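(* Let $m_1,m_2\in\mathbb{N}$, $m=m_1+m_2$, and consider the self-adjoint Dirac system $$y'(x,z)=\mathrm{i}\big(zj+jV(x)\big)y(x,z),\quad x\ge 0,\qquad j=\begin{bmatrix} I_{m_1}&0\\0&-I_{m_2}\end{bmatrix},\quad V=\begin{bmatrix}0&v\\ v^*&0\end{bmatrix},$$ where $v$ is an $m_1\times m_2$ matrix function on $\mathbb{R}_+=[0,\infty)$ and the entries of $V$ belong to $L^1(\mathbb{R}_+)$. Then the reflection coefficient $R_L(z)$ of this system exists for all $z\in\mathbb{R}$ and may be continuously extended onto $\mathbb{C}_+$ (i.e. to a continuous function on $\overline{\mathbb{C}_+}$) so that $R_L(z)$ is analytic on $\mathbb{C}_+$. Moreover, this extension is unique and the equality $R_L(z)=\varphi(z)$ holds for $z\in\mathbb{C}_+$, where $\varphi$ is the Weyl function of the system. That is, the unique analytic extension of the reflection coefficient coincides on $\mathbb{C}_+$ with the Weyl function of the Dirac system.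
   Context: $\mathbb{C}_+$ is the open upper half-plane, $\overline{\mathbb{C}_+}$ the closed upper half-plane; $y'=\frac{d}{dx}y$; $I_k$ is the $k\times k$ identity matrix. Jost solution: for $z\in\mathbb{R}$, $F_L(x,z)$ is the unique fundamental ($m\times m$ matrix) solution of the Dirac system such that $F_L(x,z)=\mathrm{e}^{\mathrm{i}xzj}(I_m+o(1))$ as $x\to\infty$. For $z\in\mathbb{R}$ put $Y(x,z)=\begin{bmatrix}Y_1(x,z)\\ Y_2(x,z)\end{bmatrix}:=F_L(x,z)\begin{bmatrix}I_{m_1}\\0\end{bmatrix}$, where $Y_1$ is $m_1\times m_1$ and $Y_2$ is $m_2\times m_1$. Reflection coefficient: $R_L(z):=Y_2(0,z)Y_1(0,z)^{-1}$, defined at those $z\in\mathbb{R}$ where $Y_1(0,z)$ is invertible. Weyl function: let $u(x,z)$ be the fundamental solution of the Dirac system with $u(0,z)=I_m$. The Weyl function of the self-adjoint Dirac system on $[0,\infty)$ (with locally summable $V$) is the $m_2\times m_1$ matrix function $\varphi$ on $\mathbb{C}_+$ such that $$\int_0^\infty\begin{bmatrix}I_{m_1}&\varphi(z)^*\end{bmatrix}u(x,z)^*u(x,z)\begin{bmatrix}I_{m_1}\\ \varphi(z)\end{bmatrix}dx<\infty,\qquad z\in\mathbb{C}_+.$$ It is known that in the self-adjoint case such $\varphi$ exists, is unique, holomorphic and contractive ($\varphi(z)^*\varphi(z)\le I_{m_1}$) on $\mathbb{C}_+$. *)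

theory Defs
  imports "HOL-Analysis.Analysis"
begin

text \<open>
  A $p \times q$ complex matrix has type \<open>complex^'q^'p\<close>. Block matrices are indexed by
  sum types, so \<open>'m1 + 'm2\<close> is the index type belonging to $m = m_1 + m_2$.
\<close>

definition adj :: "complex^'q^'p \<Rightarrow> complex^'p^'q" where
  "adj A = (\<chi> i k. cnj (A $ k $ i))"

definition vstack :: "'a^'q^'m1 \<Rightarrow> 'a^'q^'m2 \<Rightarrow> 'a^'q^('m1::finite + 'm2::finite)" where
  "vstack A B = (\<chi> i. case i of Inl a \<Rightarrow> A $ a | Inr b \<Rightarrow> B $ b)"

definition hstack :: "'a^'m1^'p \<Rightarrow> 'a^'m2^'p \<Rightarrow> 'a^('m1::finite + 'm2::finite)^'p" where
  "hstack A B = (\<chi> i k. case k of Inl a \<Rightarrow> A $ i $ a | Inr b \<Rightarrow> B $ i $ b)"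

definition upper :: "'a^'q^('m1::finite + 'm2::finite) \<Rightarrow> 'a^'q^'m1" where
  "upper A = (\<chi> a. A $ Inl a)"

definition lower :: "'a^'q^('m1::finite + 'm2::finite) \<Rightarrow> 'a^'q^'m2" where
  "lower A = (\<chi> b. A $ Inr b)"

definition dirac_j :: "complex^('m1::finite + 'm2::finite)^('m1 + 'm2)" where
  "dirac_j = vstack (hstack (mat 1) 0) (hstack 0 (- mat 1))"

definition potential ::
  "(real \<Rightarrow> complex^'m2^'m1) \<Rightarrow> real \<Rightarrow> complex^('m1::finite + 'm2::finite)^('m1 + 'm2)" where
  "potential v x = vstack (hstack 0 (v x)) (hstack (adj (v x)) 0)"

text \<open>
  The matrix exponential $\mathrm{e}^{\mathrm{i}xzj}$; as $j$ is diagonal with entries $\pm 1$,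
  it is the diagonal matrix with entries $\mathrm{e}^{\pm\mathrm{i}xz}$.
\<close>

definition exp_ixzj :: "real \<Rightarrow> complex \<Rightarrow> complex^('m1::finite + 'm2::finite)^('m1 + 'm2)" where
  "exp_ixzj x z =
     vstack (hstack (mat (exp (\<i> * of_real x * z))) 0) (hstack 0 (mat (exp (- \<i> * of_real x * z))))"

text \<open>
  The usual epsilon-delta definition: the members of \<open>D\<close> are finitely many nonoverlapping
  compact intervals \<open>{Inf K..Sup K}\<close> contained in \<open>S\<close>.
\<close>

definition abs_continuous_on :: "real set \<Rightarrow> (real \<Rightarrow> 'b::real_normed_vector) \<Rightarrow> bool" where
  "abs_continuous_on S f \<longleftrightarrow>
     (\<forall>\<epsilon>>0. \<exists>\<delta>>0. \<forall>D. D division_of \<Union>D \<and> \<Union>D \<subseteq> S \<and> (\<Sum>K\<in>D. Sup K - Inf K) < \<delta>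
        \<longrightarrow> (\<Sum>K\<in>D. norm (f (Sup K) - f (Inf K))) < \<epsilon>)"

text \<open>
  The potential is only locally summable, so solutions of $y' = \mathrm{i}(zj + jV)y$ on
  $[0,\infty)$ are locally absolutely continuous functions satisfying the equation almost
  everywhere. Functions have domain \<open>real\<close>, but only their values on $[0,\infty)$ matter.
\<close>

definition dirac_solution ::
  "(real \<Rightarrow> complex^'m2^'m1) \<Rightarrow> complex \<Rightarrow>
     (real \<Rightarrow> complex^'q^('m1::finite + 'm2::finite)) \<Rightarrow> bool" where
  "dirac_solution v z y \<longleftrightarrow>
     (\<forall>b\<ge>0. abs_continuous_on {0..b} y) \<and>
     (AE x in lebesgue. 0 \<le> x \<longrightarrow>
        (y has_vector_derivative
           mat \<i> ** (mat z ** dirac_j + dirac_j ** potential v x) ** y x) (at x within {0..}))"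

definition fundamental_solution ::
  "(real \<Rightarrow> complex^'m2^'m1) \<Rightarrow> complex \<Rightarrow>
     (real \<Rightarrow> complex^('m1::finite + 'm2::finite)^('m1 + 'm2)) \<Rightarrow> bool" where
  "fundamental_solution v z y \<longleftrightarrow> dirac_solution v z y \<and> (\<forall>x\<ge>0. invertible (y x))"

definition is_jost_solution ::
  "(real \<Rightarrow> complex^'m2^'m1) \<Rightarrow> real \<Rightarrow>
     (real \<Rightarrow> complex^('m1::finite + 'm2::finite)^('m1 + 'm2)) \<Rightarrow> bool" where
  "is_jost_solution v z F \<longleftrightarrow>
     fundamental_solution v (of_real z) F \<and>
     (\<exists>E. (E \<longlongrightarrow> 0) at_top \<and> (\<forall>x\<ge>0. F x = exp_ixzj x (of_real z) ** (mat 1 + E x)))"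

text \<open>
  A choice operator rather than a definite description, because the Jost solution is unique
  only on $[0,\infty)$.
\<close>

definition jost_solution ::
  "(real \<Rightarrow> complex^'m2^'m1) \<Rightarrow> real \<Rightarrow>
     real \<Rightarrow> complex^('m1::finite + 'm2::finite)^('m1 + 'm2)" where
  "jost_solution v z = (SOME F. is_jost_solution v z F)"

definition first_columns :: "complex^'m1^('m1::finite + 'm2::finite)" where
  "first_columns = vstack (mat 1) 0"

definition jost_Y ::
  "(real \<Rightarrow> complex^'m2^'m1) \<Rightarrow> real \<Rightarrow> real \<Rightarrow> complex^'m1^('m1::finite + 'm2::finite)" where
  "jost_Y v x z = jost_solution v z x ** first_columns"

text \<open>
  The reflection coefficient exists at \<open>z\<close> if the Jost solution exists, is determined on
  $[0,\infty)$, and $Y_1(0,z)$ is invertible; only then is \<open>reflection_coefficient v z\<close>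
  meaningful.
\<close>

definition reflection_coefficient_exists ::
  "(real \<Rightarrow> complex^('m2::finite)^('m1::finite)) \<Rightarrow> real \<Rightarrow> bool" where
  "reflection_coefficient_exists v z \<longleftrightarrow>
     (\<exists>F. is_jost_solution v z F) \<and>
     (\<forall>F G. is_jost_solution v z F \<and> is_jost_solution v z G \<longrightarrow> (\<forall>x\<ge>0. F x = G x)) \<and>
     invertible (upper (jost_Y v 0 z))"

definition reflection_coefficient ::
  "(real \<Rightarrow> complex^('m2::finite)^('m1::finite)) \<Rightarrow> real \<Rightarrow> complex^'m1^'m2" where
  "reflection_coefficient v z = lower (jost_Y v 0 z) ** matrix_inv (upper (jost_Y v 0 z))"

definition is_continuous_analytic_extension ::
  "(real \<Rightarrow> complex^'m1^'m2) \<Rightarrow> (complex \<Rightarrow> complex^('m1::finite)^('m2::finite)) \<Rightarrow> bool" where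
  "is_continuous_analytic_extension r R \<longleftrightarrow>
     continuous_on {z. 0 \<le> Im z} R \<and>
     (\<forall>i k. (\<lambda>z. R z $ i $ k) holomorphic_on {z. 0 < Im z}) \<and>
     (\<forall>t::real. R (of_real t) = r t)"

text \<open>
  The integral of the matrix function is finite when the function is (entrywise) absolutely
  integrable. The values of \<open>\<phi>\<close> outside the open upper half-plane are irrelevant.
\<close>

definition is_weyl_function ::
  "(real \<Rightarrow> complex^'m2^'m1) \<Rightarrow> (complex \<Rightarrow> complex^('m1::finite)^('m2::finite)) \<Rightarrow> bool" where
  "is_weyl_function v \<phi> \<longleftrightarrow>
     (\<forall>z. 0 < Im z \<longrightarrow>
        (\<exists>u. fundamental_solution v z u \<and> u 0 = mat 1 \<and>
           (\<lambda>x. hstack (mat 1) (adj (\<phi> z)) ** adj (u x) ** u x ** vstack (mat 1) (\<phi> z))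
             absolutely_integrable_on {0..}))"

end

(*
  For two solutions X, Y of the system at w and z one has (X* j Y)' = i (z - cnj w) X* Y. For
  w = cnj z the Wronskian X* j Y is constant, which gives invertibility and uniqueness of
  solutions without any Gronwall estimate; for w = z it shows that y* j y decreases if Im z > 0.

  A Volterra equation at infinity yields, for Im z >= 0, a solution exp(ixz) f(x,z) with
  f -> [I; 0], jointly continuous in (x,z). On the real line it is the first block column of the
  Jost solution, and for Im z > 0 it is square integrable. Monotonicity of y* j y makes the upper
  block of f(0,z) invertible, so R = f_2(0,z) f_1(0,z)^{-1} extends the reflection coefficient
  continuously to the closed half-plane and is the Weyl function on the open one. Pairing with
  the decaying solution at cnj z0 writes (R(z) - R(z0)) / (z - z0) as a convergent integral that
  is continuous in z, hence R is analytic. The extension is unique by Schwarz reflection.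
*)
theory Submission
  imports Defs "HOL-Complex_Analysis.Conformal_Mappings"
begin

section \<open>Absolutely continuous functions\<close>

text \<open>The potential is merely integrable, so solutions satisfy the system only almost
  everywhere and every differential identity must be integrated through absolute continuity. Hence
  differentiation of integrals and the fundamental theorem come first; both are obtained from the
  gauge integral. Factoring out exp(ixz) is what lets one family serve the whole closed half-plane:
  the remaining free evolution is diag(1, exp(-2ixz)), whose entries have modulus at most 1 for x <=
  0 and Im z >= 0. The Volterra kernel only involves the argument x - t <= 0, so all estimates are
  uniform in z, and continuity up to the real line comes from uniform convergence of the iterates.
  Analyticity is not read off these iterates: the Wronskian identity already exhibits the difference
  quotient of R, so continuity in z is all that is ever required of f. The boundary term at infinity
  vanishes even for real z, because the second solution decays like exp(-x Im z0).\<close>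

lemma lmeasurable_cover_up_to_negligible:
  assumes U: "U \<in> lmeasurable" "measure lebesgue U \<le> \<eta>" and neg: "negligible (B - U)"
  shows "\<exists>T. B \<subseteq> T \<and> T \<in> lmeasurable \<and> measure lebesgue T \<le> \<eta>"
proof (intro exI conjI)
  show "B \<subseteq> U \<union> (B - U)" by blast
  show "U \<union> (B - U) \<in> lmeasurable"
    by (intro fmeasurable.Un U negligible_imp_measurable neg)
  have "measure lebesgue (U \<union> (B - U)) = measure lebesgue U"
    by (rule measure_Un_null_set) (use U neg in \<open>auto simp: negligible_iff_null_sets fmeasurableD\<close>)
  then show "measure lebesgue (U \<union> (B - U)) \<le> \<eta>" using U by simp
qed

text \<open>
  A disjoint Vitali subfamily of the offending intervals is a tagged partial division, so
  Henstock's lemma bounds its total length.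
\<close>

lemma negligible_large_difference_quotients:
  fixes f :: "real \<Rightarrow> 'a::euclidean_space"
  assumes f: "f integrable_on {a..b}" and e: "e > 0"
  shows "negligible {x. \<forall>d>0. \<exists>u v. a \<le> u \<and> u \<le> x \<and> x \<le> v \<and> v \<le> b \<and> u < v \<and> v - u < d \<and>
           e * (v - u) < norm ((v - u) *\<^sub>R f x - integral {u..v} f)}" (is "negligible ?B")
  unfolding negligible_outer_le
proof (intro allI impI)
  fix \<eta> :: real assume "\<eta> > 0"
  \<comment> \<open>Each offending interval contributes more than \<open>e\<close> times its length
    to the Henstock sum, so the tolerance \<open>e * \<eta>\<close> bounds the total length by
    \<open>\<eta>\<close>.\<close>
  with e have "e * \<eta> > 0" by simp
  then obtain \<gamma> where \<gamma>: "gauge \<gamma>"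
    and H: "\<And>p. \<lbrakk>p tagged_partial_division_of (cbox a b); \<gamma> fine p\<rbrakk> \<Longrightarrow>
              (\<Sum>(x,k)\<in>p. norm (measure lborel k *\<^sub>R f x - integral k f)) < e * \<eta>"
    using Henstock_lemma[OF f[folded box_real(2)]] by blast
  define I where "I = (\<lambda>(x::real,u::real,v::real). {u..v})"
  define K where "K = {(x,u,v). a \<le> u \<and> u \<le> x \<and> x \<le> v \<and> v \<le> b \<and> u < v \<and> {u..v} \<subseteq> \<gamma> x \<and>
           e * (v - u) < norm ((v - u) *\<^sub>R f x - integral {u..v} f)}"
  \<comment> \<open>Vitali's theorem is phrased for closed balls; \<open>c\<close> and
    \<open>r\<close> present each interval as the ball with the same points.\<close>
  define c where "c = (\<lambda>(x::real,u::real,v::real). (u + v) / 2)"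
  define r where "r = (\<lambda>(x::real,u::real,v::real). (v - u) / 2)"
  have cb: "cball (c i) (r i) = I i" for i
    by (cases i) (auto simp: c_def r_def I_def cball_eq_atLeastAtMost field_simps)
  have fine: "\<exists>i. i \<in> K \<and> x \<in> cball (c i) (r i) \<and> r i < d" if x: "x \<in> ?B" and d: "d > 0" for x d
  proof -
    obtain \<rho> where \<rho>: "\<rho> > 0" "ball x \<rho> \<subseteq> \<gamma> x"
      using \<gamma> by (meson gauge_def openE)
    obtain u v where uv: "a \<le> u" "u \<le> x" "x \<le> v" "v \<le> b" "u < v" "v - u < min d \<rho>"
      "e * (v - u) < norm ((v - u) *\<^sub>R f x - integral {u..v} f)"
      using x d \<rho>(1) by (force dest: spec[of _ "min d \<rho>"])
    have "{u..v} \<subseteq> \<gamma> x"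
      using \<rho>(2) uv by (auto simp: dist_real_def subset_eq)
    then have "(x,u,v) \<in> K"
      using uv by (auto simp: K_def)
    moreover have "x \<in> cball (c (x,u,v)) (r (x,u,v))"
      unfolding cb I_def using uv by simp
    moreover have "r (x,u,v) < d" using uv by (simp add: r_def)
    ultimately show ?thesis by blast
  qed
  have rpos: "\<And>i. i \<in> K \<Longrightarrow> 0 < r i" by (auto simp: K_def r_def)
  obtain C where C: "countable C" "C \<subseteq> K"
    and disj: "pairwise (\<lambda>i j. disjnt (I i) (I j)) C"
    and neg: "negligible (?B - (\<Union>i\<in>C. I i))"
    using Vitali_covering_theorem_cballs[of K r ?B c, OF rpos fine] unfolding cb by blast
  have meas: "I i \<in> lmeasurable" for i by (cases i) (simp add: I_def)
  have bound: "measure lebesgue (\<Union>i\<in>D. I i) \<le> \<eta>" if D: "D \<subseteq> C" "finite D" for D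
  proof -
    define p where "p = (\<lambda>(x,u,v). (x,{u..v::real})) ` D"
    have inj: "inj_on (\<lambda>(x,u,v). (x,{u..v::real})) D"
      using D C(2) by (auto simp: inj_on_def K_def Icc_eq_Icc)
    have p: "p tagged_partial_division_of (cbox a b)"
      unfolding tagged_partial_division_of_def
    proof (intro conjI allI impI)
      show "finite p" using D by (simp add: p_def)
    next
      fix x k assume "(x,k) \<in> p"
      then obtain u v where "(x,u,v) \<in> K" "k = {u..v}" using D C(2) by (auto simp: p_def)
      then show "x \<in> k" "k \<subseteq> cbox a b" "\<exists>a b. k = cbox a b"
        by (auto simp: K_def intro: box_real(2)[symmetric])
    next
      fix x1 K1 x2 K2 assume *: "(x1, K1) \<in> p \<and> (x2, K2) \<in> p \<and> (x1, K1) \<noteq> (x2, K2)"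
      then obtain i j where ij: "i \<in> D" "j \<in> D" "K1 = I i" "K2 = I j" "i \<noteq> j"
        by (fastforce simp: p_def I_def)
      then have "disjnt K1 K2" using disj D(1) by (auto simp: pairwise_def)
      then show "interior K1 \<inter> interior K2 = {}"
        unfolding disjnt_def using interior_subset by blast
    qed
    have "\<gamma> fine p" unfolding fine_def p_def using D C(2) by (auto simp: K_def)
    then have less: "(\<Sum>(x,k)\<in>p. norm (measure lborel k *\<^sub>R f x - integral k f)) < e * \<eta>" using H p by blast
    have "e * (\<Sum>(x,u,v)\<in>D. v - u) = (\<Sum>(x,u,v)\<in>D. e * (v - u))"
      by (simp add: sum_distrib_left case_prod_unfold)
    also have "\<dots> \<le> (\<Sum>(x,u,v)\<in>D. norm ((v - u) *\<^sub>R f x - integral {u..v} f))"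
    proof (intro sum_mono)
      fix i assume "i \<in> D"
      then have "i \<in> K" using D C(2) by blast
      then show "(case i of (x,u,v) \<Rightarrow> e * (v - u)) \<le> (case i of (x,u,v) \<Rightarrow> norm ((v - u) *\<^sub>R f x - integral {u..v} f))"
        by (auto simp: K_def less_imp_le)
    qed
    also have "\<dots> = (\<Sum>(x,k)\<in>p. norm (measure lborel k *\<^sub>R f x - integral k f))"
      unfolding p_def
    proof (subst sum.reindex[OF inj], intro sum.cong refl)
      fix i assume "i \<in> D"
      obtain x u v where i: "i = (x,u,v)" by (metis surj_pair)
      with \<open>i \<in> D\<close> D C(2) have "u < v" by (auto simp: K_def)
      then show "(case i of (x, u, v) \<Rightarrow> norm ((v - u) *\<^sub>R f x - integral {u..v} f)) =
         ((\<lambda>(x, k). norm (measure lborel k *\<^sub>R f x - integral k f)) \<circ> (\<lambda>(x, u, v). (x, {u..v}))) i"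
        by (simp add: i)
    qed
    finally have "e * (\<Sum>(x,u,v)\<in>D. v - u) \<le> e * \<eta>" using less by linarith
    then have "(\<Sum>(x,u,v)\<in>D. v - u) \<le> \<eta>" using e by simp
    moreover have "measure lebesgue (\<Union>i\<in>D. I i) \<le> (\<Sum>i\<in>D. measure lebesgue (I i))"
      using D(2) meas by (intro measure_UNION_le) (auto intro: fmeasurableD)
    moreover have "(\<Sum>i\<in>D. measure lebesgue (I i)) = (\<Sum>(x,u,v)\<in>D. v - u)"
      using D C(2) by (intro sum.cong) (auto simp: I_def K_def)
    ultimately show ?thesis by linarith
  qed
  have U: "(\<Union>i\<in>C. I i) \<in> lmeasurable" "measure lebesgue (\<Union>i\<in>C. I i) \<le> \<eta>"
    using fmeasurable_UN_bound[OF C(1), of I lebesgue \<eta>] measure_UN_bound[OF C(1), of I lebesgue \<eta>] meas bound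
    by blast+
  show "\<exists>T. ?B \<subseteq> T \<and> T \<in> lmeasurable \<and> measure lebesgue T \<le> \<eta>"
    by (rule lmeasurable_cover_up_to_negligible[OF U neg])
qed

text \<open>Countably many tolerances 1/(n+1) suffice, so the union of their exceptional sets is
  still negligible. Outside it, intervals with one endpoint at \<open>x\<close> control both
  one-sided difference quotients.\<close>

theorem integral_has_vector_derivative_ae:
  fixes f :: "real \<Rightarrow> 'a::euclidean_space"
  assumes f: "f integrable_on {a..b}"
  obtains N where "negligible N"
    "\<And>x. \<lbrakk>a < x; x < b; x \<notin> N\<rbrakk> \<Longrightarrow> ((\<lambda>x. integral {a..x} f) has_vector_derivative f x) (at x)"
proof -
  define B where "B e = {x. \<forall>d>0. \<exists>u v. a \<le> u \<and> u \<le> x \<and> x \<le> v \<and> v \<le> b \<and> u < v \<and> v - u < d \<and>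
           e * (v - u) < norm ((v - u) *\<^sub>R f x - integral {u..v} f)}" for e
  define N where "N = (\<Union>n. B (inverse (real (Suc n))))"
  have "negligible N"
    unfolding N_def
  proof (intro negligible_countable_Union)
    fix X assume "X \<in> range (\<lambda>n. B (inverse (real (Suc n))))"
    then obtain n where "X = B (inverse (real (Suc n)))" by blast
    then show "negligible X" using negligible_large_difference_quotients[OF f, of "inverse (real (Suc n))"]
      by (simp add: B_def del: of_nat_Suc)
  qed simp
  moreover have "((\<lambda>x. integral {a..x} f) has_vector_derivative f x) (at x)"
    if x: "a < x" "x < b" "x \<notin> N" for x
    unfolding has_vector_derivative_def has_derivative_at_alt
  proof (intro conjI allI impI)
    show "bounded_linear (\<lambda>y. y *\<^sub>R f x)" by (rule bounded_linear_scaleR_left)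
  next
    fix e :: real assume "e > 0"
    then obtain n where n: "inverse (real (Suc n)) < e" using reals_Archimedean by blast
    let ?e = "inverse (real (Suc n))"
    from x(3) obtain d where d: "d > 0" and
      D: "\<And>u v. \<lbrakk>a \<le> u; u \<le> x; x \<le> v; v \<le> b; u < v; v - u < d\<rbrakk> \<Longrightarrow>
           norm ((v - u) *\<^sub>R f x - integral {u..v} f) \<le> ?e * (v - u)"
      unfolding N_def B_def by (auto simp: not_less) (metis not_less)
    have comb: "integral {a..u} f + integral {u..v} f = integral {a..v} f" if "a \<le> u" "u \<le> v" "v \<le> b" for u v
      using that by (intro Henstock_Kurzweil_Integration.integral_combine integrable_subinterval_real[OF f]) auto
    show "\<exists>d>0. \<forall>y. norm (y - x) < d \<longrightarrow>
             norm (integral {a..y} f - integral {a..x} f - (y - x) *\<^sub>R f x) \<le> e * norm (y - x)"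
    proof (intro exI[of _ "min d (min (x - a) (b - x))"] conjI allI impI)
      show "0 < min d (min (x - a) (b - x))" using d x by simp
    next
      fix y assume y: "norm (y - x) < min d (min (x - a) (b - x))"
      consider "y = x" | "y < x" | "x < y" by linarith
      then have "norm (integral {a..y} f - integral {a..x} f - (y - x) *\<^sub>R f x) \<le> ?e * norm (y - x)"
      proof cases
        case 2
        then have "norm ((x - y) *\<^sub>R f x - integral {y..x} f) \<le> ?e * (x - y)"
          using y x by (intro D) (auto simp: abs_if split: if_splits)
        moreover have "integral {a..y} f - integral {a..x} f - (y - x) *\<^sub>R f x = (x - y) *\<^sub>R f x - integral {y..x} f"
          using comb[of y x] 2 y x by (auto simp: algebra_simps abs_if split: if_splits)
        ultimately show ?thesis using 2 by simp
      next
        case 3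
        then have "norm ((y - x) *\<^sub>R f x - integral {x..y} f) \<le> ?e * (y - x)"
          using y x by (intro D) (auto simp: abs_if split: if_splits)
        moreover have "integral {a..y} f - integral {a..x} f - (y - x) *\<^sub>R f x = - ((y - x) *\<^sub>R f x - integral {x..y} f)"
          using comb[of x y] 3 y x by (auto simp: algebra_simps abs_if split: if_splits)
        ultimately have "norm (integral {a..y} f - integral {a..x} f - (y - x) *\<^sub>R f x) \<le> ?e * (y - x)"
          by (metis norm_minus_cancel)
        then show ?thesis using 3 by simp
      qed simp
      also have "\<dots> \<le> e * norm (y - x)" using n by (intro mult_right_mono) auto
      finally show "norm (integral {a..y} f - integral {a..x} f - (y - x) *\<^sub>R f x) \<le> e * norm (y - x)" .
    qed
  qed
  ultimately show ?thesis using that by blast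
qed

text \<open>
  No Vitali covering is needed for the gauge integral: intervals tagged in \<open>N\<close> are
  forced into an open set of small measure, where absolute continuity controls the increments.
\<close>

theorem fundamental_theorem_of_calculus_abs_continuous:
  fixes f :: "real \<Rightarrow> 'a::euclidean_space"
  assumes ac: "abs_continuous_on {a..b} f" and ab: "a \<le> b" and N: "negligible N"
    and deriv: "\<And>x. x \<in> {a..b} - N \<Longrightarrow> (f has_vector_derivative g x) (at x within {a..b})"
  shows "(g has_integral (f b - f a)) {a..b}"
proof -
  \<comment> \<open>Zeroing the derivative on \<open>N\<close> does not affect the integral, and at
    tags in \<open>N\<close> it leaves only the increment of \<open>f\<close> to be
    estimated.\<close>
  define g' where "g' x = (if x \<in> N then 0 else g x)" for x
  have "(g' has_integral (f b - f a)) {a..b}"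
    unfolding has_integral_real
  proof (intro allI impI)
    fix e :: real assume e: "e > 0"
    then obtain \<delta> where \<delta>: "\<delta> > 0" and
      AC: "\<And>D. \<lbrakk>D division_of \<Union>D; \<Union>D \<subseteq> {a..b}; (\<Sum>K\<in>D. Sup K - Inf K) < \<delta>\<rbrakk> \<Longrightarrow>
             (\<Sum>K\<in>D. norm (f (Sup K) - f (Inf K))) < e / 2"
      using ac[unfolded abs_continuous_on_def, rule_format, of "e/2"] by auto
    obtain T where T: "open T" "N \<subseteq> T" "T \<in> lmeasurable" "measure lebesgue T < \<delta>"
    proof -
      obtain T where T: "open T" "N \<subseteq> T" "(T - N) \<in> lmeasurable" "emeasure lebesgue (T - N) < ennreal \<delta>"
        using sets_lebesgue_outer_open[OF negligible_imp_sets[OF N] \<delta>] by blast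
      have eq: "T = (T - N) \<union> N" using T by blast
      have lm: "T \<in> lmeasurable"
        by (subst eq) (intro fmeasurable.Un T negligible_imp_measurable N)
      have "measure lebesgue T = measure lebesgue (T - N)"
        unfolding arg_cong[OF eq, of "measure lebesgue"]
        by (rule measure_Un_null_set) (use N T(3) in \<open>auto simp: negligible_iff_null_sets fmeasurableD\<close>)
      also have "\<dots> < \<delta>" using T(3,4) \<delta> by (simp add: emeasure_eq_measure2 ennreal_less_iff)
      finally show ?thesis using that T lm by blast
    qed
    \<comment> \<open>The \<open>+ 1\<close> keeps the denominator positive when
      \<open>a = b\<close>.\<close>
    define \<epsilon> where "\<epsilon> = e / (2 * (b - a + 1))"
    have \<epsilon>: "\<epsilon> > 0" using e ab by (simp add: \<epsilon>_def)
    have "\<forall>x. \<exists>d>0. x \<in> {a..b} - N \<longrightarrow>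
         (\<forall>y\<in>{a..b}. norm (y-x) < d \<longrightarrow> norm (f y - f x - (y-x) *\<^sub>R g x) \<le> \<epsilon> * norm (y-x))"
      using deriv[unfolded has_vector_derivative_def has_derivative_within_alt] \<epsilon>
      by (metis zero_less_one)
    then obtain d where d: "\<And>x. 0 < d x"
                 "\<And>x y. \<lbrakk>x \<in> {a..b} - N; y \<in> {a..b}; norm (y-x) < d x\<rbrakk>
                        \<Longrightarrow> norm (f y - f x - (y-x) *\<^sub>R g x) \<le> \<epsilon> * norm (y-x)"
      by metis
    define \<gamma> where "\<gamma> x = (if x \<in> N then T else ball x (d x))" for x
    have gauge: "gauge \<gamma>" unfolding gauge_def \<gamma>_def using T d(1) by auto
    have main: "norm ((\<Sum>(x,k)\<in>p. measure lborel k *\<^sub>R g' x) - (f b - f a)) < e"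
      if p: "p tagged_division_of {a..b}" and fine: "\<gamma> fine p" for p
    proof -
      define q where "q = {(x,k)\<in>p. x \<in> N}"
      have finp: "finite p" by (rule tagged_division_of_finite[OF p])
      have kuv: "\<exists>u v. k = {u..v} \<and> u \<le> x \<and> x \<le> v \<and> a \<le> u \<and> v \<le> b" if xk: "(x,k) \<in> p" for x k
      proof -
        obtain u v where "k = cbox u v" using xk tagged_division_ofD(4)[OF p] by blast
        moreover have "x \<in> k" "k \<subseteq> {a..b}" using xk tagged_division_ofD(2,3)[OF p] by blast+
        ultimately show ?thesis by (intro exI[of _ u] exI[of _ v]) auto
      qed
      have qp: "q tagged_partial_division_of {a..b}"
      proof (rule tagged_partial_division_subset)
        show "p tagged_partial_division_of {a..b}" using p unfolding tagged_division_of_def by blast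
        show "q \<subseteq> p" by (auto simp: q_def)
      qed
      have small: "(\<Sum>(x,k)\<in>q. norm (f (Sup k) - f (Inf k))) < e / 2"
      proof -
        define D where "D = snd ` q"
        have Ddiv: "D division_of \<Union>D" unfolding D_def by (rule partial_division_of_tagged_division[OF qp])
        have Dsub: "\<Union>D \<subseteq> {a..b}"
          using tagged_partial_division_ofD(3)[OF qp] by (fastforce simp: D_def)
        have DT: "\<Union>D \<subseteq> T" using fine unfolding D_def q_def fine_def \<gamma>_def by fastforce
        have ne: "k \<noteq> {}" if "k \<in> D" for k using that tagged_partial_division_ofD(2)[OF qp] by (fastforce simp: D_def)
        have ex: "\<exists>u v. k = {u..v} \<and> u \<le> v" if "k \<in> D" for k
          using that kuv unfolding D_def q_def by fastforce
        have "(\<Sum>K\<in>D. Sup K - Inf K) = (\<Sum>K\<in>D. measure lebesgue K)"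
        proof (intro sum.cong refl)
          fix k assume "k \<in> D"
          then obtain u v where "k = {u..v}" "u \<le> v" using ex by blast
          then show "Sup k - Inf k = measure lebesgue k" by simp
        qed
        also have "\<dots> = measure lebesgue (\<Union>D)" by (rule content_division[OF Ddiv])
        also have "\<dots> \<le> measure lebesgue T"
          by (intro measure_mono_fmeasurable DT T fmeasurableD lmeasurable_division[OF Ddiv])
        also have "\<dots> < \<delta>" by (rule T)
        finally have lt: "(\<Sum>K\<in>D. norm (f (Sup K) - f (Inf K))) < e / 2"
          using AC Ddiv Dsub by blast
        \<comment> \<open>A degenerate interval may occur in \<open>q\<close> with several tags but
          only once in \<open>D\<close>, so the two sums agree only if the summand vanishes on
          degenerate intervals. The default 0 settles the empty set, where \<open>Sup\<close> and
          \<open>Inf\<close> mean nothing.\<close>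
        define \<phi> where "\<phi> k = (if k = {} then 0 else norm (f (Sup k) - f (Inf k)))" for k
        have "(\<Sum>(x,k)\<in>q. norm (f (Sup k) - f (Inf k))) = (\<Sum>(x,k)\<in>q. \<phi> k)"
          using ne by (intro sum.cong refl) (force simp: \<phi>_def D_def)
        also have "\<dots> = (\<Sum>k\<in>D. \<phi> k)" unfolding D_def
        proof (rule sum.over_tagged_division_lemma[OF tagged_partial_division_of_Union_self[OF qp]])
          fix u v :: real assume "box u v = {}"
          then show "\<phi> (cbox u v) = 0" by (cases "u = v") (auto simp: \<phi>_def)
        qed
        also have "\<dots> = (\<Sum>K\<in>D. norm (f (Sup K) - f (Inf K)))"
          using ne by (intro sum.cong refl) (force simp: \<phi>_def)
        finally show ?thesis using lt by simp
      qed
      have "norm ((\<Sum>(x,k)\<in>p. measure lborel k *\<^sub>R g' x) - (f b - f a)) =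
            norm (\<Sum>(x,k)\<in>p. measure lborel k *\<^sub>R g' x - (f (Sup k) - f (Inf k)))"
        using additive_tagged_division_1[OF ab p, of f]
        by (simp add: sum_subtractf case_prod_unfold)
      also have "\<dots> \<le> (\<Sum>(x,k)\<in>p. (if x \<in> N then norm (f (Sup k) - f (Inf k)) else 0) + \<epsilon> * (Sup k - Inf k))"
      proof (intro sum_norm_le, clarify)
        fix x k assume xk: "(x,k) \<in> p"
        then obtain u v where uv: "k = {u..v}" "u \<le> x" "x \<le> v" "a \<le> u" "v \<le> b" using kuv by blast
        show "norm (measure lborel k *\<^sub>R g' x - (f (Sup k) - f (Inf k))) \<le>
              (if x \<in> N then norm (f (Sup k) - f (Inf k)) else 0) + \<epsilon> * (Sup k - Inf k)"
        proof (cases "x \<in> N")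
          case True
          then show ?thesis using uv \<epsilon> by (simp add: g'_def norm_minus_commute)
        next
          case False
          have sub: "k \<subseteq> ball x (d x)" using fineD[OF fine xk] False by (simp add: \<gamma>_def)
          have "norm ((v - u) *\<^sub>R g x - (f v - f u)) =
                norm ((f u - f x - (u - x) *\<^sub>R g x) - (f v - f x - (v - x) *\<^sub>R g x))"
            by (auto simp: algebra_simps)
          also have "\<dots> \<le> norm (f u - f x - (u - x) *\<^sub>R g x) + norm (f v - f x - (v - x) *\<^sub>R g x)"
            by (rule norm_triangle_ineq4)
          also have "\<dots> \<le> \<epsilon> * norm (u - x) + \<epsilon> * norm (v - x)"
          proof -
            have "u \<in> k" "v \<in> k" using uv by auto
            then have "u \<in> ball x (d x)" "v \<in> ball x (d x)" using sub by blast+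
            then show ?thesis
              using uv False by (intro add_mono d) (auto simp: dist_real_def)
          qed
          also have "\<dots> = \<epsilon> * (v - u)" using uv by (simp add: algebra_simps)
          finally show ?thesis using uv False by (simp add: g'_def)
        qed
      qed
      also have "\<dots> = (\<Sum>(x,k)\<in>q. norm (f (Sup k) - f (Inf k))) + \<epsilon> * (\<Sum>(x,k)\<in>p. Sup k - Inf k)"
      proof -
        have "(\<Sum>(x,k)\<in>p. if x \<in> N then norm (f (Sup k) - f (Inf k)) else 0) =
              (\<Sum>(x,k)\<in>q. norm (f (Sup k) - f (Inf k)))"
          unfolding q_def using finp by (intro sum.mono_neutral_cong_right) (auto split: if_splits)
        then show ?thesis by (simp add: sum.distrib sum_distrib_left case_prod_unfold)
      qed
      also have "(\<Sum>(x,k)\<in>p. Sup k - Inf k) = b - a"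
        using additive_tagged_division_1[OF ab p, of "\<lambda>x. x"] by simp
      finally have le: "norm ((\<Sum>(x,k)\<in>p. measure lborel k *\<^sub>R g' x) - (f b - f a)) \<le>
          (\<Sum>(x,k)\<in>q. norm (f (Sup k) - f (Inf k))) + \<epsilon> * (b - a)" .
      have *: "e / (2 * c) * c = e / 2" if "c \<noteq> 0" for c using that by simp
      have eq: "\<epsilon> * (b - a + 1) = e / 2"
        unfolding \<epsilon>_def by (rule *) (use ab in simp)
      have "\<epsilon> * (b - a) \<le> \<epsilon> * (b - a + 1)" using \<epsilon> by simp
      then show ?thesis using small le eq by linarith
    qed
    show "\<exists>\<gamma>. gauge \<gamma> \<and> (\<forall>p. p tagged_division_of {a..b} \<and> \<gamma> fine p \<longrightarrow>
        norm ((\<Sum>(x,k)\<in>p. measure lborel k *\<^sub>R g' x) - (f b - f a)) < e)"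
      using gauge main by (intro exI[of _ \<gamma>] conjI allI impI) (simp_all only:)
  qed
  then show ?thesis
    by (rule has_integral_spike[OF N, rotated]) (simp add: g'_def)
qed

section \<open>Closure properties of absolute continuity\<close>

lemma abs_continuous_on_subset:
  assumes "abs_continuous_on S f" "T \<subseteq> S"
  shows "abs_continuous_on T f"
  using assms unfolding abs_continuous_on_def by (meson order_trans)

text \<open>Products, differences and Lipschitz images are all reduced to this comparison of
  increments; two dominating functions are allowed for the sake of products.\<close>

lemma abs_continuous_on_dominated:
  fixes f :: "real \<Rightarrow> 'b::real_normed_vector" and h :: "real \<Rightarrow> 'c::real_normed_vector"
  assumes h: "abs_continuous_on S h" and g: "abs_continuous_on S g" and C: "C \<ge> 0"
    and le: "\<And>u v. \<lbrakk>{u..v} \<subseteq> S; u \<le> v\<rbrakk> \<Longrightarrow> norm (f v - f u) \<le> C * (norm (h v - h u) + norm (g v - g u))"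
  shows "abs_continuous_on S f"
  unfolding abs_continuous_on_def
proof (intro allI impI)
  fix \<epsilon> :: real assume "\<epsilon> > 0"
  \<comment> \<open>Using \<open>C + 1\<close> in place of \<open>C\<close> covers
    \<open>C = 0\<close> and makes the final inequality strict.\<close>
  define e where "e = \<epsilon> / (2 * (C + 1))"
  have e1: "e > 0" using \<open>\<epsilon> > 0\<close> C by (simp add: e_def)
  have "c * (\<epsilon> / (2 * c) + \<epsilon> / (2 * c)) = \<epsilon>" if "c \<noteq> 0" for c :: real using that by (simp add: field_simps)
  from this[of "C + 1"] C have "(C + 1) * (e + e) = \<epsilon>" by (simp add: e_def)
  moreover have "C * (e + e) < (C + 1) * (e + e)" using e1 by simp
  ultimately have e: "e > 0" "C * (e + e) < \<epsilon>" using e1 by simp_all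
  obtain \<delta>1 where \<delta>1: "\<delta>1 > 0" "\<And>D. \<lbrakk>D division_of \<Union>D; \<Union>D \<subseteq> S; (\<Sum>K\<in>D. Sup K - Inf K) < \<delta>1\<rbrakk> \<Longrightarrow>
             (\<Sum>K\<in>D. norm (h (Sup K) - h (Inf K))) < e"
    using h[unfolded abs_continuous_on_def, rule_format, OF e(1)] by auto
  obtain \<delta>2 where \<delta>2: "\<delta>2 > 0" "\<And>D. \<lbrakk>D division_of \<Union>D; \<Union>D \<subseteq> S; (\<Sum>K\<in>D. Sup K - Inf K) < \<delta>2\<rbrakk> \<Longrightarrow>
             (\<Sum>K\<in>D. norm (g (Sup K) - g (Inf K))) < e"
    using g[unfolded abs_continuous_on_def, rule_format, OF e(1)] by auto
  show "\<exists>\<delta>>0. \<forall>D. D division_of \<Union>D \<and> \<Union>D \<subseteq> S \<and> (\<Sum>K\<in>D. Sup K - Inf K) < \<delta>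
        \<longrightarrow> (\<Sum>K\<in>D. norm (f (Sup K) - f (Inf K))) < \<epsilon>"
  proof (intro exI[of _ "min \<delta>1 \<delta>2"] conjI allI impI)
    show "0 < min \<delta>1 \<delta>2" using \<delta>1 \<delta>2 by simp
  next
    fix D assume D: "D division_of \<Union>D \<and> \<Union>D \<subseteq> S \<and> (\<Sum>K\<in>D. Sup K - Inf K) < min \<delta>1 \<delta>2"
    have "(\<Sum>K\<in>D. norm (f (Sup K) - f (Inf K))) \<le>
          (\<Sum>K\<in>D. C * (norm (h (Sup K) - h (Inf K)) + norm (g (Sup K) - g (Inf K))))"
    proof (rule sum_mono)
      fix K assume K: "K \<in> D"
      obtain u v where uv: "K = cbox u v" "K \<noteq> {}"
        using D K division_ofD(3,4)[of D "\<Union>D" K] by blast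
      then have "K = {u..v}" "u \<le> v" "{u..v} \<subseteq> S" using D K by auto
      then show "norm (f (Sup K) - f (Inf K)) \<le> C * (norm (h (Sup K) - h (Inf K)) + norm (g (Sup K) - g (Inf K)))"
        using le by simp
    qed
    also have "\<dots> = C * ((\<Sum>K\<in>D. norm (h (Sup K) - h (Inf K))) + (\<Sum>K\<in>D. norm (g (Sup K) - g (Inf K))))"
      by (simp only: sum_distrib_left[symmetric] sum.distrib)
    also have "\<dots> \<le> C * (e + e)"
      using D C \<delta>1(2)[of D] \<delta>2(2)[of D] by (intro mult_left_mono add_mono) auto
    also have "\<dots> < \<epsilon>" by (rule e)
    finally show "(\<Sum>K\<in>D. norm (f (Sup K) - f (Inf K))) < \<epsilon>" .
  qed
qed

lemma abs_continuous_on_ident: "abs_continuous_on S (\<lambda>x::real. x)"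
  unfolding abs_continuous_on_def
proof (intro allI impI)
  fix \<epsilon> :: real assume "\<epsilon> > 0"
  have "(\<Sum>K\<in>D. norm (Sup K - Inf K)) = (\<Sum>K\<in>D. Sup K - Inf K)" if D: "D division_of \<Union>D" for D :: "real set set"
  proof (rule sum.cong[OF refl])
    fix K assume "K \<in> D"
    then obtain u v where uv: "K = cbox u v" "K \<noteq> {}"
      using division_ofD(3,4)[OF D] by blast
    then show "norm (Sup K - Inf K) = Sup K - Inf K" by simp
  qed
  then show "\<exists>\<delta>>0. \<forall>D. D division_of \<Union>D \<and> \<Union>D \<subseteq> S \<and> (\<Sum>K\<in>D. Sup K - Inf K) < \<delta>
        \<longrightarrow> (\<Sum>K\<in>D. norm (Sup K - Inf K)) < \<epsilon>"
    using \<open>\<epsilon> > 0\<close> by (intro exI[of _ \<epsilon>]) auto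
qed

lemma abs_continuous_on_const: "abs_continuous_on S (\<lambda>x. c)"
  unfolding abs_continuous_on_def by (auto intro: exI[of _ 1])

lemma abs_continuous_on_imp_continuous_on:
  assumes "abs_continuous_on {a..b} f"
  shows "continuous_on {a..b} f"
  unfolding continuous_on_iff
proof (intro ballI allI impI)
  fix x e :: real assume x: "x \<in> {a..b}" and e: "e > 0"
  obtain \<delta> where \<delta>: "\<delta> > 0" "\<And>D. \<lbrakk>D division_of \<Union>D; \<Union>D \<subseteq> {a..b}; (\<Sum>K\<in>D. Sup K - Inf K) < \<delta>\<rbrakk> \<Longrightarrow>
             (\<Sum>K\<in>D. norm (f (Sup K) - f (Inf K))) < e"
    using assms[unfolded abs_continuous_on_def, rule_format, OF e] by auto
  have *: "norm (f v - f u) < e" if "a \<le> u" "u \<le> v" "v \<le> b" "v - u < \<delta>" for u v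
  proof -
    have "{{u..v}} division_of \<Union>{{u..v}}"
      using division_of_self[of u v] that by simp
    from \<delta>(2)[OF this] that show ?thesis by simp
  qed
  show "\<exists>d>0. \<forall>x'\<in>{a..b}. dist x' x < d \<longrightarrow> dist (f x') (f x) < e"
  proof (intro exI[of _ \<delta>] conjI ballI impI \<delta>(1))
    fix y assume y: "y \<in> {a..b}" "dist y x < \<delta>"
    show "dist (f y) (f x) < e"
      using *[of x y] *[of y x] x y
      by (cases "x \<le> y") (auto simp: dist_norm norm_minus_commute abs_if split: if_splits)
  qed
qed

lemma continuous_on_halfline:
  fixes f :: "real \<Rightarrow> 'a::topological_space"
  assumes "\<And>b. 0 \<le> b \<Longrightarrow> continuous_on {0..b} f"
  shows "continuous_on {0..} f"
proof -
  have "continuous (at x within {0..}) f" if "0 \<le> x" for x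
  proof -
    have "continuous (at x within {0..x+1}) f"
      using assms[of "x + 1"] that by (simp add: continuous_on_eq_continuous_within)
    moreover have "at x within {0..x+1} = at x within {0..}"
      by (rule at_within_nhd[of _ "{..<x+1}"]) auto
    ultimately show ?thesis by simp
  qed
  then show ?thesis by (simp add: continuous_on_eq_continuous_within)
qed

lemma abs_continuous_on_bilinear:
  assumes h: "bounded_bilinear h"
    and f: "abs_continuous_on {a..b} f" and g: "abs_continuous_on {a..b} g"
  shows "abs_continuous_on {a..b} (\<lambda>x. h (f x) (g x))"
proof -
  interpret bounded_bilinear h by fact
  obtain K where K: "K \<ge> 0" "\<And>a b. norm (h a b) \<le> norm a * norm b * K"
    using nonneg_bounded by blast
  have "bounded (f ` {a..b})" "bounded (g ` {a..b})"
    using abs_continuous_on_imp_continuous_on f g compact_continuous_image compact_imp_bounded compact_Icc by blast+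
  then obtain M M' where M0: "\<And>x. x \<in> {a..b} \<Longrightarrow> norm (f x) \<le> M" "\<And>x. x \<in> {a..b} \<Longrightarrow> norm (g x) \<le> M'"
    unfolding bounded_iff by (meson imageI)
  define N where "N = max 0 (max M M')"
  have M: "N \<ge> 0" "\<And>x. x \<in> {a..b} \<Longrightarrow> norm (f x) \<le> N" "\<And>x. x \<in> {a..b} \<Longrightarrow> norm (g x) \<le> N"
    using M0 by (force simp: N_def)+
  show ?thesis
  proof (rule abs_continuous_on_dominated[OF f g, of "N * K"])
    show "N * K \<ge> 0" using K M by simp
  next
    fix u v assume uv: "{u..v} \<subseteq> {a..b}" "u \<le> v"
    then have mem: "u \<in> {a..b}" "v \<in> {a..b}" by auto
    have "h (f v) (g v) - h (f u) (g u) = h (f v - f u) (g v) + h (f u) (g v - g u)"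
      by (simp add: diff_left diff_right)
    also have "norm \<dots> \<le> norm (f v - f u) * norm (g v) * K + norm (f u) * norm (g v - g u) * K"
      by (intro norm_triangle_le add_mono K)
    also have "\<dots> \<le> norm (f v - f u) * N * K + N * norm (g v - g u) * K"
      using M(2)[OF mem(1)] M(3)[OF mem(2)] K M by (intro add_mono mult_right_mono mult_left_mono) auto
    finally show "norm (h (f v) (g v) - h (f u) (g u)) \<le> N * K * (norm (f v - f u) + norm (g v - g u))"
      by (simp add: algebra_simps)
  qed
qed

lemma abs_continuous_on_lipschitz_compose:
  assumes f: "abs_continuous_on {a..b} f" and C: "C \<ge> 0"
    and lip: "\<And>u v. \<lbrakk>u \<in> {a..b}; v \<in> {a..b}\<rbrakk> \<Longrightarrow> norm (g v - g u) \<le> C * norm (f v - f u)"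
  shows "abs_continuous_on {a..b} g"
  by (rule abs_continuous_on_dominated[OF f abs_continuous_on_const[of _ "0::real"] C]) (use lip in auto)

lemma abs_continuous_on_differentiable:
  fixes f :: "real \<Rightarrow> 'a::banach"
  assumes "\<And>x. x \<in> {a..b} \<Longrightarrow> (f has_vector_derivative f' x) (at x within {a..b})"
    and "continuous_on {a..b} f'"
  shows "abs_continuous_on {a..b} f"
proof -
  have "bounded (f' ` {a..b})"
    using assms(2) compact_continuous_image compact_imp_bounded compact_Icc by blast
  then obtain M0 where M0: "\<And>x. x \<in> {a..b} \<Longrightarrow> norm (f' x) \<le> M0"
    unfolding bounded_iff by (meson imageI)
  define M where "M = max 0 M0"
  have M: "M \<ge> 0" "\<And>x. x \<in> {a..b} \<Longrightarrow> norm (f' x) \<le> M" using M0 by (force simp: M_def)+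
  show ?thesis
  proof (rule abs_continuous_on_lipschitz_compose[OF abs_continuous_on_ident M(1)])
    fix u v assume uv: "u \<in> {a..b}" "v \<in> {a..b}"
    show "norm (f v - f u) \<le> M * norm (v - u)"
    proof (rule differentiable_bound)
      show "convex {a..b}" by (rule convex_real_interval)
      show "(f has_derivative (\<lambda>h. h *\<^sub>R f' x)) (at x within {a..b})" if "x \<in> {a..b}" for x
        using assms(1)[OF that] by (simp add: has_vector_derivative_def)
      show "onorm (\<lambda>h. h *\<^sub>R f' x) \<le> M" if "x \<in> {a..b}" for x
      proof (rule onorm_le)
        show "norm (h *\<^sub>R f' x) \<le> M * norm h" for h
          using mult_left_mono[OF M(2)[OF that], of "norm h"] by (simp add: mult.commute)
      qed
    qed (use uv in auto)
  qed
qed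

text \<open>Cut \<open>norm (f x)\<close> off at height \<open>n\<close>: by dominated convergence
  the excess \<open>h n\<close> has small total integral for large \<open>n\<close>, while the
  bounded part contributes at most \<open>n\<close> times the total length of the intervals.\<close>

lemma abs_continuous_on_indefinite_integral:
  fixes f :: "real \<Rightarrow> 'a::euclidean_space"
  assumes f: "f absolutely_integrable_on {a..b}"
  shows "abs_continuous_on {a..b} (\<lambda>x. c + integral {a..x} f)"
  unfolding abs_continuous_on_def
proof (intro allI impI)
  fix \<epsilon> :: real assume \<epsilon>: "\<epsilon> > 0"
  define q where "q x = norm (f x)" for x
  have q: "q absolutely_integrable_on {a..b}" unfolding q_def using f by (rule set_integrable_norm)
  then have qi: "q integrable_on {a..b}" using set_lebesgue_integral_eq_integral(1) by blast
  have mina: "(\<lambda>x. min (q x) (real n)) absolutely_integrable_on {a..b}" for n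
    by (intro absolutely_integrable_min_1 q absolutely_integrable_on_const) auto
  define h where "h n x = q x - min (q x) (real n)" for n x
  have ha: "h n absolutely_integrable_on {a..b}" for n
    unfolding h_def[abs_def] by (intro set_integral_diff q mina)
  then have hi: "h n integrable_on {a..b}" for n using set_lebesgue_integral_eq_integral(1) by blast
  have "(\<lambda>n. integral {a..b} (h n)) \<longlonglongrightarrow> integral {a..b} (\<lambda>x. 0)"
  proof (rule dominated_convergence(2)[OF hi qi])
    show "norm (h n x) \<le> q x" if "x \<in> {a..b}" for n x by (auto simp: h_def q_def)
    show "(\<lambda>n. h n x) \<longlonglongrightarrow> 0" if "x \<in> {a..b}" for x
    proof -
      obtain n0 where "q x \<le> real n0" using real_arch_simple by blast
      then have "eventually (\<lambda>n. h n x = 0) sequentially"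
        unfolding eventually_sequentially by (auto intro!: exI[of _ n0] simp: h_def)
      then show ?thesis by (rule tendsto_eventually)
    qed
  qed
  then have "(\<lambda>n. integral {a..b} (h n)) \<longlonglongrightarrow> 0" by simp
  then have "eventually (\<lambda>n. integral {a..b} (h n) < \<epsilon> / 2) sequentially"
    using \<epsilon> by (intro order_tendstoD(2)) auto
  then obtain n where n: "integral {a..b} (h n) < \<epsilon> / 2" by (meson eventually_sequentially order_refl)
  define \<delta> where "\<delta> = \<epsilon> / (2 * (real n + 1))"
  have \<delta>: "\<delta> > 0" "real n * \<delta> \<le> \<epsilon> / 2" using \<epsilon> by (auto simp: \<delta>_def field_simps)
  show "\<exists>\<delta>>0. \<forall>D. D division_of \<Union>D \<and> \<Union>D \<subseteq> {a..b} \<and> (\<Sum>K\<in>D. Sup K - Inf K) < \<delta>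
        \<longrightarrow> (\<Sum>K\<in>D. norm (c + integral {a..Sup K} f - (c + integral {a..Inf K} f))) < \<epsilon>"
  proof (intro exI[of _ \<delta>] conjI allI impI \<delta>(1))
    fix D assume D: "D division_of \<Union>D \<and> \<Union>D \<subseteq> {a..b} \<and> (\<Sum>K\<in>D. Sup K - Inf K) < \<delta>"
    have Ksub: "K \<subseteq> {a..b}" if "K \<in> D" for K using D that by blast
    have Kuv: "\<exists>u v. K = {u..v} \<and> u \<le> v \<and> a \<le> u \<and> v \<le> b" if K: "K \<in> D" for K
    proof -
      obtain u v where uv: "K = cbox u v" "K \<noteq> {}"
        using D K division_ofD(3,4)[of D "\<Union>D" K] by blast
      then show ?thesis using Ksub[OF K] by (intro exI[of _ u] exI[of _ v]) auto
    qed
    have hK: "h n integrable_on K" if "K \<in> D" for K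
      using Kuv[OF that] hi integrable_subinterval_real by (metis Ksub that)
    have "(\<Sum>K\<in>D. norm (c + integral {a..Sup K} f - (c + integral {a..Inf K} f))) \<le>
          (\<Sum>K\<in>D. integral K (h n) + real n * (Sup K - Inf K))"
    proof (rule sum_mono)
      fix K assume K: "K \<in> D"
      obtain u v where uv: "K = {u..v}" "u \<le> v" "a \<le> u" "v \<le> b" using Kuv[OF K] by blast
      have fi: "f integrable_on {a..b}" using f set_lebesgue_integral_eq_integral(1) by blast
      have "integral {a..u} f + integral {u..v} f = integral {a..v} f"
        using uv by (intro Henstock_Kurzweil_Integration.integral_combine integrable_subinterval_real[OF fi]) auto
      then have "integral {u..v} f = integral {a..v} f - integral {a..u} f" by (metis add_diff_cancel_left')
      then have "norm (c + integral {a..Sup K} f - (c + integral {a..Inf K} f)) = norm (integral {u..v} f)"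
        using uv by simp
      also have "\<dots> \<le> integral {u..v} (\<lambda>x. h n x + real n)"
      proof (rule integral_norm_bound_integral)
        show "f integrable_on {u..v}" using uv by (intro integrable_subinterval_real[OF fi]) auto
        show "(\<lambda>x. h n x + real n) integrable_on {u..v}"
          using hK[OF K] uv by (intro integrable_add) auto
        show "norm (f x) \<le> h n x + real n" if "x \<in> {u..v}" for x by (auto simp: h_def q_def)
      qed
      also have "\<dots> = integral K (h n) + real n * (Sup K - Inf K)"
        using hK[OF K] uv by (subst integral_add) (auto simp: algebra_simps)
      finally show "norm (c + integral {a..Sup K} f - (c + integral {a..Inf K} f)) \<le>
              integral K (h n) + real n * (Sup K - Inf K)" .
    qed
    also have "\<dots> = (\<Sum>K\<in>D. integral K (h n)) + real n * (\<Sum>K\<in>D. Sup K - Inf K)"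
      by (simp add: sum.distrib sum_distrib_left)
    also have "(\<Sum>K\<in>D. integral K (h n)) = integral (\<Union>D) (h n)"
      using D hK by (intro integral_combine_division_bottomup[symmetric]) auto
    also have "\<dots> \<le> integral {a..b} (h n)"
    proof (rule integral_subset_le)
      show "h n integrable_on \<Union>D" using D hK by (intro integrable_combine_division[of D "\<Union>D"]) blast+
    qed (use D hi in \<open>auto simp: h_def\<close>)
    also have "real n * (\<Sum>K\<in>D. Sup K - Inf K) \<le> real n * \<delta>"
      using D by (intro mult_left_mono) auto
    finally show "(\<Sum>K\<in>D. norm (c + integral {a..Sup K} f - (c + integral {a..Inf K} f))) < \<epsilon>"
      using n \<delta>(2) by linarith
  qed
qed

text \<open>The exceptional sets for the intervals from 0 to \<open>n\<close> are united over all
  \<open>n\<close>. The point 0 is added because differentiability was obtained only at interior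
  points.\<close>

lemma indefinite_integral_has_vector_derivative_AE:
  fixes f :: "real \<Rightarrow> 'a::euclidean_space"
  assumes f: "\<And>b. f integrable_on {0..b}"
  shows "AE x in lebesgue. 0 \<le> x \<longrightarrow>
           ((\<lambda>x. c + integral {0..x} f) has_vector_derivative f x) (at x within {0..})"
proof -
  have "\<exists>N. negligible N \<and> (\<forall>x. 0 < x \<and> x < real n \<and> x \<notin> N \<longrightarrow>
          ((\<lambda>x. integral {0..x} f) has_vector_derivative f x) (at x))" for n
    using integral_has_vector_derivative_ae[OF f, of "real n"] by metis
  then obtain N where N: "\<And>n. negligible (N n)"
    "\<And>n x. \<lbrakk>0 < x; x < real n; x \<notin> N n\<rbrakk> \<Longrightarrow> ((\<lambda>x. integral {0..x} f) has_vector_derivative f x) (at x)"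
    by metis
  define M where "M = insert 0 (\<Union>n. N n)"
  have M: "M \<in> null_sets lebesgue"
    unfolding M_def negligible_iff_null_sets[symmetric]
    by (intro negligible_insert[THEN iffD2] negligible_Union_nat N)
  show ?thesis
  proof (rule AE_I'[OF M], clarsimp, rule ccontr)
    fix x :: real assume x: "0 \<le> x" "x \<notin> M"
      and nd: "\<not> ((\<lambda>x. c + integral {0..x} f) has_vector_derivative f x) (at x within {0..})"
    obtain n where "x < real n" using reals_Archimedean2 by blast
    then have "((\<lambda>x. integral {0..x} f) has_vector_derivative f x) (at x)"
      using x by (intro N(2)[of x n]) (auto simp: M_def order_less_le)
    then have "((\<lambda>x. integral {0..x} f) has_vector_derivative f x) (at x within {0..})"
      by (rule has_vector_derivative_at_within)
    then have "((\<lambda>x. c + integral {0..x} f) has_vector_derivative 0 + f x) (at x within {0..})"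
      by (intro derivative_intros)
    with nd show False by simp
  qed
qed

lemma fundamental_theorem_of_calculus_AE:
  fixes f :: "real \<Rightarrow> 'a::euclidean_space"
  assumes ac: "abs_continuous_on {0..b} f" and ab: "0 \<le> a" "a \<le> b"
    and deriv: "AE x in lebesgue. 0 \<le> x \<longrightarrow> (f has_vector_derivative g x) (at x within {0..})"
  shows "(g has_integral (f b - f a)) {a..b}"
proof -
  obtain N where N: "N \<in> null_sets lebesgue"
    "{x. \<not> (0 \<le> x \<longrightarrow> (f has_vector_derivative g x) (at x within {0..}))} \<subseteq> N"
    using deriv by (auto simp: eventually_ae_filter)
  show ?thesis
  proof (rule fundamental_theorem_of_calculus_abs_continuous[of _ _ _ N])
    show "abs_continuous_on {a..b} f"
      by (rule abs_continuous_on_subset[OF ac]) (use ab in auto)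
    show "(f has_vector_derivative g x) (at x within {a..b})" if "x \<in> {a..b} - N" for x
    proof (rule has_vector_derivative_within_subset)
      have "x \<notin> N" "0 \<le> x" using that ab(1) by auto
      then show "(f has_vector_derivative g x) (at x within {0..})" using N(2) by blast
    qed (use ab in auto)
    show "negligible N" using N by (simp add: negligible_iff_null_sets)
  qed (rule ab(2))
qed

text \<open>Since exp is Lipschitz on bounded intervals, the exponential of an indefinite integral
  is again absolutely continuous, and the fundamental theorem applies to it. The cases
  \<open>l = 2\<close> and \<open>l = -2\<close> evaluate the weighted integrals behind the two
  contraction estimates.\<close>

lemma has_integral_exp_indefinite_integral:
  fixes q :: "real \<Rightarrow> real"
  assumes q: "\<And>b. q absolutely_integrable_on {0..b}" and pos: "\<And>x. 0 \<le> x \<Longrightarrow> 0 \<le> q x"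
    and ab: "0 \<le> a" "a \<le> b" and l: "l \<noteq> 0"
  shows "((\<lambda>t. q t * exp (l * integral {0..t} q)) has_integral
           (exp (l * integral {0..b} q) - exp (l * integral {0..a} q)) / l) {a..b}"
proof -
  define Q where "Q x = integral {0..x} q" for x
  have qi: "q integrable_on {0..b}" for b using q set_lebesgue_integral_eq_integral(1) by blast
  have Q: "0 \<le> Q x" "Q x \<le> Q b" if "x \<in> {0..b}" for x
  proof -
    show "0 \<le> Q x" unfolding Q_def by (rule integral_nonneg[OF qi]) (use pos in auto)
    show "Q x \<le> Q b" unfolding Q_def
      by (rule integral_subset_le[OF _ qi qi]) (use pos that in auto)
  qed
  have ac: "abs_continuous_on {0..b} Q"
    using abs_continuous_on_indefinite_integral[OF q, of b 0] by (simp add: Q_def[abs_def])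
  have "((\<lambda>t. l * q t * exp (l * Q t)) has_integral (exp (l * Q b) - exp (l * Q a))) {a..b}"
  proof (rule fundamental_theorem_of_calculus_AE[OF _ ab])
    show "abs_continuous_on {0..b} (\<lambda>t. exp (l * Q t))"
    proof (rule abs_continuous_on_lipschitz_compose[OF ac, of "\<bar>l\<bar> * exp (\<bar>l\<bar> * Q b)"])
      fix u v assume uv: "u \<in> {0..b}" "v \<in> {0..b}"
      \<comment> \<open>The exponent stays in the interval from \<open>-m\<close> to
        \<open>m\<close>, where exp has Lipschitz constant \<open>exp m\<close>.\<close>
      define m where "m = \<bar>l\<bar> * Q b"
      have lQ: "\<bar>l * Q x\<bar> \<le> m" if "x \<in> {0..b}" for x
        using Q[OF that] by (simp add: m_def abs_mult mult_left_mono)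
      have bd: "l * Q u \<in> {-m..m}" "l * Q v \<in> {-m..m}"
        using lQ[OF uv(1)] lQ[OF uv(2)] by (simp_all add: abs_le_iff)
      have "norm (exp (l * Q v) - exp (l * Q u)) \<le> exp m * norm (l * Q v - l * Q u)"
      proof (rule field_differentiable_bound[of "{-m..m}"])
        show "(exp has_field_derivative exp x) (at x within {-m..m})" for x :: real
          by (rule DERIV_subset[OF DERIV_exp]) simp
      qed (use bd in auto)
      also have "\<dots> = \<bar>l\<bar> * exp m * norm (Q v - Q u)"
        by (simp add: abs_mult right_diff_distrib[symmetric])
      finally show "norm (exp (l * Q v) - exp (l * Q u)) \<le> \<bar>l\<bar> * exp (\<bar>l\<bar> * Q b) * norm (Q v - Q u)"
        by (simp add: m_def)
    qed simp
    have "AE x in lebesgue. 0 \<le> x \<longrightarrow> (Q has_vector_derivative q x) (at x within {0..})"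
      using indefinite_integral_has_vector_derivative_AE[OF qi, of 0] by (simp add: Q_def[abs_def])
    then show "AE x in lebesgue. 0 \<le> x \<longrightarrow>
      ((\<lambda>t. exp (l * Q t)) has_vector_derivative l * q x * exp (l * Q x)) (at x within {0..})"
    proof (eventually_elim, intro impI)
      fix x :: real assume "0 \<le> x \<longrightarrow> (Q has_vector_derivative q x) (at x within {0..})" "0 \<le> x"
      then have "(Q has_real_derivative q x) (at x within {0..})"
        by (simp add: has_real_derivative_iff_has_vector_derivative)
      then have "((\<lambda>t. exp (l * Q t)) has_real_derivative exp (l * Q x) * (l * q x)) (at x within {0..})"
        by (auto intro!: derivative_eq_intros)
      then show "((\<lambda>t. exp (l * Q t)) has_vector_derivative l * q x * exp (l * Q x)) (at x within {0..})"
        by (simp add: has_real_derivative_iff_has_vector_derivative mult_ac)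
    qed
  qed
  from has_integral_divide[OF this, of l] l show ?thesis
    by (simp add: Q_def)
qed

section \<open>The Wronskian identity\<close>

lemma bounded_bilinear_matrix_mult:
  "bounded_bilinear ((**) :: complex^'n^'m \<Rightarrow> complex^'p^'n \<Rightarrow> complex^'p^'m)"
  unfolding bilinear_conv_bounded_bilinear[symmetric] bilinear_def
  by (auto intro!: linearI simp: matrix_matrix_mult_def vec_eq_iff
      scaleR_sum_right sum.distrib distrib_right distrib_left)

interpretation mm: bounded_bilinear "(**) :: complex^'n^'m \<Rightarrow> complex^'p^'n \<Rightarrow> complex^'p^'m"
  by (rule bounded_bilinear_matrix_mult)

section \<open>Scalar, adjoint and block algebra of matrices\<close>

lemma mat_mult_nth: "(mat c ** A) $ i $ k = c * A $ i $ k"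
  for A :: "'a::semiring_1^'q^'p"
  by (simp add: matrix_matrix_mult_def mat_def if_distrib[of "\<lambda>x. x * _"] cong: if_cong)

lemma mult_mat_nth: "(A ** mat c) $ i $ k = A $ i $ k * c"
  for A :: "'a::semiring_1^'q^'p"
  by (simp add: matrix_matrix_mult_def mat_def if_distrib[of "\<lambda>x. _ * x"] cong: if_cong)

lemma mult_mat_comm: "A ** mat c = mat c ** A" for A :: "complex^'q^'p"
  by (simp add: vec_eq_iff mat_mult_nth mult_mat_nth mult.commute)

lemma mult_mat_left_comm: "A ** (mat c ** B) = mat c ** (A ** B)" for A :: "complex^'q^'p"
  by (metis matrix_mul_assoc mult_mat_comm)

lemma mat_mult_mat: "mat c ** (mat d ** A) = mat (c * d) ** A" for A :: "complex^'q^'p"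
  by (simp add: vec_eq_iff mat_mult_nth mult.assoc)

lemma mat_mult_zero [simp]: "mat 0 ** A = 0" for A :: "complex^'q^'p"
  by (simp add: vec_eq_iff mat_mult_nth)

lemma adj_nth [simp]: "adj A $ i $ k = cnj (A $ k $ i)"
  by (simp add: adj_def)

lemma adj_mult: "adj (A ** B) = adj B ** adj A"
  by (simp add: vec_eq_iff matrix_matrix_mult_def mult.commute)

lemma adj_adj [simp]: "adj (adj A) = A"
  by (simp add: vec_eq_iff)

lemma adj_mat [simp]: "adj (mat c) = mat (cnj c)"
  by (simp add: vec_eq_iff mat_def)

lemma adj_mat_mult: "adj (mat c ** A) = mat (cnj c) ** adj A"
  by (simp add: vec_eq_iff mat_mult_nth)

lemma bounded_linear_adj: "bounded_linear adj"
  unfolding linear_conv_bounded_linear[symmetric]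
  by (rule linearI) (auto simp: vec_eq_iff)

lemma adj_zero [simp]: "adj 0 = 0" and adj_add [simp]: "adj (A + B) = adj A + adj B"
  and adj_minus [simp]: "adj (- A) = - adj A"
  by (simp_all add: vec_eq_iff)

lemma vstack_nth [simp]:
  "vstack A B $ Inl a = A $ a" "vstack A B $ Inr b = B $ b"
  by (simp_all add: vstack_def)

lemma hstack_nth [simp]:
  "hstack A B $ i $ Inl a = A $ i $ a" "hstack A B $ i $ Inr b = B $ i $ b"
  by (simp_all add: hstack_def)

lemma upper_nth [simp]: "upper A $ a = A $ Inl a"
  by (simp add: upper_def)

lemma lower_nth [simp]: "lower A $ b = A $ Inr b"
  by (simp add: lower_def)

lemma vec_eq_iff_sum: "A = B \<longleftrightarrow> upper A = upper B \<and> lower A = lower B"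
proof
  assume "upper A = upper B \<and> lower A = lower B"
  then have "A $ Inl a = B $ Inl a" "A $ Inr b = B $ Inr b" for a b
    by (metis upper_nth, metis lower_nth)
  then have "A $ i = B $ i" for i by (cases i) auto
  then show "A = B" by (simp add: vec_eq_iff)
qed simp

lemma sum_UNIV_sum:
  fixes f :: "'a::finite + 'b::finite \<Rightarrow> 'c::comm_monoid_add"
  shows "(\<Sum>i\<in>UNIV. f i) = (\<Sum>a\<in>UNIV. f (Inl a)) + (\<Sum>b\<in>UNIV. f (Inr b))"
  by (simp add: UNIV_Plus_UNIV[symmetric] sum.Plus del: UNIV_Plus_UNIV)

lemma upper_vstack [simp]: "upper (vstack A B) = A" and lower_vstack [simp]: "lower (vstack A B) = B"
  by (simp_all add: vec_eq_iff)

lemma upper_mult: "upper (A ** B) = upper A ** B" and lower_mult: "lower (A ** B) = lower A ** B"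
  by (simp_all add: vec_eq_iff matrix_matrix_mult_def)

lemma upper_hstack_mult: "upper (vstack (hstack A B) M ** Y) = A ** upper Y + B ** lower Y"
  and lower_hstack_mult: "lower (vstack M (hstack C D) ** Y) = C ** upper Y + D ** lower Y"
  for Y :: "complex^'q^('m1::finite + 'm2::finite)"
  by (simp_all add: vec_eq_iff matrix_matrix_mult_def sum_UNIV_sum)

lemma upper_dirac_j_mult [simp]: "upper (dirac_j ** Y) = upper Y"
  and lower_dirac_j_mult [simp]: "lower (dirac_j ** Y) = - lower Y"
  for Y :: "complex^'q^('m1::finite + 'm2::finite)"
  unfolding dirac_j_def by (simp_all add: upper_hstack_mult lower_hstack_mult mm.minus_left)

lemma upper_exp_mult [simp]: "upper (exp_ixzj x z ** Y) = mat (exp (\<i> * of_real x * z)) ** upper Y"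
  and lower_exp_mult [simp]: "lower (exp_ixzj x z ** Y) = mat (exp (- \<i> * of_real x * z)) ** lower Y"
  for Y :: "complex^'q^('m1::finite + 'm2::finite)"
  unfolding exp_ixzj_def by (simp_all add: upper_hstack_mult lower_hstack_mult)

lemma upper_add [simp]: "upper (A + B) = upper A + upper B" and lower_add [simp]: "lower (A + B) = lower A + lower B"
  and upper_minus [simp]: "upper (- A) = - upper A" and lower_minus [simp]: "lower (- A) = - lower A"
  and upper_diff [simp]: "upper (A - B) = upper A - upper B" and lower_diff [simp]: "lower (A - B) = lower A - lower B"
  for A B :: "complex^'q^('m1::finite + 'm2::finite)"
  by (simp_all add: vec_eq_iff)

lemma upper_mat_mult [simp]: "upper (mat c ** Y) = mat c ** upper Y" 
  and lower_mat_mult [simp]: "lower (mat c ** Y) = mat c ** lower Y"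
  for Y :: "complex^'q^('m1::finite + 'm2::finite)"
  by (simp_all add: vec_eq_iff mat_mult_nth)

lemma dirac_j_idem_assoc [simp]: "dirac_j ** (dirac_j ** A) = A"
  by (subst vec_eq_iff_sum) simp

lemma dirac_j_idem [simp]: "dirac_j ** dirac_j = mat 1"
  by (metis matrix_mul_rid dirac_j_idem_assoc)

lemma adj_block: "adj (vstack (hstack A B) (hstack C D)) = vstack (hstack (adj A) (adj C)) (hstack (adj B) (adj D))"
  unfolding vec_eq_iff
proof (intro allI)
  fix i k
  show "adj (vstack (hstack A B) (hstack C D)) $ i $ k = vstack (hstack (adj A) (adj C)) (hstack (adj B) (adj D)) $ i $ k"
    by (cases i; cases k) simp_all
qed

lemma adj_dirac_j [simp]: "adj dirac_j = dirac_j"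
  unfolding dirac_j_def by (simp add: adj_block adj_minus)

lemma adj_potential [simp]: "adj (potential v x) = potential v x"
  unfolding potential_def by (simp add: adj_block)

lemma adj_exp_ixzj: "adj (exp_ixzj x z) = exp_ixzj x (- cnj z)"
  unfolding exp_ixzj_def by (simp add: adj_block exp_cnj)

lemma exp_ixzj_add: "exp_ixzj x z ** (exp_ixzj y z ** A) = exp_ixzj (x + y) z ** A"
  by (subst vec_eq_iff_sum) (simp add: mat_mult_mat exp_add[symmetric] distrib_left distrib_right algebra_simps)

lemma exp_ixzj_zero [simp]: "exp_ixzj 0 z ** A = A"
  by (subst vec_eq_iff_sum) simp

lemma exp_ixzj_dirac_j: "exp_ixzj x z ** (dirac_j ** A) = dirac_j ** (exp_ixzj x z ** A)"
  by (subst vec_eq_iff_sum) (simp add: mm.minus_right)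

section \<open>The coefficient matrix and Wronskians of solutions\<close>

definition dirac_matrix ::
  "(real \<Rightarrow> complex^'m2^'m1) \<Rightarrow> complex \<Rightarrow> real \<Rightarrow> complex^('m1::finite + 'm2::finite)^('m1 + 'm2)" where
  "dirac_matrix v z x = mat \<i> ** (mat z ** dirac_j + dirac_j ** potential v x)"

lemma dirac_j_dirac_matrix:
  fixes v :: "real \<Rightarrow> complex^'m2^'m1" and Y :: "complex^'q^('m1::finite + 'm2::finite)"
  shows "dirac_j ** (dirac_matrix v z x ** Y) = mat (\<i> * z) ** Y + mat \<i> ** (potential v x ** Y)"
  unfolding dirac_matrix_def
  by (simp add: matrix_mul_assoc[symmetric] mm.add_left mm.add_right mult_mat_left_comm[of dirac_j] mat_mult_mat)

text \<open>Because j squares to the identity, j times the coefficient matrix is i(z + V). The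
  potential V is self-adjoint, so its two contributions cancel and only the spectral parameters
  remain.\<close>

lemma dirac_matrix_wronskian:
  fixes v :: "real \<Rightarrow> complex^'m2^'m1"
    and X :: "complex^'p^('m1::finite + 'm2::finite)" and Y :: "complex^'q^('m1 + 'm2)"
  shows "adj (dirac_matrix v w x ** X) ** (dirac_j ** Y) + adj X ** (dirac_j ** (dirac_matrix v z x ** Y))
     = mat (\<i> * (z - cnj w)) ** (adj X ** Y)"
proof -
  have "adj (dirac_matrix v w x ** X) ** (dirac_j ** Y) = adj (dirac_j ** (dirac_matrix v w x ** X)) ** Y"
    by (simp add: adj_mult matrix_mul_assoc)
  also have "\<dots> = mat (- \<i> * cnj w) ** (adj X ** Y) + mat (- \<i>) ** (adj X ** (potential v x ** Y))"
    unfolding dirac_j_dirac_matrix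
    by (simp only: adj_add adj_mat_mult mm.add_left) (simp add: adj_mult matrix_mul_assoc)
  finally have 1: "adj (dirac_matrix v w x ** X) ** (dirac_j ** Y) =
    mat (- \<i> * cnj w) ** (adj X ** Y) + mat (- \<i>) ** (adj X ** (potential v x ** Y))" .
  have 2: "adj X ** (dirac_j ** (dirac_matrix v z x ** Y)) =
    mat (\<i> * z) ** (adj X ** Y) + mat \<i> ** (adj X ** (potential v x ** Y))"
    unfolding dirac_j_dirac_matrix by (simp add: mm.add_right mult_mat_left_comm[of "adj X"])
  show ?thesis
    unfolding 1 2 by (simp add: vec_eq_iff mat_mult_nth algebra_simps)
qed

lemma dirac_solution_iff:
  "dirac_solution v z y \<longleftrightarrow>
     (\<forall>b\<ge>0. abs_continuous_on {0..b} y) \<and>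
     (AE x in lebesgue. 0 \<le> x \<longrightarrow> (y has_vector_derivative dirac_matrix v z x ** y x) (at x within {0..}))"
  unfolding dirac_solution_def dirac_matrix_def ..

theorem wronskian:
  fixes X :: "real \<Rightarrow> complex^'p^('m1::finite + 'm2::finite)" and Y :: "real \<Rightarrow> complex^'q^('m1 + 'm2)"
  assumes X: "dirac_solution v w X" and Y: "dirac_solution v z Y" and ab: "0 \<le> a" "a \<le> b"
  shows "((\<lambda>x. mat (\<i> * (z - cnj w)) ** (adj (X x) ** Y x)) has_integral
           (adj (X b) ** (dirac_j ** Y b) - adj (X a) ** (dirac_j ** Y a))) {a..b}"
proof (rule fundamental_theorem_of_calculus_AE[OF _ ab])
  \<comment> \<open>The adjoint is conjugate-linear, hence linear over the reals, which is enough
    for a product rule in the real variable \<open>x\<close>.\<close>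
  have bl: "bounded_bilinear (\<lambda>(A :: complex^'p^('m1::finite + 'm2::finite)) (B :: complex^'q^('m1 + 'm2)). adj A ** (dirac_j ** B))"
    by (rule bounded_bilinear.comp[OF bounded_bilinear_matrix_mult bounded_linear_adj])
       (rule bounded_bilinear.bounded_linear_right[OF bounded_bilinear_matrix_mult])
  show "abs_continuous_on {0..b} (\<lambda>x. adj (X x) ** (dirac_j ** Y x))"
    by (rule abs_continuous_on_bilinear[OF bl]) (use X Y ab in \<open>auto simp: dirac_solution_iff\<close>)
  have "AE x in lebesgue. 0 \<le> x \<longrightarrow> (X has_vector_derivative dirac_matrix v w x ** X x) (at x within {0..})"
    "AE x in lebesgue. 0 \<le> x \<longrightarrow> (Y has_vector_derivative dirac_matrix v z x ** Y x) (at x within {0..})"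
    using X Y by (auto simp: dirac_solution_iff)
  then show "AE x in lebesgue. 0 \<le> x \<longrightarrow>
        ((\<lambda>x. adj (X x) ** (dirac_j ** Y x)) has_vector_derivative mat (\<i> * (z - cnj w)) ** (adj (X x) ** Y x)) (at x within {0..})"
  proof (eventually_elim, intro impI)
    fix x :: real
    assume "0 \<le> x \<longrightarrow> (X has_vector_derivative dirac_matrix v w x ** X x) (at x within {0..})"
      "0 \<le> x \<longrightarrow> (Y has_vector_derivative dirac_matrix v z x ** Y x) (at x within {0..})" "0 \<le> x"
    then show "((\<lambda>x. adj (X x) ** (dirac_j ** Y x)) has_vector_derivative mat (\<i> * (z - cnj w)) ** (adj (X x) ** Y x)) (at x within {0..})"
      using bounded_bilinear.has_vector_derivative[OF bl, of X "dirac_matrix v w x ** X x" x "{0..}" Y "dirac_matrix v z x ** Y x"]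
      by (simp add: dirac_matrix_wronskian[of v w x "X x" "Y x" z, symmetric] add.commute)
  qed
qed

lemma dirac_solution_continuous_on:
  assumes "dirac_solution v z y"
  shows "continuous_on {0..} y"
  by (rule continuous_on_halfline, rule abs_continuous_on_imp_continuous_on)
     (use assms in \<open>simp add: dirac_solution_iff\<close>)

lemma dirac_solution_mult_right:
  assumes "dirac_solution v z y"
  shows "dirac_solution v z (\<lambda>x. y x ** C)"
proof -
  have bl: "bounded_linear (\<lambda>A. A ** C)" by (rule mm.bounded_linear_left)
  have "abs_continuous_on {0..b} (\<lambda>x. y x ** C)" if "b \<ge> 0" for b
    using assms that by (intro abs_continuous_on_bilinear[OF bounded_bilinear_matrix_mult] abs_continuous_on_const)
      (auto simp: dirac_solution_iff)
  moreover have "AE x in lebesgue. 0 \<le> x \<longrightarrow> (y has_vector_derivative dirac_matrix v z x ** y x) (at x within {0..})"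
    using assms by (auto simp: dirac_solution_iff)
  then have "AE x in lebesgue. 0 \<le> x \<longrightarrow> ((\<lambda>x. y x ** C) has_vector_derivative dirac_matrix v z x ** (y x ** C)) (at x within {0..})"
    by eventually_elim (auto simp: matrix_mul_assoc intro: bounded_linear.has_vector_derivative[OF bl])
  ultimately show ?thesis by (auto simp: dirac_solution_iff)
qed

lemma dirac_solution_diff:
  assumes y: "dirac_solution v z y" and w: "dirac_solution v z w"
  shows "dirac_solution v z (\<lambda>x. y x - w x)"
proof -
  have "abs_continuous_on {0..b} (\<lambda>x. y x - w x)" if "b \<ge> 0" for b
  proof (rule abs_continuous_on_dominated[of _ y w 1])
    fix s t
    have "y t - w t - (y s - w s) = (y t - y s) - (w t - w s)" by simp
    then show "norm (y t - w t - (y s - w s)) \<le> 1 * (norm (y t - y s) + norm (w t - w s))"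
      by (metis mult_1 norm_triangle_ineq4)
  qed (use assms that in \<open>auto simp: dirac_solution_iff\<close>)
  moreover have "AE x in lebesgue. 0 \<le> x \<longrightarrow> (y has_vector_derivative dirac_matrix v z x ** y x) (at x within {0..})"
    "AE x in lebesgue. 0 \<le> x \<longrightarrow> (w has_vector_derivative dirac_matrix v z x ** w x) (at x within {0..})"
    using assms by (auto simp: dirac_solution_iff)
  then have "AE x in lebesgue. 0 \<le> x \<longrightarrow> ((\<lambda>x. y x - w x) has_vector_derivative dirac_matrix v z x ** (y x - w x)) (at x within {0..})"
    by eventually_elim (auto simp: mm.diff_right intro: has_vector_derivative_diff)
  ultimately show ?thesis by (auto simp: dirac_solution_iff)
qed

section \<open>Linear Volterra equations\<close>

text \<open>Picard iteration from 0 in the sup norm weighted by \<open>p\<close>. A parameter may be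
  one of the coordinates of \<open>D\<close>; joint continuity in it is then part of the conclusion.
  The bound \<open>2 * B\<close> is the sum of the geometric series
  \<open>B / 2 ^ n\<close>.\<close>

theorem weighted_contraction_fixed_point:
  fixes T :: "('x::topological_space \<Rightarrow> 'e::banach) \<Rightarrow> 'x \<Rightarrow> 'e" and p :: "'x \<Rightarrow> real"
  defines "adm \<equiv> \<lambda>D p f. continuous_on D f \<and> (\<exists>C. \<forall>x\<in>D. norm (f x) \<le> C * p x)"
  assumes p: "continuous_on D p" "\<And>x. x \<in> D \<Longrightarrow> 0 < p x"
    and cont: "\<And>f. adm D p f \<Longrightarrow> continuous_on D (T f)"
    and base: "\<And>x. x \<in> D \<Longrightarrow> norm (T (\<lambda>_. 0) x) \<le> B * p x"
    and contr: "\<And>f g C x. \<lbrakk>adm D p f; adm D p g; \<And>x. x \<in> D \<Longrightarrow> norm (f x - g x) \<le> C * p x; x \<in> D\<rbrakk>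
                  \<Longrightarrow> norm (T f x - T g x) \<le> C / 2 * p x"
  obtains f where "continuous_on D f" "\<And>x. x \<in> D \<Longrightarrow> norm (f x) \<le> 2 * B * p x" "\<And>x. x \<in> D \<Longrightarrow> T f x = f x"
proof -
  define F where "F n = (T ^^ n) (\<lambda>_. 0)" for n
  have F0: "F 0 = (\<lambda>_. 0)" and FS: "F (Suc n) = T (F n)" for n by (simp_all add: F_def)
  have step: "adm D p (F n) \<and> (\<forall>x\<in>D. norm (F (Suc n) x - F n x) \<le> B / 2 ^ n * p x)" for n
  proof (induction n)
    case 0
    then show ?case using base by (auto simp: F0 FS adm_def intro!: exI[of _ 0])
  next
    case (Suc n)
    then obtain C where C: "\<And>x. x \<in> D \<Longrightarrow> norm (F n x) \<le> C * p x" by (auto simp: adm_def)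
    have "norm (F (Suc n) x) \<le> (B / 2 ^ n + C) * p x" if "x \<in> D" for x
    proof -
      have "norm (F (Suc n) x) \<le> norm (F (Suc n) x - F n x) + norm (F n x)"
        by (metis diff_add_cancel norm_triangle_ineq)
      also have "\<dots> \<le> B / 2 ^ n * p x + C * p x"
        using Suc C that by (intro add_mono) auto
      finally show ?thesis by (simp add: algebra_simps)
    qed
    then have adm: "adm D p (F (Suc n))"
      using cont[of "F n"] Suc unfolding adm_def FS by blast
    moreover have "norm (F (Suc (Suc n)) x - F (Suc n) x) \<le> B / 2 ^ Suc n * p x" if "x \<in> D" for x
      using contr[of "F (Suc n)" "F n" "B / 2 ^ n" x] adm Suc that by (simp add: FS field_simps)
    ultimately show ?case by blast
  qed
  \<comment> \<open>Divided by the weight, the increments form a series dominated by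
    \<open>B / 2 ^ n\<close> uniformly on \<open>D\<close>, as the Weierstrass test demands.\<close>
  define d where "d n x = (F (Suc n) x - F n x) /\<^sub>R p x" for n x
  have dle: "norm (d n x) \<le> B / 2 ^ n" if "x \<in> D" for n x
    using step[of n] that p(2)[OF that] by (simp add: d_def divide_simps)
  have geo: "(\<lambda>n. B / 2 ^ n) sums (2 * B)"
    using sums_mult[OF geometric_sums[of "1/2::real"], of B] by (simp add: power_divide mult.commute)
  define L where "L x = (\<Sum>n. d n x)" for x
  have ulim: "uniform_limit D (\<lambda>n x. \<Sum>i<n. d i x) L sequentially"
    unfolding L_def using dle sums_summable[OF geo] by (rule Weierstrass_m_test)
  have tel: "(\<Sum>i<n. d i x) = F n x /\<^sub>R p x" for n x
  proof -
    have "(\<Sum>i<n. d i x) = (\<Sum>i<n. F (Suc i) x - F i x) /\<^sub>R p x"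
      by (simp add: d_def scaleR_sum_right)
    then show ?thesis using sum_lessThan_telescope[of "\<lambda>i. F i x" n] by (simp add: F0)
  qed
  define f where "f x = p x *\<^sub>R L x" for x
  have "continuous_on D L"
  proof (rule uniform_limit_theorem[OF _ ulim])
    show "\<forall>\<^sub>F n in sequentially. continuous_on D (\<lambda>x. \<Sum>i<n. d i x)"
      using step p unfolding tel by (intro always_eventually allI continuous_intros) (auto simp: adm_def less_imp_neq[symmetric] dest: p(2))
  qed simp
  then have cf: "continuous_on D f"
    unfolding f_def[abs_def] by (intro continuous_intros p)
  have Lle: "norm (L x) \<le> 2 * B" if "x \<in> D" for x
  proof -
    have "norm (L x) \<le> (\<Sum>n. B / 2 ^ n)"
      unfolding L_def using dle[OF that] sums_summable[OF geo] by (rule norm_suminf_le)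
    then show ?thesis using sums_unique[OF geo] by simp
  qed
  have fle: "norm (f x) \<le> 2 * B * p x" if "x \<in> D" for x
    using mult_right_mono[OF Lle[OF that], of "p x"] p(2)[OF that] by (simp add: f_def mult.commute)
  have "T f x = f x" if x: "x \<in> D" for x
  proof -
    have main: "norm (T f x - f x) \<le> e" if e: "e > 0" for e
    proof -
      \<comment> \<open>Chosen so that \<open>\<delta> * p x = e / 2\<close>; the two error terms
        below then add up to three quarters of \<open>e\<close>.\<close>
      define \<delta> where "\<delta> = e / (2 * p x)"
      have \<delta>: "\<delta> > 0" using e p(2)[OF x] by (simp add: \<delta>_def)
      obtain N where N: "\<And>n y. \<lbrakk>n \<ge> N; y \<in> D\<rbrakk> \<Longrightarrow> dist (F n y /\<^sub>R p y) (L y) < \<delta>"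
        using uniform_limitD[OF ulim \<delta>] unfolding tel eventually_sequentially by blast
      have near: "norm (f y - F n y) \<le> \<delta> * p y" if "n \<ge> N" "y \<in> D" for n y
      proof -
        have "f y - F n y = p y *\<^sub>R (L y - F n y /\<^sub>R p y)"
          using p(2)[OF that(2)] by (simp add: f_def scaleR_diff_right)
        also have "norm \<dots> = p y * dist (F n y /\<^sub>R p y) (L y)"
          using p(2)[OF that(2)] by (simp add: dist_norm norm_minus_commute)
        also have "\<dots> \<le> p y * \<delta>" using N[OF that] p(2)[OF that(2)] by (intro mult_left_mono) auto
        finally show ?thesis by (simp add: mult.commute)
      qed
      have "adm D p f" using cf fle unfolding adm_def by blast
      then have "norm (T f x - T (F N) x) \<le> \<delta> / 2 * p x"
        using step[of N] near[of N] x by (intro contr) auto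
      moreover have "norm (f x - F (Suc N) x) \<le> \<delta> * p x" using near x by simp
      ultimately have "norm ((T f x - T (F N) x) - (f x - F (Suc N) x)) \<le> \<delta> / 2 * p x + \<delta> * p x"
        by (rule order_trans[OF norm_triangle_ineq4 add_mono])
      then have "norm (T f x - f x) \<le> \<delta> / 2 * p x + \<delta> * p x" by (simp add: FS)
      moreover have "\<delta> * p x = e / 2" using p(2)[OF x] by (simp add: \<delta>_def)
      ultimately show ?thesis using e by simp
    qed
    have "norm (T f x - f x) \<le> 0"
    proof (rule field_le_epsilon)
      fix e :: real assume "0 < e"
      from main[OF this] show "norm (T f x - f x) \<le> 0 + e" by simp
    qed
    then show ?thesis by simp
  qed
  from that[OF cf fle this] show thesis .
qed

section \<open>Integrability of matrix functions and integrals over half-lines\<close>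

lemma mult_absolutely_integrable:
  fixes f :: "real \<Rightarrow> complex^'n^'m" and g :: "real \<Rightarrow> complex^'p^'n"
  assumes "continuous_on S f" "S \<in> sets lebesgue" "bounded (f ` S)" "g absolutely_integrable_on S"
  shows "(\<lambda>x. f x ** g x) absolutely_integrable_on S"
  by (rule absolutely_integrable_bounded_measurable_product)
     (use assms in \<open>auto simp: bilinear_conv_bounded_bilinear bounded_bilinear_matrix_mult intro: continuous_imp_measurable_on_sets_lebesgue\<close>)

lemma mult_absolutely_integrable_right:
  fixes f :: "real \<Rightarrow> complex^'p^'n" and g :: "real \<Rightarrow> complex^'n^'m"
  assumes "continuous_on S f" "S \<in> sets lebesgue" "bounded (f ` S)" "g absolutely_integrable_on S"
  shows "(\<lambda>x. g x ** f x) absolutely_integrable_on S"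
  by (rule absolutely_integrable_bounded_measurable_product[where h = "\<lambda>a b. b ** a"])
     (use assms in \<open>auto simp: bilinear_conv_bounded_bilinear intro: bounded_bilinear.flip[OF bounded_bilinear_matrix_mult] continuous_imp_measurable_on_sets_lebesgue\<close>)

text \<open>\<open>E i k\<close> puts a scalar into a single entry, so the matrix function is a
  finite sum of integrable terms. This connects the entrywise hypothesis of the theorem with
  integrability of the whole potential.\<close>

lemma absolutely_integrable_entrywise:
  fixes A :: "real \<Rightarrow> complex^'q^'p"
  assumes "\<And>i k. (\<lambda>x. A x $ i $ k) absolutely_integrable_on S"
  shows "A absolutely_integrable_on S"
proof -
  define E where "E i k c = (\<chi> i' k'. if i' = i \<and> k' = k then c else 0 :: complex^'q^'p)" for i k and c :: complex
  have E: "bounded_linear (E i k)" for i k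
    unfolding linear_conv_bounded_linear[symmetric] by (rule linearI) (auto simp: E_def vec_eq_iff)
  have "A x = (\<Sum>i\<in>UNIV. \<Sum>k\<in>UNIV. E i k (A x $ i $ k))" for x
  proof -
    have "(\<Sum>i\<in>UNIV. \<Sum>k\<in>UNIV. E i k (A x $ i $ k)) $ a $ b = A x $ a $ b" for a b
    proof -
      have "(\<Sum>i\<in>UNIV. \<Sum>k\<in>UNIV. E i k (A x $ i $ k)) $ a $ b =
        (\<Sum>i\<in>UNIV. \<Sum>k\<in>UNIV. if a = i \<and> b = k then A x $ i $ k else 0)"
        by (simp add: E_def)
      also have "\<dots> = (\<Sum>i\<in>UNIV. if a = i then (\<Sum>k\<in>UNIV. if b = k then A x $ i $ k else 0) else 0)"
        by (intro sum.cong) (auto intro: sum.neutral)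
      finally show ?thesis by simp
    qed
    then show ?thesis by (simp add: vec_eq_iff)
  qed
  then have eq: "A = (\<lambda>x. \<Sum>i\<in>UNIV. \<Sum>k\<in>UNIV. E i k (A x $ i $ k))" by blast
  show ?thesis
    by (subst eq, intro absolutely_integrable_sum finite absolutely_integrable_linear[unfolded o_def, OF assms E])
qed

lemma continuous_on_indefinite_integral:
  fixes f :: "real \<Rightarrow> 'a::euclidean_space"
  assumes "\<And>b. f absolutely_integrable_on {0..b}"
  shows "continuous_on {0..} (\<lambda>x. c + integral {0..x} f)"
  by (intro continuous_on_halfline abs_continuous_on_imp_continuous_on
      abs_continuous_on_indefinite_integral assms)

lemma absolutely_integrable_tail:
  fixes f :: "real \<Rightarrow> 'a::euclidean_space"
  assumes "f absolutely_integrable_on {a..}" "a \<le> x"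
  shows "f absolutely_integrable_on {x..}" "f absolutely_integrable_on {x..b}"
  by (rule set_integrable_subset[OF assms(1)]; use assms(2) in auto)+

lemma integral_tail_eq:
  fixes f :: "real \<Rightarrow> 'a::euclidean_space"
  assumes f: "f absolutely_integrable_on {a..}" and x: "a \<le> x"
  shows "integral {x..} f = integral {a..} f - integral {a..x} f"
proof -
  have "integral ({a..x} \<union> {x..}) f = integral {a..x} f + integral {x..} f"
  proof (rule integral_Un)
    have "{a..x} \<inter> {x..} \<subseteq> {x}" by auto
    then show "negligible ({a..x} \<inter> {x..})" by (rule negligible_subset[rotated]) simp
  qed (use absolutely_integrable_tail[OF f, of a] absolutely_integrable_tail[OF f x] set_lebesgue_integral_eq_integral(1) in auto)
  moreover have "{a..x} \<union> {x..} = {a..}" using x by auto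
  ultimately show ?thesis by simp
qed

lemma tendsto_integral_halfline:
  fixes f :: "real \<Rightarrow> 'a::euclidean_space"
  assumes f: "f absolutely_integrable_on {a..}"
  shows "((\<lambda>b. integral {a..b} f) \<longlongrightarrow> integral {a..} f) at_top"
proof -
  have "((\<lambda>b. set_lebesgue_integral lebesgue {a..b} f) \<longlongrightarrow> set_lebesgue_integral lebesgue {a..} f) at_top"
    by (rule tendsto_set_lebesgue_integral_at_top) (use f in auto)
  then show ?thesis
    using set_lebesgue_integral_eq_integral(2)[OF f]
      set_lebesgue_integral_eq_integral(2)[OF absolutely_integrable_tail(2)[OF f order_refl]] by simp
qed

lemma tendsto_integral_tail:
  fixes f :: "real \<Rightarrow> 'a::euclidean_space"
  assumes f: "f absolutely_integrable_on {a..}"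
  shows "((\<lambda>x. integral {x..} f) \<longlongrightarrow> 0) at_top"
proof -
  have "((\<lambda>x. integral {a..} f - integral {a..x} f) \<longlongrightarrow> integral {a..} f - integral {a..} f) at_top"
    by (intro tendsto_intros tendsto_integral_halfline f)
  then have "((\<lambda>x. integral {a..} f - integral {a..x} f) \<longlongrightarrow> 0) at_top" by simp
  moreover have "eventually (\<lambda>x. integral {a..} f - integral {a..x} f = integral {x..} f) at_top"
    using eventually_ge_at_top[of a] by eventually_elim (rule integral_tail_eq[OF f, symmetric])
  ultimately show ?thesis by (rule Lim_transform_eventually)
qed

text \<open>Dominated convergence along a sequence of pairs: the moving lower limit is absorbed into
  the integrand as an indicator function, so that both variables are handled at once.\<close>

lemma continuous_on_tail_integral:
  fixes h :: "'z::metric_space \<Rightarrow> real \<Rightarrow> 'e::euclidean_space"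
  assumes int: "\<And>z. z \<in> D \<Longrightarrow> h z absolutely_integrable_on {0..}"
    and w: "w integrable_on {0..}" "\<And>z t. \<lbrakk>z \<in> D; 0 \<le> t\<rbrakk> \<Longrightarrow> norm (h z t) \<le> w t"
    and cont: "\<And>t. 0 \<le> t \<Longrightarrow> continuous_on D (\<lambda>z. h z t)"
  shows "continuous_on ({0..} \<times> D) (\<lambda>(x,z). integral {x..} (h z))"
  unfolding continuous_on_sequentially
proof (intro allI ballI impI, elim conjE)
  fix X :: "nat \<Rightarrow> real \<times> 'z" and a
  assume a: "a \<in> {0..} \<times> D" and X: "\<forall>n. X n \<in> {0..} \<times> D" and lim: "X \<longlonglongrightarrow> a"
  \<comment> \<open>At the limiting endpoint itself the indicators of the half-lines need not
    converge; removing this one point changes no integral.\<close>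
  define S where "S = {0..} - {fst a}"
  have spike: "integral ({y..} \<inter> S) f = integral {y..} f" if "0 \<le> y" for y and f :: "real \<Rightarrow> 'e"
    by (rule integral_spike_set; rule negligible_subset[of "{fst a}"]) (use that in \<open>auto simp: S_def\<close>)
  have limx: "(\<lambda>n. fst (X n)) \<longlonglongrightarrow> fst a" and limz: "(\<lambda>n. snd (X n)) \<longlonglongrightarrow> snd a"
    using lim by (auto intro: tendsto_fst tendsto_snd)
  define g where "g n t = (if t \<in> {fst (X n)..} then h (snd (X n)) t else 0)" for n t
  have "(\<lambda>n. integral S (g n)) \<longlonglongrightarrow> integral S (\<lambda>t. if t \<in> {fst a..} then h (snd a) t else 0)"
  proof (rule dominated_convergence(2))
    show "g n integrable_on S" for n
    proof -
      have hX: "h (snd (X n)) integrable_on {fst (X n)..}"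
        using X by (intro set_lebesgue_integral_eq_integral(1) absolutely_integrable_tail[OF int]) (auto simp: mem_Times_iff)
      have "h (snd (X n)) integrable_on ({fst (X n)..} \<inter> S)"
        by (rule integrable_spike_set[OF hX]; rule negligible_subset[of "{fst a}"])
          (use X[rule_format, of n] in \<open>auto simp: S_def mem_Times_iff\<close>)
      then show ?thesis unfolding g_def[abs_def] integrable_restrict_Int .
    qed
    show "w integrable_on S"
      by (rule integrable_spike_set[OF w(1)]; rule negligible_subset[of "{fst a}"]) (auto simp: S_def)
    have w0: "0 \<le> w t" if "0 \<le> t" for t
      using w(2)[of "snd a" t] a that norm_ge_zero order_trans by (metis mem_Times_iff)
    show "norm (g n t) \<le> w t" if "t \<in> S" for n t
      using that X w(2)[of "snd (X n)" t] w0[of t] by (auto simp: g_def S_def mem_Times_iff)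
    fix t assume t: "t \<in> S"
    have hz: "(\<lambda>n. h (snd (X n)) t) \<longlonglongrightarrow> h (snd a) t"
      using cont[of t] t X a limz
      by (auto simp: S_def mem_Times_iff continuous_on_sequentially o_def)
    have "t \<noteq> fst a" using t by (simp add: S_def)
    then consider "t < fst a" | "fst a < t" by linarith
    then show "(\<lambda>n. g n t) \<longlonglongrightarrow> (if t \<in> {fst a..} then h (snd a) t else 0)"
    proof cases
      case 1
      then have "eventually (\<lambda>n. t < fst (X n)) sequentially" using order_tendstoD(1)[OF limx] by blast
      then have "eventually (\<lambda>n. g n t = 0) sequentially" by eventually_elim (simp add: g_def)
      then show ?thesis using 1 by (simp add: tendsto_eventually)
    next
      case 2
      then have "eventually (\<lambda>n. fst (X n) < t) sequentially" using order_tendstoD(2)[OF limx] by blast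
      then have "eventually (\<lambda>n. h (snd (X n)) t = g n t) sequentially" by eventually_elim (simp add: g_def)
      from Lim_transform_eventually[OF hz this] 2 show ?thesis by simp
    qed
  qed
  then have "(\<lambda>n. integral {fst (X n)..} (h (snd (X n)))) \<longlonglongrightarrow> integral {fst a..} (h (snd a))"
    unfolding g_def[abs_def] Henstock_Kurzweil_Integration.integral_restrict_Int using X a by (simp add: spike mem_Times_iff)
  then show "((\<lambda>(x, z). integral {x..} (h z)) \<circ> X) \<longlonglongrightarrow> (case a of (x, z) \<Rightarrow> integral {x..} (h z))"
    by (simp add: o_def case_prod_unfold)
qed

text \<open>The weight grows fast enough to make the integral operator a contraction on the entire
  half-line, although \<open>A\<close> is only locally integrable. No gluing of solutions on short
  intervals is necessary.\<close>

theorem linear_initial_value_problem: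
  fixes A :: "real \<Rightarrow> complex^'n^'n" and C :: "complex^'q^'n"
  assumes A: "\<And>b. A absolutely_integrable_on {0..b}"
  obtains y where "\<And>b. 0 \<le> b \<Longrightarrow> abs_continuous_on {0..b} y" "y 0 = C"
    "AE x in lebesgue. 0 \<le> x \<longrightarrow> (y has_vector_derivative A x ** y x) (at x within {0..})"
proof -
  obtain K where K: "0 \<le> K" "\<And>(M :: complex^'n^'n) (N :: complex^'q^'n). norm (M ** N) \<le> norm M * norm N * K"
    using mm.nonneg_bounded by blast
  define q where "q t = norm (A t) * K" for t
  have q: "q absolutely_integrable_on {0..b}" for b
    unfolding q_def[abs_def] by (intro set_integrable_mult_left set_integrable_norm A)
  have qi: "q integrable_on {0..b}" for b using q set_lebesgue_integral_eq_integral(1) by blast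
  have q0: "0 \<le> q t" for t using K by (simp add: q_def)
  \<comment> \<open>The exponent 2 is the origin of the factor 1/2: the integral of
    \<open>q * p\<close> from 0 to \<open>x\<close> is \<open>(p x - 1) / 2\<close>.\<close>
  define p where "p x = exp (2 * integral {0..x} q)" for x
  have p1: "1 \<le> p x" for x
    using integral_nonneg[OF qi[of x]] q0 by (simp add: p_def)
  have pc: "continuous_on {0..} p"
    unfolding p_def[abs_def] using continuous_on_indefinite_integral[OF q, of 0] by (intro continuous_intros) simp
  have hint: "(\<lambda>t. A t ** f t) absolutely_integrable_on {0..b}" if "continuous_on {0..} f" for f :: "real \<Rightarrow> complex^'q^'n" and b
  proof -
    have "continuous_on {0..b} f" by (rule continuous_on_subset[OF that]) auto
    then show ?thesis
      by (intro mult_absolutely_integrable_right A) (auto intro: compact_imp_bounded compact_continuous_image)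
  qed
  define T where "T f x = C + integral {0..x} (\<lambda>t. A t ** f t)" for f and x :: real
  obtain y where y: "continuous_on {0..} y" "\<And>x. x \<in> {0..} \<Longrightarrow> T y x = y x"
  proof (rule weighted_contraction_fixed_point[of "{0..}" p T "norm C"])
    show "continuous_on {0..} (T f)" if "continuous_on {0..} f \<and> (\<exists>C. \<forall>x\<in>{0..}. norm (f x) \<le> C * p x)" for f
      unfolding T_def[abs_def] using that by (intro continuous_on_indefinite_integral hint) auto
    show "norm (T (\<lambda>_. 0) x) \<le> norm C * p x" for x :: real
      using mult_left_mono[OF p1, of "norm C" x] by (simp add: T_def)
    fix f g :: "real \<Rightarrow> complex^'q^'n" and L x :: real
    assume f: "continuous_on {0..} f \<and> (\<exists>C. \<forall>x\<in>{0..}. norm (f x) \<le> C * p x)"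
      and g: "continuous_on {0..} g \<and> (\<exists>C. \<forall>x\<in>{0..}. norm (g x) \<le> C * p x)"
      and fg: "\<And>x. x \<in> {0..} \<Longrightarrow> norm (f x - g x) \<le> L * p x" and x: "x \<in> {0..}"
    have "0 \<le> L * p 0" by (rule order_trans[OF norm_ge_zero fg]) simp
    then have L: "0 \<le> L" using p1[of 0] by (simp add: zero_le_mult_iff)
    have exp: "((\<lambda>t. q t * p t) has_integral (p x - 1) / 2) {0..x}"
      using has_integral_exp_indefinite_integral[OF q, of 0 x 2] q0 x by (simp add: p_def)
    have ai: "(\<lambda>t. A t ** f t) integrable_on {0..x}" "(\<lambda>t. A t ** g t) integrable_on {0..x}"
      using f g hint set_lebesgue_integral_eq_integral(1) by blast+
    have "T f x - T g x = integral {0..x} (\<lambda>t. A t ** f t - A t ** g t)"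
      unfolding T_def using ai by (simp add: integral_diff)
    also have "norm \<dots> \<le> integral {0..x} (\<lambda>t. L * (q t * p t))"
    proof (rule integral_norm_bound_integral)
      show "(\<lambda>t. A t ** f t - A t ** g t) integrable_on {0..x}" by (intro integrable_diff ai)
      show "(\<lambda>t. L * (q t * p t)) integrable_on {0..x}" using has_integral_mult_right[OF exp, of L] by (auto simp: integrable_on_def)
      show "norm (A t ** f t - A t ** g t) \<le> L * (q t * p t)" if "t \<in> {0..x}" for t
      proof -
        have "norm (A t ** f t - A t ** g t) \<le> norm (A t) * norm (f t - g t) * K"
          using K(2)[of "A t" "f t - g t"] by (simp add: mm.diff_right)
        also have "\<dots> \<le> norm (A t) * (L * p t) * K"
          using fg[of t] that K by (intro mult_right_mono mult_left_mono) auto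
        finally show ?thesis by (simp add: q_def mult_ac)
      qed
    qed
    also have "\<dots> = L * ((p x - 1) / 2)" using exp by (simp add: integral_unique)
    also have "\<dots> \<le> L * (p x / 2)" using L by (intro mult_left_mono) auto
    finally show "norm (T f x - T g x) \<le> L / 2 * p x" by simp
  qed (use pc p1 in \<open>auto intro: less_le_trans[OF zero_less_one]\<close>)
  \<comment> \<open>The fixed point \<open>y\<close> satisfies its integral formula only on the
    half-line. \<open>Y\<close> is given by the formula for every real argument, so the results on
    indefinite integrals apply to it literally.\<close>
  define Y where "Y x = C + integral {0..x} (\<lambda>t. A t ** y t)" for x
  have Yy: "Y x = y x" if "0 \<le> x" for x using y(2)[of x] that by (simp add: Y_def T_def)
  note hy = hint[OF y(1)]
  show thesis
  proof (rule that[of Y])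
    show "abs_continuous_on {0..b} Y" for b
      unfolding Y_def[abs_def] by (rule abs_continuous_on_indefinite_integral[OF hy])
    show "Y 0 = C" by (simp add: Y_def)
    have "AE x in lebesgue. 0 \<le> x \<longrightarrow> (Y has_vector_derivative A x ** y x) (at x within {0..})"
      unfolding Y_def[abs_def]
      by (rule indefinite_integral_has_vector_derivative_AE) (use hy set_lebesgue_integral_eq_integral(1) in blast)
    then show "AE x in lebesgue. 0 \<le> x \<longrightarrow> (Y has_vector_derivative A x ** Y x) (at x within {0..})"
      by eventually_elim (simp add: Yy)
  qed
qed

text \<open>For integrals from infinity the weight must decrease: \<open>q\<close> times the weight
  is -1/2 times the derivative of the weight. The limit of the weight at infinity is nonnegative and
  is dropped, which leaves an inequality.\<close>

lemma integral_exp_weight_tail: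
  fixes q :: "real \<Rightarrow> real"
  assumes q: "q absolutely_integrable_on {0..}" and q0: "\<And>t. 0 \<le> q t" and x: "0 \<le> x"
  shows "(\<lambda>t. q t * exp (-2 * integral {0..t} q)) integrable_on {x..}"
    and "integral {x..} (\<lambda>t. q t * exp (-2 * integral {0..t} q)) \<le> exp (-2 * integral {0..x} q) / 2"
proof -
  define w where "w t = exp (-2 * integral {0..t} q)" for t
  have qb: "q absolutely_integrable_on {0..b}" for b
    using absolutely_integrable_tail(2)[OF q order_refl] .
  have qi: "q integrable_on {0..b}" for b using qb set_lebesgue_integral_eq_integral(1) by blast
  have wc: "continuous_on {0..} w"
    unfolding w_def[abs_def] using continuous_on_indefinite_integral[OF qb, of 0] by (intro continuous_intros) simp
  have w1: "0 < w t" "w t \<le> 1" for t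
    using integral_nonneg[OF qi[of t]] q0 by (auto simp: w_def)
  have ai: "(\<lambda>t. w t * q t) absolutely_integrable_on {0..}"
  proof (rule absolutely_integrable_bounded_measurable_product_real)
    show "w \<in> borel_measurable (lebesgue_on {0..})"
      by (intro continuous_imp_measurable_on_sets_lebesgue wc) auto
    show "bounded (w ` {0..})"
      unfolding bounded_iff using w1 by (auto intro!: exI[of _ 1] simp: abs_of_pos)
  qed (use q in auto)
  then have ax: "(\<lambda>t. q t * w t) absolutely_integrable_on {x..}"
    using absolutely_integrable_tail(1)[OF ai x] by (simp add: mult.commute)
  then show "(\<lambda>t. q t * exp (-2 * integral {0..t} q)) integrable_on {x..}"
    unfolding w_def by (rule set_lebesgue_integral_eq_integral(1))
  have lim: "((\<lambda>b. integral {x..b} (\<lambda>t. q t * w t)) \<longlongrightarrow> integral {x..} (\<lambda>t. q t * w t)) at_top"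
    by (rule tendsto_integral_halfline[OF ax])
  have "integral {x..} (\<lambda>t. q t * w t) \<le> w x / 2"
  proof (rule tendsto_upperbound[OF lim])
    show "\<forall>\<^sub>F b in at_top. integral {x..b} (\<lambda>t. q t * w t) \<le> w x / 2"
      using eventually_ge_at_top[of x]
    proof eventually_elim
      case (elim b)
      have "((\<lambda>t. q t * w t) has_integral (w b - w x) / -2) {x..b}"
        unfolding w_def by (rule has_integral_exp_indefinite_integral[OF qb _ x elim]) (use q0 in auto)
      then have "integral {x..b} (\<lambda>t. q t * w t) = (w x - w b) / 2"
        by (metis integral_unique minus_diff_eq minus_divide_divide)
      then show ?case using w1(1)[of b] by (simp add: divide_right_mono)
    qed
  qed simp
  then show "integral {x..} (\<lambda>t. q t * exp (-2 * integral {0..t} q)) \<le> exp (-2 * integral {0..x} q) / 2"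
    by (simp add: w_def)
qed

text \<open>
  The weight $\mathrm{e}^{-2\int_0^x q}$ makes the integral operator a contraction with factor
  $1/2$. Iterating on functions of both variables makes the solution jointly continuous in $(x,z)$.
\<close>

theorem volterra_at_infinity:
  fixes M :: "real \<Rightarrow> complex \<Rightarrow> complex^'n^'n" and B :: "real \<Rightarrow> complex^'n^'n" and C :: "complex^'q^'n"
  assumes B: "B absolutely_integrable_on {0..}"
    and M: "continuous_on (UNIV \<times> D) (\<lambda>(x,z). M x z)"
    and add: "\<And>x y z (A :: complex^'q^'n). M x z ** (M y z ** A) = M (x + y) z ** A"
    and bound: "\<And>s z. \<lbrakk>0 \<le> s; z \<in> D\<rbrakk> \<Longrightarrow> norm (M (-s) z) \<le> \<kappa>"
    and C: "\<And>x z. \<lbrakk>0 \<le> x; z \<in> D\<rbrakk> \<Longrightarrow> norm (M x z ** C) \<le> \<beta>"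
  obtains f \<beta>' where "continuous_on ({0..} \<times> D) (\<lambda>(x,z). f x z)"
    "\<And>x z. \<lbrakk>0 \<le> x; z \<in> D\<rbrakk> \<Longrightarrow> norm (f x z) \<le> \<beta>'"
    "\<And>z. z \<in> D \<Longrightarrow> (\<lambda>t. M (-t) z ** (B t ** f t z)) absolutely_integrable_on {0..}"
    "\<And>x z. \<lbrakk>0 \<le> x; z \<in> D\<rbrakk> \<Longrightarrow> f x z = M x z ** (C - integral {x..} (\<lambda>t. M (-t) z ** (B t ** f t z)))"
proof -
  obtain K where K: "0 \<le> K" "\<And>(A :: complex^'n^'n) (N :: complex^'q^'n). norm (A ** N) \<le> norm A * norm N * K"
    using mm.nonneg_bounded by blast
  define \<kappa>' where "\<kappa>' = max 0 \<kappa>"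
  have \<kappa>': "0 \<le> \<kappa>'" "\<And>s z. \<lbrakk>0 \<le> s; z \<in> D\<rbrakk> \<Longrightarrow> norm (M (-s) z) \<le> \<kappa>'"
    using bound by (force simp: \<kappa>'_def)+
  \<comment> \<open>Each of the two matrix products costs a factor \<open>K\<close>, the kernel a
    factor \<open>\<kappa>'\<close>.\<close>
  define q where "q t = norm (B t) * (K * K * \<kappa>')" for t
  have q: "q absolutely_integrable_on {0..}"
    unfolding q_def[abs_def] by (intro set_integrable_mult_left set_integrable_norm B)
  have qi: "q integrable_on {0..}" "q integrable_on {0..b}" for b
    using q absolutely_integrable_tail(2)[OF q order_refl] set_lebesgue_integral_eq_integral(1) by blast+
  have q0: "0 \<le> q t" for t using K \<kappa>' by (simp add: q_def)
  define w where "w t = exp (-2 * integral {0..t} q)" for t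
  define p where "p a = w (fst a)" for a :: "real \<times> complex"
  have w1: "0 < w t" "w t \<le> 1" for t
    using integral_nonneg[OF qi(2)[of t]] q0 by (auto simp: w_def)
  \<comment> \<open>As \<open>q\<close> is integrable on the half-line, the weight stays above the
    positive number \<open>m\<close>; weighted bounds and plain uniform bounds are therefore
    equivalent.\<close>
  define m where "m = exp (-2 * integral {0..} q)"
  have m: "0 < m" "m \<le> w t" for t
  proof -
    have "integral {0..t} q \<le> integral {0..} q"
      by (rule integral_subset_le) (use qi q0 in auto)
    then show "0 < m" "m \<le> w t" by (simp_all add: m_def w_def)
  qed
  have wc: "continuous_on {0..} w"
    unfolding w_def[abs_def] using continuous_on_indefinite_integral[OF absolutely_integrable_tail(2)[OF q order_refl], of 0]
    by (intro continuous_intros) simp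
  have pc: "continuous_on ({0..} \<times> D) p"
    unfolding p_def[abs_def] by (rule continuous_on_compose2[OF wc continuous_on_fst[OF continuous_on_id]]) auto
  define adm where "adm f \<longleftrightarrow> continuous_on ({0..} \<times> D) f \<and> (\<exists>L. \<forall>a\<in>{0..} \<times> D. norm (f a) \<le> L * p a)"
    for f :: "real \<times> complex \<Rightarrow> complex^'q^'n"
  have admb: "\<exists>L. 0 \<le> L \<and> (\<forall>a\<in>{0..} \<times> D. norm (f a) \<le> L)" if fadm: "adm f" for f
  proof -
    obtain L where L: "\<And>a. a \<in> {0..} \<times> D \<Longrightarrow> norm (f a) \<le> L * p a" using fadm unfolding adm_def by blast
    have "norm (f a) \<le> max 0 L" if "a \<in> {0..} \<times> D" for a
    proof -
      have "norm (f a) \<le> max 0 L * p a"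
        using L[OF that] w1(1)[of "fst a"] by (smt (verit) p_def max.cobounded2 mult_right_mono)
      also have "\<dots> \<le> max 0 L" using w1(2)[of "fst a"] by (simp add: p_def mult_left_le)
      finally show ?thesis .
    qed
    then show ?thesis by (intro exI[of _ "max 0 L"]) simp
  qed
  have Mt: "continuous_on {0..} (\<lambda>t. M (-t) z)" if "z \<in> D" for z
  proof -
    have "continuous_on {0..} (\<lambda>t::real. case (-t, z) of (x, z) \<Rightarrow> M x z)"
      by (rule continuous_on_compose2[OF M]) (use that in \<open>auto intro!: continuous_intros\<close>)
    then show ?thesis by simp
  qed
  have ai: "(\<lambda>t. M (-t) z ** (B t ** f (t, z))) absolutely_integrable_on {0..}" if f: "adm f" and z: "z \<in> D" for f z
  proof -
    obtain L where L: "\<And>a. a \<in> {0..} \<times> D \<Longrightarrow> norm (f a) \<le> L" using admb[OF f] by blast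
    have fc: "continuous_on {0..} (\<lambda>t. f (t, z))"
    proof (rule continuous_on_compose2[of "{0..} \<times> D" f])
      show "continuous_on ({0..} \<times> D) f" using f by (simp add: adm_def)
    qed (use z in \<open>auto intro!: continuous_intros\<close>)
    have "(\<lambda>t. B t ** f (t, z)) absolutely_integrable_on {0..}"
      by (rule mult_absolutely_integrable_right[OF fc _ _ B]) (use L z in \<open>auto simp: bounded_iff\<close>)
    then show ?thesis
      by (rule mult_absolutely_integrable[OF Mt[OF z], rotated 2]) (use bound z in \<open>auto simp: bounded_iff\<close>)
  qed
  have hle: "norm (M (-s) z ** (B t ** e)) \<le> q t * norm e" if "0 \<le> s" "z \<in> D" for s z t and e :: "complex^'q^'n"
  proof -
    have "norm (M (-s) z ** (B t ** e)) \<le> norm (M (-s) z) * norm (B t ** e) * K" by (rule K)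
    also have "\<dots> \<le> \<kappa>' * (norm (B t) * norm e * K) * K"
      using \<kappa>' that K by (intro mult_right_mono mult_mono) auto
    finally show ?thesis by (simp add: q_def mult_ac)
  qed
  define T where "T f = (\<lambda>(x,z). M x z ** (C - integral {x..} (\<lambda>t. M (-t) z ** (B t ** f (t, z)))))"
    for f :: "real \<times> complex \<Rightarrow> complex^'q^'n"
  obtain f where f: "continuous_on ({0..} \<times> D) f"
    "\<And>a. a \<in> {0..} \<times> D \<Longrightarrow> norm (f a) \<le> 2 * (\<bar>\<beta>\<bar> / m) * p a" "\<And>a. a \<in> {0..} \<times> D \<Longrightarrow> T f a = f a"
  proof (rule weighted_contraction_fixed_point[of "{0..} \<times> D" p T "\<bar>\<beta>\<bar> / m"])
    show "continuous_on ({0..} \<times> D) (T f)" if "continuous_on ({0..} \<times> D) f \<and> (\<exists>C. \<forall>x\<in>{0..} \<times> D. norm (f x) \<le> C * p x)" for f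
    proof -
      have f: "adm f" using that by (simp add: adm_def)
      obtain L where L: "0 \<le> L" "\<And>a. a \<in> {0..} \<times> D \<Longrightarrow> norm (f a) \<le> L" using admb[OF f] by blast
      have "continuous_on ({0..} \<times> D) (\<lambda>(x,z). integral {x..} (\<lambda>t. M (-t) z ** (B t ** f (t, z))))"
      proof (rule continuous_on_tail_integral[where w = "\<lambda>t. L * q t"])
        show "(\<lambda>t. L * q t) integrable_on {0..}" by (intro integrable_on_mult_right qi)
        show "norm (M (-t) z ** (B t ** f (t, z))) \<le> L * q t" if "z \<in> D" "0 \<le> t" for z t
        proof -
          have "norm (M (-t) z ** (B t ** f (t, z))) \<le> q t * norm (f (t, z))" by (rule hle) (use that in auto)
          also have "\<dots> \<le> q t * L" using L(2)[of "(t,z)"] that q0 by (intro mult_left_mono) auto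
          finally show ?thesis by (simp add: mult.commute)
        qed
        show "continuous_on D (\<lambda>z. M (-t) z ** (B t ** f (t, z)))" if "0 \<le> t" for t
        proof (intro mm.continuous_on continuous_on_const)
          have "continuous_on D (\<lambda>z. case (-t, z) of (x, z) \<Rightarrow> M x z)"
            by (rule continuous_on_compose2[OF M]) (auto intro!: continuous_intros)
          then show "continuous_on D (\<lambda>z. M (-t) z)" by simp
          show "continuous_on D (\<lambda>z. f (t, z))"
          proof (rule continuous_on_compose2[of "{0..} \<times> D" f])
            show "continuous_on ({0..} \<times> D) f" using f by (simp add: adm_def)
          qed (use that in \<open>auto intro!: continuous_intros\<close>)
        qed
      qed (rule ai[OF f])
      moreover have "continuous_on ({0..} \<times> D) (\<lambda>(x,z). M x z)"
        by (rule continuous_on_subset[OF M]) auto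
      ultimately show ?thesis
        unfolding T_def case_prod_unfold by (intro mm.continuous_on continuous_on_diff continuous_on_const) auto
    qed
    show "norm (T (\<lambda>_. 0) a) \<le> \<bar>\<beta>\<bar> / m * p a" if "a \<in> {0..} \<times> D" for a
    proof -
      have "norm (T (\<lambda>_. 0) a) \<le> \<bar>\<beta>\<bar>" using C[of "fst a" "snd a"] that by (auto simp: T_def mm.zero_right)
      also have "\<dots> = \<bar>\<beta>\<bar> / m * m" using m by simp
      also have "\<dots> \<le> \<bar>\<beta>\<bar> / m * p a" unfolding p_def using m by (intro mult_left_mono) auto
      finally show ?thesis .
    qed
    fix f g :: "real \<times> complex \<Rightarrow> complex^'q^'n" and L :: real and a :: "real \<times> complex"
    assume "continuous_on ({0..} \<times> D) f \<and> (\<exists>C. \<forall>x\<in>{0..} \<times> D. norm (f x) \<le> C * p x)"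
      and "continuous_on ({0..} \<times> D) g \<and> (\<exists>C. \<forall>x\<in>{0..} \<times> D. norm (g x) \<le> C * p x)"
      and fg: "\<And>a. a \<in> {0..} \<times> D \<Longrightarrow> norm (f a - g a) \<le> L * p a" and a: "a \<in> {0..} \<times> D"
    then have adm: "adm f" "adm g" by (auto simp: adm_def)
    obtain x z where xz: "a = (x,z)" "0 \<le> x" "z \<in> D" using a by auto
    have "0 \<le> L * p a" by (rule order_trans[OF norm_ge_zero fg[OF a]])
    then have L: "0 \<le> L" using w1(1)[of "fst a"] by (simp add: p_def zero_le_mult_iff)
    note fi = set_lebesgue_integral_eq_integral(1)[OF absolutely_integrable_tail(1)[OF ai[OF adm(1) xz(3)] xz(2)]]
    note gi = set_lebesgue_integral_eq_integral(1)[OF absolutely_integrable_tail(1)[OF ai[OF adm(2) xz(3)] xz(2)]]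
    define h where "h t = M (-t) z ** (B t ** g (t, z)) - M (-t) z ** (B t ** f (t, z))" for t
    have hi: "h integrable_on {x..}" unfolding h_def[abs_def] by (intro integrable_diff fi gi)
    have bl: "bounded_linear (\<lambda>e :: complex^'q^'n. M x z ** e)" by (rule mm.bounded_linear_right)
    have "T f a - T g a = M x z ** integral {x..} h"
    proof -
      have "integral {x..} h = integral {x..} (\<lambda>t. M (-t) z ** (B t ** g (t, z))) - integral {x..} (\<lambda>t. M (-t) z ** (B t ** f (t, z)))"
        unfolding h_def[abs_def] by (rule integral_diff[OF gi fi])
      then show ?thesis by (simp only: T_def xz(1) prod.case) (simp add: mm.diff_right)
    qed
    also have "\<dots> = integral {x..} (\<lambda>t. M x z ** h t)"
      using integral_linear[OF hi bl] by (simp add: o_def)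
    also have "norm \<dots> \<le> integral {x..} (\<lambda>t. L * (q t * w t))"
    proof (rule integral_norm_bound_integral)
      show "(\<lambda>t. M x z ** h t) integrable_on {x..}" using integrable_linear[OF hi bl] by (simp add: o_def)
      show "(\<lambda>t. L * (q t * w t)) integrable_on {x..}"
        unfolding w_def by (intro integrable_on_mult_right integral_exp_weight_tail(1) q q0 xz)
      show "norm (M x z ** h t) \<le> L * (q t * w t)" if t: "t \<in> {x..}" for t
      proof -
        \<comment> \<open>For positive \<open>x\<close> there is no control of \<open>M x z\<close>
          alone. It has to be moved under the integral, where the group law merges the two factors
          into a kernel with argument \<open>x - t\<close>, which is not positive.\<close>
        have "M x z ** h t = M (- (t - x)) z ** (B t ** (g (t, z) - f (t, z)))"
          by (simp add: h_def mm.diff_right add)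
        also have "norm \<dots> \<le> q t * norm (g (t, z) - f (t, z))" by (rule hle) (use t xz in auto)
        also have "\<dots> \<le> q t * (L * w t)"
          using fg[of "(t,z)"] t xz q0[of t] by (intro mult_left_mono) (auto simp: p_def norm_minus_commute)
        finally show ?thesis by (simp add: mult_ac)
      qed
    qed
    also have "\<dots> = L * integral {x..} (\<lambda>t. q t * w t)" by simp
    also have "\<dots> \<le> L * (w x / 2)"
      unfolding w_def using integral_exp_weight_tail(2)[OF q q0 xz(2)] L by (intro mult_left_mono) auto
    finally show "norm (T f a - T g a) \<le> L / 2 * p a" by (simp add: p_def xz(1))
  qed (use pc w1 in \<open>auto simp: p_def\<close>)
  then have adm: "adm f" unfolding adm_def by blast
  show thesis
  proof (rule that[of "\<lambda>x z. f (x, z)" "2 * (\<bar>\<beta>\<bar> / m)"])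
    show "continuous_on ({0..} \<times> D) (\<lambda>(x, z). f (x, z))" using f(1) by simp
    show "(\<lambda>t. M (- t) z ** (B t ** f (t, z))) absolutely_integrable_on {0..}" if "z \<in> D" for z
      by (rule ai[OF adm that])
    fix x :: real and z assume xz: "0 \<le> x" "z \<in> D"
    then show "f (x, z) = M x z ** (C - integral {x..} (\<lambda>t. M (- t) z ** (B t ** f (t, z))))"
      using f(3)[of "(x,z)"] by (simp add: T_def)
    have "norm (f (x, z)) \<le> 2 * (\<bar>\<beta>\<bar> / m) * p (x,z)" using f(2)[of "(x,z)"] xz by simp
    also have "\<dots> \<le> 2 * (\<bar>\<beta>\<bar> / m)" using w1(2)[of x] m(1) by (intro mult_left_le) (auto simp: p_def)
    finally show "norm (f (x, z)) \<le> 2 * (\<bar>\<beta>\<bar> / m)" .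
  qed
qed

section \<open>Solutions of the Dirac system\<close>

lemma abs_continuous_on_cong:
  assumes f: "abs_continuous_on S f" and eq: "\<And>x. x \<in> S \<Longrightarrow> f x = g x"
  shows "abs_continuous_on S g"
proof (rule abs_continuous_on_dominated[OF f abs_continuous_on_const[of _ "0::real"]])
  fix u v assume "{u..v} \<subseteq> S" "u \<le> v"
  then have "u \<in> S" "v \<in> S" by auto
  then show "norm (g v - g u) \<le> 1 * (norm (f v - f u) + norm (0 - 0 :: real))" by (simp add: eq)
qed simp

lemma dirac_solution_cong:
  assumes y: "dirac_solution v z y" and eq: "\<And>x. 0 \<le> x \<Longrightarrow> y x = w x"
  shows "dirac_solution v z w"
proof -
  have "abs_continuous_on {0..b} w" if "0 \<le> b" for b
    by (rule abs_continuous_on_cong[of _ y]) (use y eq that in \<open>auto simp: dirac_solution_iff\<close>)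
  moreover have "AE x in lebesgue. 0 \<le> x \<longrightarrow> (y has_vector_derivative dirac_matrix v z x ** y x) (at x within {0..})"
    using y by (simp add: dirac_solution_iff)
  then have "AE x in lebesgue. 0 \<le> x \<longrightarrow> (w has_vector_derivative dirac_matrix v z x ** w x) (at x within {0..})"
  proof (eventually_elim, intro impI)
    fix x :: real
    assume *: "0 \<le> x \<longrightarrow> (y has_vector_derivative dirac_matrix v z x ** y x) (at x within {0..})" "0 \<le> x"
    then have "(y has_vector_derivative dirac_matrix v z x ** y x) (at x within {0..})" by blast
    then show "(w has_vector_derivative dirac_matrix v z x ** w x) (at x within {0..})"
      unfolding eq[OF *(2)] by (rule has_vector_derivative_transform[rotated 2]) (use * eq in auto)
  qed
  ultimately show ?thesis by (auto simp: dirac_solution_iff)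
qed

section \<open>Existence, invertibility and uniqueness for initial values at 0\<close>

definition jpotential :: "(real \<Rightarrow> complex^'m2^'m1) \<Rightarrow> real \<Rightarrow> complex^('m1::finite + 'm2::finite)^('m1 + 'm2)" where
  "jpotential v x = mat \<i> ** (dirac_j ** potential v x)"

lemma dirac_matrix_mult:
  "dirac_matrix v z x ** A = mat (\<i> * z) ** (dirac_j ** A) + jpotential v x ** A"
  unfolding dirac_matrix_def jpotential_def
  by (simp add: mm.add_right mm.add_left mat_mult_mat matrix_mul_assoc[symmetric])

lemma absolutely_integrable_const_mult:
  fixes g :: "real \<Rightarrow> complex^'p^'n" and c :: "complex^'n^'m"
  assumes "g absolutely_integrable_on S"
  shows "(\<lambda>x. c ** g x) absolutely_integrable_on S"
  using absolutely_integrable_linear[OF assms mm.bounded_linear_right] by (simp add: o_def)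

lemma jpotential_absolutely_integrable:
  assumes "potential v absolutely_integrable_on {0..}"
  shows "jpotential v absolutely_integrable_on {0..}"
  unfolding jpotential_def[abs_def] by (intro absolutely_integrable_const_mult assms)

lemma dirac_initial_value_problem:
  fixes v :: "real \<Rightarrow> complex^'m2^'m1" and C :: "complex^'q^('m1::finite + 'm2::finite)"
  assumes V: "potential v absolutely_integrable_on {0..}"
  obtains u where "dirac_solution v z u" "u 0 = C"
proof -
  have eq: "dirac_matrix v z = (\<lambda>x. mat (\<i> * z) ** dirac_j + jpotential v x)"
    using dirac_matrix_mult[of v z _ "mat 1"] by (simp add: fun_eq_iff)
  have "dirac_matrix v z absolutely_integrable_on {0..b}" for b
    unfolding eq
    by (intro set_integral_add absolutely_integrable_on_const absolutely_integrable_tail(2)[OF jpotential_absolutely_integrable[OF V]]) auto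
  then show thesis
  proof (rule linear_initial_value_problem[where C = C])
    fix y assume y: "\<And>b. 0 \<le> b \<Longrightarrow> abs_continuous_on {0..b} y" "y 0 = C"
      "AE x in lebesgue. 0 \<le> x \<longrightarrow> (y has_vector_derivative dirac_matrix v z x ** y x) (at x within {0..})"
    show thesis
      by (rule that[of y]) (use y in \<open>simp_all add: dirac_solution_iff\<close>)
  qed
qed

lemma wronskian_constant:
  fixes X :: "real \<Rightarrow> complex^'p^('m1::finite + 'm2::finite)" and Y :: "real \<Rightarrow> complex^'q^('m1 + 'm2)"
  assumes "dirac_solution v (cnj z) X" "dirac_solution v z Y" "0 \<le> a" "a \<le> b"
  shows "adj (X b) ** (dirac_j ** Y b) = adj (X a) ** (dirac_j ** Y a)"
proof -
  have "((\<lambda>x. 0) has_integral adj (X b) ** (dirac_j ** Y b) - adj (X a) ** (dirac_j ** Y a)) {a..b}"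
    using wronskian[OF assms] by simp
  then show ?thesis using has_integral_unique[OF _ has_integral_0] by fastforce
qed

text \<open>The Wronskian with the normalized solution \<open>w\<close> at the conjugate parameter
  keeps its initial value \<open>dirac_j\<close>, which makes
  \<open>dirac_j ** (adj (w x) ** dirac_j)\<close> an explicit left inverse of
  \<open>u x\<close>.\<close>

lemma fundamental_solution_exists:
  fixes v :: "real \<Rightarrow> complex^'m2::finite^'m1::finite"
  assumes V: "potential v absolutely_integrable_on {0..}"
  obtains u where "fundamental_solution v z u" "u 0 = mat 1"
proof -
  obtain u :: "real \<Rightarrow> complex^('m1 + 'm2)^('m1 + 'm2)" where u: "dirac_solution v z u" "u 0 = mat 1"
    using dirac_initial_value_problem[OF V] by metis
  obtain w :: "real \<Rightarrow> complex^('m1 + 'm2)^('m1 + 'm2)" where w: "dirac_solution v (cnj z) w" "w 0 = mat 1"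
    using dirac_initial_value_problem[OF V] by metis
  have "invertible (u x)" if "0 \<le> x" for x
  proof -
    have "adj (w x) ** (dirac_j ** u x) = dirac_j"
      using wronskian_constant[OF w(1) u(1) order_refl that] w(2) u(2) by simp
    then have "(dirac_j ** (adj (w x) ** dirac_j)) ** u x = mat 1"
      by (simp add: matrix_mul_assoc[symmetric])
    then show ?thesis using invertible_left_inverse by blast
  qed
  then show ?thesis using that u by (auto simp: fundamental_solution_def)
qed

lemma invertible_mult_zero:
  fixes A :: "complex^'n^'n" and B :: "complex^'p^'n"
  assumes "invertible A" "A ** B = 0"
  shows "B = 0"
proof -
  obtain A' where "A' ** A = mat 1" using assms(1) invertible_left_inverse by blast
  then have "B = A' ** (A ** B)" by (simp add: matrix_mul_assoc)
  then show ?thesis using assms(2) by simp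
qed

lemma dirac_j_mult_eq_0: "dirac_j ** A = 0 \<longleftrightarrow> A = 0"
  by (metis dirac_j_idem_assoc mm.zero_right)

lemma invertible_adj:
  fixes A :: "complex^'n^'n"
  assumes "invertible A" shows "invertible (adj A)"
proof -
  obtain B where "A ** B = mat 1" "B ** A = mat 1" using assms by (auto simp: invertible_def)
  then have "adj A ** adj B = mat 1" "adj B ** adj A = mat 1" by (simp_all add: adj_mult[symmetric])
  then show ?thesis by (auto simp: invertible_def)
qed

text \<open>The difference of the two solutions starts at 0, so its Wronskian with an invertible
  solution at the conjugate parameter is 0 throughout, and an invertible factor can be
  cancelled.\<close>

lemma dirac_solution_unique:
  fixes v :: "real \<Rightarrow> complex^'m2::finite^'m1::finite" and y :: "real \<Rightarrow> complex^'q^('m1 + 'm2)"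
  assumes V: "potential v absolutely_integrable_on {0..}"
    and y: "dirac_solution v z y" and w: "dirac_solution v z w" and eq: "y 0 = w 0" and x: "0 \<le> x"
  shows "y x = w x"
proof -
  obtain u :: "real \<Rightarrow> complex^('m1 + 'm2)^('m1 + 'm2)" where u: "fundamental_solution v (cnj z) u"
    using fundamental_solution_exists[OF V] by blast
  then have "adj (u x) ** (dirac_j ** (y x - w x)) = 0"
    using wronskian_constant[OF _ dirac_solution_diff[OF y w] order_refl x, of u] eq
    by (simp add: fundamental_solution_def mm.zero_right)
  moreover have "invertible (adj (u x))" using u x by (simp add: fundamental_solution_def invertible_adj)
  ultimately have "y x - w x = 0" using invertible_mult_zero dirac_j_mult_eq_0 by metis
  then show ?thesis by simp
qed

section \<open>Spectral projections of j and the scaled free exponential\<close>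

definition upper_proj :: "complex^('m1::finite + 'm2::finite)^('m1 + 'm2)" where
  "upper_proj = vstack (hstack (mat 1) 0) (hstack 0 0)"

definition lower_proj :: "complex^('m1::finite + 'm2::finite)^('m1 + 'm2)" where
  "lower_proj = vstack (hstack 0 0) (hstack 0 (mat 1))"

lemma upper_proj_mult [simp]: "upper (upper_proj ** A) = upper A" "lower (upper_proj ** A) = 0"
  and lower_proj_mult [simp]: "upper (lower_proj ** A) = 0" "lower (lower_proj ** A) = lower A"
  for A :: "complex^'q^('m1::finite + 'm2::finite)"
  by (simp_all add: upper_proj_def lower_proj_def upper_hstack_mult lower_hstack_mult)

lemma upper_zero [simp]: "upper 0 = 0" and lower_zero [simp]: "lower 0 = 0"
  by (simp_all add: vec_eq_iff)

text \<open>The block rules rewrite \<open>upper\<close> and \<open>lower\<close> of products only.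
  The right factor \<open>mat 1\<close> gives a bare matrix that shape, so that they apply to every
  factor.\<close>

lemma matrix_eqI:
  fixes A B :: "complex^'n^('m1::finite + 'm2::finite)"
  assumes "upper (A ** mat 1) = upper (B ** mat 1)" "lower (A ** mat 1) = lower (B ** mat 1)"
  shows "A = B"
  using assms by (simp add: vec_eq_iff_sum)

lemma exp_ixzj_eq:
  "exp_ixzj x z = mat (exp (\<i> * of_real x * z)) ** upper_proj + mat (exp (- \<i> * of_real x * z)) ** lower_proj"
  by (rule matrix_eqI) (simp_all add: mm.add_left matrix_mul_assoc[symmetric] mm.zero_right del: matrix_mul_rid)

lemma bounded_linear_mat: "bounded_linear (mat :: complex \<Rightarrow> complex^'n^'n)"
  unfolding linear_conv_bounded_linear[symmetric]
  by (rule linearI) (auto simp: vec_eq_iff mat_def)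

lemma exp_ixzj_has_vector_derivative:
  "((\<lambda>x. exp_ixzj x z :: complex^('m1::finite + 'm2::finite)^('m1 + 'm2)) has_vector_derivative mat (\<i> * z) ** (dirac_j ** exp_ixzj x z)) (at x within S)"
proof -
  have e: "((\<lambda>x. exp (c * of_real x * z)) has_vector_derivative exp (c * of_real x * z) * (c * z)) (at x within S)" for c :: complex
  proof -
    have "((\<lambda>x. of_real x) has_vector_derivative (1::complex)) (at x within S)"
      using bounded_linear.has_vector_derivative[OF bounded_linear_of_real has_vector_derivative_id] by simp
    then have 1: "((\<lambda>x. c * of_real x * z) has_vector_derivative c * 1 * z) (at x within S)"
      by (intro has_vector_derivative_mult_left has_vector_derivative_mult_right)
    have 2: "(exp has_field_derivative exp (c * of_real x * z)) (at (c * of_real x * z) within (\<lambda>x. c * of_real x * z) ` S)"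
      by (rule DERIV_subset[OF DERIV_exp]) simp
    show ?thesis using field_vector_diff_chain_within[OF 1 2] by (simp add: o_def mult.commute)
  qed
  have m: "((\<lambda>x. mat (exp (c * of_real x * z)) ** P) has_vector_derivative mat (exp (c * of_real x * z) * (c * z)) ** P) (at x within S)"
    for c and P :: "complex^('m1 + 'm2)^('m1 + 'm2)"
    by (rule bounded_linear.has_vector_derivative[OF bounded_linear_compose[OF mm.bounded_linear_left bounded_linear_mat, unfolded o_def]]) (rule e)
  have "((\<lambda>x. exp_ixzj x z :: complex^('m1 + 'm2)^('m1 + 'm2)) has_vector_derivative
      mat (exp (\<i> * of_real x * z) * (\<i> * z)) ** upper_proj + mat (exp (- \<i> * of_real x * z) * (- \<i> * z)) ** lower_proj) (at x within S)"
    unfolding exp_ixzj_eq by (intro has_vector_derivative_add m)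
  also have "mat (exp (\<i> * of_real x * z) * (\<i> * z)) ** upper_proj + mat (exp (- \<i> * of_real x * z) * (- \<i> * z)) ** lower_proj
      = mat (\<i> * z) ** (dirac_j ** exp_ixzj x z :: complex^('m1 + 'm2)^('m1 + 'm2))"
    by (rule matrix_eqI)
      (simp_all add: mm.add_left matrix_mul_assoc[symmetric] mm.zero_right mm.minus_right[symmetric] mat_mult_mat mult_ac del: matrix_mul_rid,
       simp add: vec_eq_iff mat_mult_nth)
  finally show ?thesis .
qed

text \<open>
  This is $\mathrm{e}^{-\mathrm{i}\sigma xz}\mathrm{e}^{\mathrm{i}xzj}$. The values $\sigma = 1$ and
  $\sigma = -1$ produce the solutions decaying for $z$ in the upper and lower half-plane,
  $\sigma = 0$ the Jost solution for real $z$.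
\<close>

definition scaled_exp :: "real \<Rightarrow> real \<Rightarrow> complex \<Rightarrow> complex^('m1::finite + 'm2::finite)^('m1 + 'm2)" where
  "scaled_exp \<sigma> x z = mat (exp (- (\<i> * of_real \<sigma> * of_real x * z))) ** exp_ixzj x z"

lemma scaled_exp_mult: "scaled_exp \<sigma> x z ** A = mat (exp (- (\<i> * of_real \<sigma> * of_real x * z))) ** (exp_ixzj x z ** A)"
  by (simp add: scaled_exp_def matrix_mul_assoc)

lemma scaled_exp_add: "scaled_exp \<sigma> x z ** (scaled_exp \<sigma> y z ** A) = scaled_exp \<sigma> (x + y) z ** A"
proof -
  have "exp (- (\<i> * of_real \<sigma> * of_real x * z)) * exp (- (\<i> * of_real \<sigma> * of_real y * z)) = exp (- (\<i> * of_real \<sigma> * of_real (x + y) * z))"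
    by (simp add: exp_add[symmetric] algebra_simps)
  then show ?thesis
    by (simp add: scaled_exp_mult mult_mat_left_comm[of "exp_ixzj x z"] mat_mult_mat exp_ixzj_add)
qed

lemma scaled_exp_eq:
  "scaled_exp \<sigma> x z = mat (exp (\<i> * of_real (1 - \<sigma>) * of_real x * z)) ** upper_proj
     + mat (exp (- (\<i> * of_real (1 + \<sigma>) * of_real x * z))) ** lower_proj"
  unfolding scaled_exp_def exp_ixzj_eq
  by (simp add: mm.add_right mat_mult_mat exp_add[symmetric] algebra_simps)

lemma norm_mat_mult_le: "\<exists>K\<ge>0. \<forall>c. norm (mat c ** (A :: complex^'n^'n)) \<le> norm c * K"
  using bounded_linear.nonneg_bounded[OF bounded_linear_compose[OF mm.bounded_linear_left bounded_linear_mat]]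
  by (metis comp_apply)

text \<open>The sign conditions say that both diagonal exponentials have modulus at most 1 at a
  negative argument. They describe the closed upper half-plane for \<open>\<sigma> = 1\<close>, the
  closed lower one for \<open>\<sigma> = -1\<close>, and the real line for
  \<open>\<sigma> = 0\<close>.\<close>

lemma scaled_exp_bounded:
  obtains \<kappa> where "\<And>s z. \<lbrakk>0 \<le> s; (1 - \<sigma>) * Im z \<le> 0; 0 \<le> (1 + \<sigma>) * Im z\<rbrakk>
    \<Longrightarrow> norm (scaled_exp \<sigma> (-s) z :: complex^('m1::finite + 'm2::finite)^('m1 + 'm2)) \<le> \<kappa>"
proof -
  obtain K1 where K1: "K1 \<ge> 0" "\<And>c. norm (mat c ** (upper_proj :: complex^('m1 + 'm2)^('m1 + 'm2))) \<le> norm c * K1"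
    using norm_mat_mult_le by metis
  obtain K2 where K2: "K2 \<ge> 0" "\<And>c. norm (mat c ** (lower_proj :: complex^('m1 + 'm2)^('m1 + 'm2))) \<le> norm c * K2"
    using norm_mat_mult_le by metis
  show thesis
  proof (rule that[of "1 * K1 + 1 * K2"])
    fix s :: real and z assume s: "0 \<le> s" "(1 - \<sigma>) * Im z \<le> 0" "0 \<le> (1 + \<sigma>) * Im z"
    have a: "norm (exp (\<i> * of_real (1 - \<sigma>) * of_real (-s) * z)) \<le> 1"
      using mult_left_mono[OF s(2,1)] by (simp add: norm_exp_eq_Re algebra_simps)
    have b: "norm (exp (- (\<i> * of_real (1 + \<sigma>) * of_real (-s) * z))) \<le> 1"
      using mult_left_mono[OF s(3,1)] by (simp add: norm_exp_eq_Re algebra_simps)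
    have "norm (scaled_exp \<sigma> (-s) z :: complex^('m1 + 'm2)^('m1 + 'm2)) \<le>
      norm (exp (\<i> * of_real (1 - \<sigma>) * of_real (-s) * z)) * K1 + norm (exp (- (\<i> * of_real (1 + \<sigma>) * of_real (-s) * z))) * K2"
      unfolding scaled_exp_eq by (intro norm_triangle_le add_mono K1 K2)
    also have "\<dots> \<le> 1 * K1 + 1 * K2" using a b K1(1) K2(1) by (intro add_mono mult_right_mono)
    finally show "norm (scaled_exp \<sigma> (-s) z :: complex^('m1 + 'm2)^('m1 + 'm2)) \<le> 1 * K1 + 1 * K2" .
  qed
qed

lemma scaled_exp_continuous_on:
  "continuous_on S (\<lambda>(x,z). scaled_exp \<sigma> x z :: complex^('m1::finite + 'm2::finite)^('m1 + 'm2))"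
proof -
  have m: "continuous_on S (\<lambda>p. mat (h p) ** P)"
    if "continuous_on S h" for h :: "real \<times> complex \<Rightarrow> complex" and P :: "complex^('m1 + 'm2)^('m1 + 'm2)"
    by (intro mm.continuous_on bounded_linear.continuous_on[OF bounded_linear_mat] that continuous_on_const)
  show ?thesis
    unfolding scaled_exp_eq case_prod_unfold by (intro continuous_on_add m continuous_intros)
qed

text \<open>Variation of constants around the free solution \<open>exp_ixzj x z ** C\<close>, with
  the amplitude prescribed at infinity and the scalar exp(i \<sigma> x z) divided out. The bound on
  the leading term is a hypothesis, since it depends on which columns \<open>C\<close>
  selects.\<close>

theorem dirac_volterra_solution:
  fixes v :: "real \<Rightarrow> complex^'m2::finite^'m1::finite" and C :: "complex^'q^('m1 + 'm2)"
  assumes V: "potential v absolutely_integrable_on {0..}"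
    and D: "\<And>z. z \<in> D \<Longrightarrow> (1 - \<sigma>) * Im z \<le> 0 \<and> 0 \<le> (1 + \<sigma>) * Im z"
    and C: "\<And>x z. \<lbrakk>0 \<le> x; z \<in> D\<rbrakk> \<Longrightarrow> norm (scaled_exp \<sigma> x z ** C) \<le> \<beta>"
  obtains f \<beta>' where "continuous_on ({0..} \<times> D) (\<lambda>(x,z). f x z)"
    "\<And>x z. \<lbrakk>0 \<le> x; z \<in> D\<rbrakk> \<Longrightarrow> norm (f x z) \<le> \<beta>'"
    "\<And>z. z \<in> D \<Longrightarrow> dirac_solution v z (\<lambda>x. mat (exp (\<i> * of_real \<sigma> * of_real x * z)) ** f x z)"
    "\<And>z. z \<in> D \<Longrightarrow> ((\<lambda>x. f x z - scaled_exp \<sigma> x z ** C) \<longlongrightarrow> 0) at_top"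
proof -
  let ?M = "scaled_exp \<sigma> :: real \<Rightarrow> complex \<Rightarrow> complex^('m1 + 'm2)^('m1 + 'm2)"
  let ?B = "jpotential v"
  note B = jpotential_absolutely_integrable[OF V]
  obtain \<kappa> where \<kappa>: "\<And>s z. \<lbrakk>0 \<le> s; z \<in> D\<rbrakk> \<Longrightarrow> norm (?M (-s) z) \<le> \<kappa>"
    using scaled_exp_bounded[of \<sigma>] D by metis
  obtain f \<beta>' where f: "continuous_on ({0..} \<times> D) (\<lambda>(x,z). f x z)"
    "\<And>x z. \<lbrakk>0 \<le> x; z \<in> D\<rbrakk> \<Longrightarrow> norm (f x z) \<le> \<beta>'"
    "\<And>z. z \<in> D \<Longrightarrow> (\<lambda>t. ?M (-t) z ** (?B t ** f t z)) absolutely_integrable_on {0..}"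
    "\<And>x z. \<lbrakk>0 \<le> x; z \<in> D\<rbrakk> \<Longrightarrow> f x z = ?M x z ** (C - integral {x..} (\<lambda>t. ?M (-t) z ** (?B t ** f t z)))"
    using volterra_at_infinity[OF B scaled_exp_continuous_on scaled_exp_add \<kappa> C] by blast
  show thesis
  proof (rule that[of f \<beta>'])
    fix z assume z: "z \<in> D"
    define g where "g t = ?M (-t) z ** (?B t ** f t z)" for t
    have g: "g absolutely_integrable_on {0..}" using f(3)[OF z] by (simp add: g_def[abs_def])
    have gb: "g absolutely_integrable_on {0..b}" for b by (rule absolutely_integrable_tail(2)[OF g order_refl])
    have gi: "g integrable_on {0..b}" for b using gb set_lebesgue_integral_eq_integral(1) by blast
    \<comment> \<open>The amplitude of the solution in front of the free exponential. Writing the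
      tail integral as a constant plus an integral from 0 makes it absolutely continuous with
      derivative \<open>g\<close>.\<close>
    define P where "P x = (C - integral {0..} g) + integral {0..x} g" for x
    have fP: "f x z = ?M x z ** P x" if "0 \<le> x" for x
    proof -
      have "P x = C - integral {x..} g" using integral_tail_eq[OF g that] by (simp add: P_def algebra_simps)
      then show ?thesis using f(4)[OF that z] by (simp add: g_def[abs_def])
    qed
    have cancel: "mat (exp (\<i> * of_real \<sigma> * of_real x * z)) ** (mat (exp (- (\<i> * of_real \<sigma> * of_real x * z))) ** A) = A"
      for x and A :: "complex^'q^('m1 + 'm2)"
      by (simp add: mat_mult_mat exp_minus)
    have YP: "mat (exp (\<i> * of_real \<sigma> * of_real x * z)) ** f x z = exp_ixzj x z ** P x" if "0 \<le> x" for x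
      unfolding fP[OF that] scaled_exp_mult by (rule cancel)
    have "dirac_solution v z (\<lambda>x. exp_ixzj x z ** P x)"
      unfolding dirac_solution_iff
    proof (intro conjI allI impI)
      show "abs_continuous_on {0..b} (\<lambda>x. exp_ixzj x z ** P x)" for b
      proof (rule abs_continuous_on_bilinear[OF bounded_bilinear_matrix_mult])
        have "continuous_on {0..b} (\<lambda>x. exp_ixzj x z :: complex^('m1 + 'm2)^('m1 + 'm2))"
          by (rule continuous_on_vector_derivative) (rule exp_ixzj_has_vector_derivative)
        then show "abs_continuous_on {0..b} (\<lambda>x. exp_ixzj x z :: complex^('m1 + 'm2)^('m1 + 'm2))"
          by (intro abs_continuous_on_differentiable[OF exp_ixzj_has_vector_derivative] mm.continuous_on continuous_on_const)
        show "abs_continuous_on {0..b} P"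
          unfolding P_def[abs_def] by (rule abs_continuous_on_indefinite_integral[OF gb])
      qed
      have "AE x in lebesgue. 0 \<le> x \<longrightarrow> (P has_vector_derivative g x) (at x within {0..})"
        unfolding P_def[abs_def] by (rule indefinite_integral_has_vector_derivative_AE[OF gi])
      then show "AE x in lebesgue. 0 \<le> x \<longrightarrow>
        ((\<lambda>x. exp_ixzj x z ** P x) has_vector_derivative dirac_matrix v z x ** (exp_ixzj x z ** P x)) (at x within {0..})"
      proof (eventually_elim, intro impI)
        fix x :: real assume x: "0 \<le> x \<longrightarrow> (P has_vector_derivative g x) (at x within {0..})" "0 \<le> x"
        have "exp_ixzj x z ** g x = jpotential v x ** (exp_ixzj x z ** P x)"
        proof -
          have "exp_ixzj x z ** g x = mat (exp (\<i> * of_real \<sigma> * of_real x * z)) ** (?M x z ** g x)"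
            unfolding scaled_exp_mult by (rule cancel[symmetric])
          also have "?M x z ** g x = ?B x ** f x z"
            unfolding g_def scaled_exp_add by (simp add: scaled_exp_mult)
          also have "mat (exp (\<i> * of_real \<sigma> * of_real x * z)) ** (?B x ** f x z) = ?B x ** (exp_ixzj x z ** P x)"
            unfolding YP[OF x(2), symmetric] by (simp add: mult_mat_left_comm[of "?B x"])
          finally show ?thesis .
        qed
        moreover have "((\<lambda>x. exp_ixzj x z ** P x) has_vector_derivative
            exp_ixzj x z ** g x + mat (\<i> * z) ** (dirac_j ** exp_ixzj x z) ** P x) (at x within {0..})"
          using x by (intro mm.has_vector_derivative exp_ixzj_has_vector_derivative) auto
        ultimately show "((\<lambda>x. exp_ixzj x z ** P x) has_vector_derivative dirac_matrix v z x ** (exp_ixzj x z ** P x)) (at x within {0..})"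
          by (simp add: dirac_matrix_mult matrix_mul_assoc add.commute mm.add_left)
      qed
    qed
    then show "dirac_solution v z (\<lambda>x. mat (exp (\<i> * of_real \<sigma> * of_real x * z)) ** f x z)"
      by (rule dirac_solution_cong) (simp add: YP)
    obtain K where K: "0 \<le> K" "\<And>(A :: complex^('m1 + 'm2)^('m1 + 'm2)) (N :: complex^'q^('m1 + 'm2)). norm (A ** N) \<le> norm A * norm N * K"
      using mm.nonneg_bounded by blast
    \<comment> \<open>An integrable majorant independent of \<open>x\<close>: the deviation from the
      leading term is then bounded by a tail of its integral.\<close>
    define q where "q t = \<bar>\<kappa>\<bar> * (norm (?B t) * \<bar>\<beta>'\<bar> * K) * K" for t
    have q: "q absolutely_integrable_on {0..}"
      unfolding q_def[abs_def] by (intro set_integrable_mult_left set_integrable_mult_right set_integrable_norm B)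
    show "((\<lambda>x. f x z - ?M x z ** C) \<longlongrightarrow> 0) at_top"
    proof (rule Lim_null_comparison)
      show "((\<lambda>x. integral {x..} q) \<longlongrightarrow> 0) at_top" by (rule tendsto_integral_tail[OF q])
      show "\<forall>\<^sub>F x in at_top. norm (f x z - ?M x z ** C) \<le> integral {x..} q"
        using eventually_ge_at_top[of 0]
      proof eventually_elim
        case (elim x)
        have gx: "g integrable_on {x..}"
          by (rule set_lebesgue_integral_eq_integral(1)[OF absolutely_integrable_tail(1)[OF g elim]])
        have bl: "bounded_linear (\<lambda>e :: complex^'q^('m1 + 'm2). ?M x z ** e)" by (rule mm.bounded_linear_right)
        have "f x z - ?M x z ** C = - (?M x z ** integral {x..} g)"
          using f(4)[OF elim z] by (simp add: g_def[abs_def] mm.diff_right)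
        then have "norm (f x z - ?M x z ** C) = norm (integral {x..} (\<lambda>t. ?M x z ** g t))"
          using integral_linear[OF gx bl] by (simp add: o_def)
        also have "\<dots> \<le> integral {x..} q"
        proof (rule integral_norm_bound_integral)
          show "(\<lambda>t. ?M x z ** g t) integrable_on {x..}" using integrable_linear[OF gx bl] by (simp add: o_def)
          show "q integrable_on {x..}"
            by (rule set_lebesgue_integral_eq_integral(1)[OF absolutely_integrable_tail(1)[OF q elim]])
          show "norm (?M x z ** g t) \<le> q t" if "t \<in> {x..}" for t
          proof -
            have "?M x z ** g t = ?M (- (t - x)) z ** (?B t ** f t z)"
              unfolding g_def scaled_exp_add by simp
            also have "norm \<dots> \<le> norm (?M (- (t - x)) z) * norm (?B t ** f t z) * K" by (rule K)
            also have "\<dots> \<le> \<bar>\<kappa>\<bar> * (norm (?B t) * norm (f t z) * K) * K"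
              using \<kappa>[OF _ z, of "t - x"] that K by (intro mult_right_mono mult_mono) auto
            also have "\<dots> \<le> q t" unfolding q_def
              using f(2)[OF _ z, of t] that elim K by (intro mult_right_mono mult_left_mono) auto
            finally show ?thesis .
          qed
        qed
        finally show ?case .
      qed
    qed
  qed (use f in auto)
qed

section \<open>Solutions with prescribed behaviour at infinity\<close>

lemma first_columns_upper [simp]: "upper first_columns = mat 1" and first_columns_lower [simp]: "lower first_columns = 0"
  by (simp_all add: first_columns_def)

definition last_columns :: "complex^'m2^('m1::finite + 'm2::finite)" where
  "last_columns = vstack 0 (mat 1)"

lemma last_columns_upper [simp]: "upper last_columns = 0" and last_columns_lower [simp]: "lower last_columns = mat 1"
  by (simp_all add: last_columns_def)

lemma scaled_exp_first_columns: "scaled_exp 1 x z ** first_columns = first_columns"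
  by (subst vec_eq_iff_sum) (simp add: scaled_exp_mult mat_mult_mat exp_add[symmetric] mm.zero_right del: matrix_mul_rid)

lemma scaled_exp_last_columns: "scaled_exp (-1) x z ** last_columns = last_columns"
  by (subst vec_eq_iff_sum) (simp add: scaled_exp_mult mat_mult_mat exp_add[symmetric] mm.zero_right del: matrix_mul_rid)

lemma scaled_exp_0: "scaled_exp 0 x z = exp_ixzj x z"
  by (simp add: scaled_exp_def)

lemma exp_ixzj_uminus: "exp_ixzj (-x) z = exp_ixzj x (-z)"
  by (simp add: exp_ixzj_def)

text \<open>With \<open>\<sigma> = 1\<close> the scalar factor cancels the exponential of the upper
  block, so the leading term is the constant \<open>first_columns\<close>. It is bounded uniformly
  in \<open>z\<close>, and a single Volterra equation covers the closed half-plane.\<close>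

lemma upper_weyl_family:
  fixes v :: "real \<Rightarrow> complex^'m2::finite^'m1::finite"
  assumes V: "potential v absolutely_integrable_on {0..}"
  obtains f :: "real \<Rightarrow> complex \<Rightarrow> complex^'m1^('m1 + 'm2)" and \<beta> where
    "continuous_on ({0..} \<times> {z. 0 \<le> Im z}) (\<lambda>(x,z). f x z)"
    "\<And>x z. \<lbrakk>0 \<le> x; 0 \<le> Im z\<rbrakk> \<Longrightarrow> norm (f x z) \<le> \<beta>"
    "\<And>z. 0 \<le> Im z \<Longrightarrow> dirac_solution v z (\<lambda>x. mat (exp (\<i> * of_real x * z)) ** f x z)"
    "\<And>z. 0 \<le> Im z \<Longrightarrow> ((\<lambda>x. f x z) \<longlongrightarrow> first_columns) at_top"
proof -
  have "norm (scaled_exp 1 x z ** first_columns :: complex^'m1^('m1 + 'm2)) \<le> norm (first_columns :: complex^'m1^('m1 + 'm2))" for x z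
    by (simp add: scaled_exp_first_columns)
  from dirac_volterra_solution[OF V _ this, of "{z. 0 \<le> Im z}"] obtain f \<beta> where
    "continuous_on ({0..} \<times> {z. 0 \<le> Im z}) (\<lambda>(x,z). f x z)"
    "\<And>x z. \<lbrakk>0 \<le> x; z \<in> {z. 0 \<le> Im z}\<rbrakk> \<Longrightarrow> norm (f x z) \<le> \<beta>"
    "\<And>z. z \<in> {z. 0 \<le> Im z} \<Longrightarrow> dirac_solution v z (\<lambda>x. mat (exp (\<i> * of_real 1 * of_real x * z)) ** f x z)"
    "\<And>z. z \<in> {z. 0 \<le> Im z} \<Longrightarrow> ((\<lambda>x. f x z - scaled_exp 1 x z ** first_columns) \<longlongrightarrow> 0) at_top"
    by auto
  then show ?thesis
    by (intro that[of f \<beta>]) (auto simp: scaled_exp_first_columns Lim_null[symmetric])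
qed

text \<open>Supplies the partner solution for the difference quotient of \<open>R\<close>. There the
  base point is fixed, so one parameter \<open>w\<close> is enough and no continuity in it is
  recorded.\<close>

lemma lower_weyl_family:
  fixes v :: "real \<Rightarrow> complex^'m2::finite^'m1::finite"
  assumes V: "potential v absolutely_integrable_on {0..}" and w: "Im w \<le> 0"
  obtains g :: "real \<Rightarrow> complex^'m2^('m1 + 'm2)" and \<beta> where
    "\<And>x. 0 \<le> x \<Longrightarrow> norm (g x) \<le> \<beta>"
    "dirac_solution v w (\<lambda>x. mat (exp (- \<i> * of_real x * w)) ** g x)"
    "(g \<longlongrightarrow> last_columns) at_top"
proof -
  have "norm (scaled_exp (-1) x z ** last_columns :: complex^'m2^('m1 + 'm2)) \<le> norm (last_columns :: complex^'m2^('m1 + 'm2))" for x z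
    by (simp add: scaled_exp_last_columns)
  note bound = this
  have "\<And>z. z \<in> {w} \<Longrightarrow> (1 - (-1)) * Im z \<le> 0 \<and> 0 \<le> (1 + (-1)) * Im z" using w by auto
  then show ?thesis using bound
  proof (rule dirac_volterra_solution[OF V])
    fix f \<beta>
    assume f: "continuous_on ({0..} \<times> {w}) (\<lambda>(x,z). f x z)"
      "\<And>x z. \<lbrakk>0 \<le> x; z \<in> {w}\<rbrakk> \<Longrightarrow> norm (f x z) \<le> \<beta>"
      "\<And>z. z \<in> {w} \<Longrightarrow> dirac_solution v z (\<lambda>x. mat (exp (\<i> * of_real (-1) * of_real x * z)) ** f x z)"
      "\<And>z. z \<in> {w} \<Longrightarrow> ((\<lambda>x. f x z - scaled_exp (-1) x z ** last_columns) \<longlongrightarrow> 0) at_top"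
    show ?thesis
    proof (rule that[of "\<lambda>x. f x w" \<beta>])
      show "dirac_solution v w (\<lambda>x. mat (exp (- \<i> * of_real x * w)) ** f x w)" using f(3)[of w] by simp
      show "((\<lambda>x. f x w) \<longlongrightarrow> last_columns) at_top"
        using f(4)[of w] by (simp add: scaled_exp_last_columns Lim_null[symmetric])
    qed (use f(2) in blast)
  qed
qed

text \<open>The Volterra equation gives an additive error relative to the free exponential, whereas
  a Jost solution is defined by a multiplicative one. For real \<open>z\<close> the inverse
  exponential is bounded, which converts the former into the latter.\<close>

lemma jost_asymptotics_exist:
  fixes v :: "real \<Rightarrow> complex^'m2::finite^'m1::finite" and z :: real
  assumes V: "potential v absolutely_integrable_on {0..}"
  obtains F A :: "real \<Rightarrow> complex^('m1 + 'm2)^('m1 + 'm2)" where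
    "dirac_solution v (of_real z) F" "\<And>x. F x = exp_ixzj x (of_real z) ** A x" "(A \<longlongrightarrow> mat 1) at_top"
proof -
  obtain \<kappa> where \<kappa>: "\<And>s z. \<lbrakk>0 \<le> s; (1 - 0) * Im z \<le> 0; 0 \<le> (1 + 0) * Im z\<rbrakk>
      \<Longrightarrow> norm (scaled_exp 0 (-s) z :: complex^('m1 + 'm2)^('m1 + 'm2)) \<le> \<kappa>"
    using scaled_exp_bounded[of 0] by blast
  \<comment> \<open>The exponential is unchanged when \<open>x\<close> and \<open>w\<close> both
    change sign, so at a real point the kernel bound also covers the leading term.\<close>
  have b: "norm (scaled_exp 0 x w ** mat 1 :: complex^('m1 + 'm2)^('m1 + 'm2)) \<le> \<kappa>" if "0 \<le> x" "w \<in> {of_real z}" for x w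
    using \<kappa>[of x "- w"] that by (simp add: scaled_exp_0 exp_ixzj_uminus)
  have "\<And>w. w \<in> {of_real z} \<Longrightarrow> (1 - 0) * Im w \<le> 0 \<and> 0 \<le> (1 + 0) * Im w" by auto
  then show thesis using b
  proof (rule dirac_volterra_solution[OF V])
    fix f :: "real \<Rightarrow> complex \<Rightarrow> complex^('m1 + 'm2)^('m1 + 'm2)" and \<beta>
    assume f': "continuous_on ({0..} \<times> {of_real z}) (\<lambda>(x,w). f x w)"
      "\<And>x w. \<lbrakk>0 \<le> x; w \<in> {of_real z}\<rbrakk> \<Longrightarrow> norm (f x w) \<le> \<beta>"
      "\<And>w. w \<in> {of_real z} \<Longrightarrow> dirac_solution v w (\<lambda>x. mat (exp (\<i> * of_real 0 * of_real x * w)) ** f x w)"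
      "\<And>w. w \<in> {of_real z} \<Longrightarrow> ((\<lambda>x. f x w - scaled_exp 0 x w ** mat 1) \<longlongrightarrow> 0) at_top"
    have f: "dirac_solution v (of_real z) (\<lambda>x. f x (of_real z))"
        "((\<lambda>x. f x (of_real z) - exp_ixzj x (of_real z)) \<longlongrightarrow> 0) at_top"
      using f'(3)[of "of_real z"] f'(4)[of "of_real z"] by (simp_all add: scaled_exp_0)
    define A where "A x = exp_ixzj (-x) (of_real z) ** f x (of_real z)" for x
    have fA: "f x (of_real z) = exp_ixzj x (of_real z) ** A x" for x
      by (simp add: A_def exp_ixzj_add)
    have "exp_ixzj (-x) (of_real z) ** exp_ixzj x (of_real z) = (mat 1 :: complex^('m1 + 'm2)^('m1 + 'm2))" for x
      using exp_ixzj_add[of "-x" "of_real z" x "mat 1 :: complex^('m1 + 'm2)^('m1 + 'm2)"] exp_ixzj_zero[of _ "mat 1"] by simp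
    then have A1: "A x - mat 1 = exp_ixzj (-x) (of_real z) ** (f x (of_real z) - exp_ixzj x (of_real z))" for x
      by (simp add: A_def mm.diff_right)
    obtain K where K: "0 \<le> K" "\<And>(A :: complex^('m1 + 'm2)^('m1 + 'm2)) (N :: complex^('m1 + 'm2)^('m1 + 'm2)). norm (A ** N) \<le> norm A * norm N * K"
      using mm.nonneg_bounded by blast
    have "((\<lambda>x. A x - mat 1) \<longlongrightarrow> 0) at_top"
    proof (rule Lim_null_comparison)
      show "((\<lambda>x. \<kappa> * norm (f x (of_real z) - exp_ixzj x (of_real z)) * K) \<longlongrightarrow> 0) at_top"
        using tendsto_mult_left_zero[OF tendsto_mult_right_zero[OF tendsto_norm_zero[OF f(2)]]] by simp
      show "\<forall>\<^sub>F x in at_top. norm (A x - mat 1) \<le> \<kappa> * norm (f x (of_real z) - exp_ixzj x (of_real z)) * K"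
        using eventually_ge_at_top[of 0]
      proof eventually_elim
        case (elim x)
        then have "norm (exp_ixzj (-x) (of_real z) :: complex^('m1 + 'm2)^('m1 + 'm2)) \<le> \<kappa>"
          using \<kappa>[of x "of_real z"] by (simp add: scaled_exp_0)
        then show ?case
          unfolding A1 by (intro order_trans[OF K(2)] mult_right_mono K) auto
      qed
    qed
    then have "(A \<longlongrightarrow> mat 1) at_top" by (simp add: Lim_null[symmetric])
    with f(1) fA show thesis by (rule that)
  qed
qed

section \<open>Wronskians at infinity and the Jost solution\<close>

lemma exp_ixzj_unitary:
  "adj (exp_ixzj x (of_real z) ** A) ** (dirac_j ** (exp_ixzj x (of_real z) ** B)) = adj A ** (dirac_j ** B)"
proof -
  have "adj (exp_ixzj x (of_real z) ** A) ** (dirac_j ** (exp_ixzj x (of_real z) ** B)) =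
    adj A ** (exp_ixzj (-x) (of_real z) ** (exp_ixzj x (of_real z) ** (dirac_j ** B)))"
    by (simp add: adj_mult adj_exp_ixzj exp_ixzj_uminus exp_ixzj_dirac_j matrix_mul_assoc[symmetric])
  then show ?thesis by (simp add: exp_ixzj_add)
qed

text \<open>A real parameter is its own conjugate, so the Wronskian is constant. The free
  exponential is unitary and commutes with j, hence drops out, and the constant can be evaluated
  from the limiting amplitudes.\<close>

lemma wronskian_asymptotic:
  fixes v :: "real \<Rightarrow> complex^'m2::finite^'m1::finite" and z :: real
    and F :: "real \<Rightarrow> complex^'p^('m1 + 'm2)" and G :: "real \<Rightarrow> complex^'q^('m1 + 'm2)"
  assumes F: "dirac_solution v (of_real z) F" "\<And>x. 0 \<le> x \<Longrightarrow> F x = exp_ixzj x (of_real z) ** A x" "(A \<longlongrightarrow> A0) at_top"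
    and G: "dirac_solution v (of_real z) G" "\<And>x. 0 \<le> x \<Longrightarrow> G x = exp_ixzj x (of_real z) ** B x" "(B \<longlongrightarrow> B0) at_top"
    and x: "0 \<le> x"
  shows "adj (F x) ** (dirac_j ** G x) = adj A0 ** (dirac_j ** B0)"
proof -
  have "((\<lambda>x. adj (A x) ** (dirac_j ** B x)) \<longlongrightarrow> adj A0 ** (dirac_j ** B0)) at_top"
    by (intro mm.tendsto tendsto_const bounded_linear.tendsto[OF bounded_linear_adj] F G)
  moreover have "eventually (\<lambda>y. adj (A y) ** (dirac_j ** B y) = adj (F x) ** (dirac_j ** G x)) at_top"
    using eventually_ge_at_top[of x]
  proof eventually_elim
    case (elim y)
    then have "adj (F y) ** (dirac_j ** G y) = adj (F x) ** (dirac_j ** G x)"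
      using F(1) G(1) x by (intro wronskian_constant) auto
    then show ?case using F(2)[of y] G(2)[of y] elim x by (simp add: exp_ixzj_unitary)
  qed
  then have "((\<lambda>x. adj (A x) ** (dirac_j ** B x)) \<longlongrightarrow> adj (F x) ** (dirac_j ** G x)) at_top"
    by (rule tendsto_eventually)
  ultimately show ?thesis
    using tendsto_unique trivial_limit_at_top_linorder by blast
qed

lemma jost_asymptotics:
  assumes "is_jost_solution v z F"
  shows "\<exists>A. dirac_solution v (of_real z) F \<and> (\<forall>x\<ge>0. F x = exp_ixzj x (of_real z) ** A x) \<and>
    (A \<longlongrightarrow> mat 1) at_top \<and> (\<forall>x\<ge>0. invertible (F x))"
proof -
  obtain E where E: "(E \<longlongrightarrow> 0) at_top" "\<And>x. 0 \<le> x \<Longrightarrow> F x = exp_ixzj x (of_real z) ** (mat 1 + E x)"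
    using assms by (auto simp: is_jost_solution_def)
  have "((\<lambda>x. mat 1 + E x) \<longlongrightarrow> mat 1 + 0) at_top" by (intro tendsto_intros E)
  then show ?thesis using E assms
    by (intro exI[of _ "\<lambda>x. mat 1 + E x"]) (simp add: is_jost_solution_def fundamental_solution_def)
qed

text \<open>The Wronskian of \<open>F\<close> with itself equals its value \<open>dirac_j\<close> at
  infinity; this gives a left inverse of \<open>F x\<close> for every nonnegative
  \<open>x\<close>.\<close>

lemma jost_solution_exists:
  fixes v :: "real \<Rightarrow> complex^'m2::finite^'m1::finite"
  assumes V: "potential v absolutely_integrable_on {0..}"
  shows "\<exists>F. is_jost_solution v z F"
proof -
  obtain F A :: "real \<Rightarrow> complex^('m1 + 'm2)^('m1 + 'm2)" where
    F: "dirac_solution v (of_real z) F" "\<And>x. F x = exp_ixzj x (of_real z) ** A x" "(A \<longlongrightarrow> mat 1) at_top"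
    using jost_asymptotics_exist[OF V] by blast
  have "invertible (F x)" if "0 \<le> x" for x
  proof -
    have "adj (F x) ** (dirac_j ** F x) = adj (mat 1) ** (dirac_j ** mat 1)"
      by (rule wronskian_asymptotic[OF F F that])
    then have "dirac_j ** (adj (F x) ** (dirac_j ** F x)) = mat 1" by simp
    then have "(dirac_j ** (adj (F x) ** dirac_j)) ** F x = mat 1" by (simp add: matrix_mul_assoc)
    then show ?thesis using invertible_left_inverse by blast
  qed
  moreover have "((\<lambda>x. A x - mat 1) \<longlongrightarrow> 0) at_top" using F(3) by (simp add: Lim_null[symmetric])
  ultimately have "is_jost_solution v z F"
    unfolding is_jost_solution_def fundamental_solution_def
    using F by (auto intro!: exI[of _ "\<lambda>x. A x - mat 1"])
  then show ?thesis by blast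
qed

text \<open>A solution is determined by its limiting amplitude, because \<open>G\<close> and
  \<open>F ** B0\<close> have the same Wronskian with the invertible \<open>F\<close>. Serves both
  for uniqueness of the Jost solution and for recognizing its first block column.\<close>

lemma jost_solution_mult_unique:
  fixes v :: "real \<Rightarrow> complex^'m2::finite^'m1::finite" and G :: "real \<Rightarrow> complex^'q^('m1 + 'm2)"
  assumes F: "is_jost_solution v z F"
    and G: "dirac_solution v (of_real z) G" "\<And>x. 0 \<le> x \<Longrightarrow> G x = exp_ixzj x (of_real z) ** B x" "(B \<longlongrightarrow> B0) at_top"
    and x: "0 \<le> x"
  shows "G x = F x ** B0"
proof -
  obtain A where A: "dirac_solution v (of_real z) F" "\<And>x. 0 \<le> x \<Longrightarrow> F x = exp_ixzj x (of_real z) ** A x"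
    "(A \<longlongrightarrow> mat 1) at_top" "\<And>x. 0 \<le> x \<Longrightarrow> invertible (F x)"
    using jost_asymptotics[OF F] by metis
  have "adj (F x) ** (dirac_j ** G x) = dirac_j ** B0"
    using wronskian_asymptotic[OF A(1-3) G x] by simp
  moreover have "adj (F x) ** (dirac_j ** F x) = dirac_j"
    using wronskian_asymptotic[OF A(1-3) A(1-3) x] by simp
  then have "adj (F x) ** (dirac_j ** (F x ** B0)) = dirac_j ** B0"
    by (simp add: matrix_mul_assoc)
  ultimately have "adj (F x) ** (dirac_j ** (G x - F x ** B0)) = 0"
    by (simp add: mm.diff_right)
  moreover have "invertible (adj (F x))" using A(4)[OF x] by (rule invertible_adj)
  ultimately have "G x - F x ** B0 = 0" using invertible_mult_zero dirac_j_mult_eq_0 by metis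
  then show ?thesis by simp
qed

lemma jost_solution_unique:
  assumes "is_jost_solution v z F" "is_jost_solution v z G" "0 \<le> x"
  shows "F x = G x"
proof -
  obtain A where A: "dirac_solution v (of_real z) F" "\<And>x. 0 \<le> x \<Longrightarrow> F x = exp_ixzj x (of_real z) ** A x"
    "(A \<longlongrightarrow> mat 1) at_top" "\<And>x. 0 \<le> x \<Longrightarrow> invertible (F x)"
    using jost_asymptotics[OF assms(1)] by metis
  from jost_solution_mult_unique[OF assms(2) A(1-3) assms(3)] show ?thesis by (simp only: matrix_mul_rid)
qed

section \<open>Energy\<close>

text \<open>Turns the matrix Wronskian identity into a scalar one: on \<open>adj A ** A\<close> it
  is the square of the norm.\<close>

definition re_trace :: "complex^'n^'n \<Rightarrow> real" where
  "re_trace A = (\<Sum>k\<in>UNIV. Re (A $ k $ k))"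

lemma bounded_linear_re_trace: "bounded_linear re_trace"
  unfolding linear_conv_bounded_linear[symmetric]
  by (rule linearI) (simp_all add: re_trace_def sum.distrib sum_distrib_left)

lemma re_trace_diff: "re_trace (A - B) = re_trace A - re_trace B"
  by (simp add: re_trace_def sum_subtractf)

lemma re_trace_real_mult: "re_trace (mat (of_real r) ** A) = r * re_trace A"
  by (simp add: re_trace_def mat_mult_nth sum_distrib_left)

lemma norm_matrix_sq: "(norm A)\<^sup>2 = (\<Sum>i\<in>UNIV. \<Sum>k\<in>UNIV. (cmod (A $ i $ k))\<^sup>2)" for A :: "complex^'q^'p"
  by (simp add: norm_vec_def L2_set_def sum_nonneg)

lemma norm_adj [simp]: "norm (adj A) = norm A"
proof -
  have "(norm (adj A))\<^sup>2 = (norm A)\<^sup>2"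
    unfolding norm_matrix_sq by (subst sum.swap) simp
  then show ?thesis by simp
qed

lemma norm_mat_mult [simp]: "norm (mat c ** A) = cmod c * norm A" for A :: "complex^'q^'p"
proof -
  have "(norm (mat c ** A))\<^sup>2 = (cmod c * norm A)\<^sup>2"
    unfolding power_mult_distrib norm_matrix_sq
    by (simp add: mat_mult_nth norm_mult power_mult_distrib sum_distrib_left)
  then show ?thesis by (simp add: power2_eq_iff_nonneg)
qed

lemma re_trace_adj_mult: "re_trace (adj A ** A) = (norm A)\<^sup>2" for A :: "complex^'q^'p"
proof -
  have "Re ((adj A ** A) $ k $ k) = (\<Sum>i\<in>UNIV. (cmod (A $ i $ k))\<^sup>2)" for k
    by (simp add: matrix_matrix_mult_def cmod_power2) (simp add: power2_eq_square)
  then show ?thesis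
    unfolding re_trace_def norm_matrix_sq by (subst sum.swap) simp
qed

lemma adj_mult_split: "adj Y ** Z = adj (upper Y) ** upper Z + adj (lower Y) ** lower Z"
  for Y :: "complex^'p^('m1::finite + 'm2::finite)"
  by (simp add: vec_eq_iff matrix_matrix_mult_def sum_UNIV_sum)

lemma norm_sq_split: "(norm Y)\<^sup>2 = (norm (upper Y))\<^sup>2 + (norm (lower Y))\<^sup>2"
  for Y :: "complex^'p^('m1::finite + 'm2::finite)"
  by (simp add: norm_matrix_sq sum_UNIV_sum)

text \<open>The trace of the indefinite form Y* j Y.\<close>

definition energy :: "complex^'p^('m1::finite + 'm2::finite) \<Rightarrow> real" where
  "energy Y = (norm (upper Y))\<^sup>2 - (norm (lower Y))\<^sup>2"

lemma re_trace_dirac_j: "re_trace (adj Y ** (dirac_j ** Y)) = energy Y"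
proof -
  have "re_trace (adj Y ** (dirac_j ** Y)) = re_trace (adj (upper Y) ** upper Y) - re_trace (adj (lower Y) ** lower Y)"
    unfolding adj_mult_split
    by (simp add: mm.minus_right re_trace_diff)
  then show ?thesis by (simp add: re_trace_adj_mult energy_def)
qed

lemma energy_mat_mult: "energy (mat c ** Y) = (cmod c)\<^sup>2 * energy Y"
  by (simp add: energy_def power_mult_distrib right_diff_distrib)

lemma bounded_linear_upper: "bounded_linear (upper :: complex^'q^('m1::finite + 'm2::finite) \<Rightarrow> _)"
  and bounded_linear_lower: "bounded_linear (lower :: complex^'q^('m1::finite + 'm2::finite) \<Rightarrow> _)"
  unfolding linear_conv_bounded_linear[symmetric] by (auto intro!: linearI simp: vec_eq_iff)

lemma tendsto_energy:
  assumes "(h \<longlongrightarrow> H) F"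
  shows "((\<lambda>x. energy (h x)) \<longlongrightarrow> energy H) F"
  unfolding energy_def
  by (intro tendsto_intros bounded_linear.tendsto[OF bounded_linear_upper]
      bounded_linear.tendsto[OF bounded_linear_lower] assms)

lemma energy_has_integral:
  fixes Y :: "real \<Rightarrow> complex^'q^('m1::finite + 'm2::finite)"
  assumes Y: "dirac_solution v z Y" and ab: "0 \<le> a" "a \<le> b"
  shows "((\<lambda>x. (- 2 * Im z) * (norm (Y x))\<^sup>2) has_integral (energy (Y b) - energy (Y a))) {a..b}"
proof -
  have "\<i> * (z - cnj z) = of_real (- 2 * Im z)"
    by (simp add: complex_eq_iff)
  then show ?thesis
    using has_integral_linear[OF wronskian[OF Y Y ab] bounded_linear_re_trace]
    by (simp only: o_def re_trace_real_mult re_trace_adj_mult re_trace_diff re_trace_dirac_j)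
qed

text \<open>The real factor \<open>\<sigma>\<close> treats both half-planes together:
  \<open>1\<close> for decrease in the upper one, \<open>-1\<close> for increase in the lower
  one.\<close>

lemma energy_mono:
  assumes Y: "dirac_solution v z Y" and ab: "0 \<le> a" "a \<le> b" and \<sigma>: "0 \<le> \<sigma> * Im z"
  shows "\<sigma> * energy (Y b) \<le> \<sigma> * energy (Y a)"
proof -
  have "((\<lambda>x. (2 * (\<sigma> * Im z)) * (norm (Y x))\<^sup>2) has_integral (- \<sigma>) * (energy (Y b) - energy (Y a))) {a..b}"
    using has_integral_mult_right[OF energy_has_integral[OF Y ab], of "- \<sigma>"] by (simp add: mult_ac)
  then have "0 \<le> (- \<sigma>) * (energy (Y b) - energy (Y a))"
    by (rule has_integral_nonneg) (use \<sigma> in auto)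
  then show ?thesis by (simp add: algebra_simps)
qed

text \<open>The scalar \<open>c x\<close> may tend to 0, so the energy of the solution itself can
  lose all information in the limit. Its sign does not depend on \<open>c x\<close>, however, and so
  passes to the limit of the remaining factor.\<close>

lemma energy_limit:
  assumes Y: "dirac_solution v z (\<lambda>x. mat (c x) ** h x)" and c: "\<And>x. c x \<noteq> 0"
    and h: "(h \<longlongrightarrow> H) at_top" and \<sigma>: "0 \<le> \<sigma> * Im z" and init: "\<sigma> * energy (h 0) \<le> 0"
  shows "\<sigma> * energy H \<le> 0"
proof (rule tendsto_upperbound)
  show "((\<lambda>x. \<sigma> * energy (h x)) \<longlongrightarrow> \<sigma> * energy H) at_top"
    by (intro tendsto_intros tendsto_energy h)
  show "\<forall>\<^sub>F x in at_top. \<sigma> * energy (h x) \<le> 0"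
    using eventually_ge_at_top[of 0]
  proof eventually_elim
    case (elim x)
    have "(cmod (c x))\<^sup>2 * (\<sigma> * energy (h x)) \<le> (cmod (c 0))\<^sup>2 * (\<sigma> * energy (h 0))"
      using energy_mono[OF Y order_refl elim \<sigma>] by (simp add: energy_mat_mult mult_ac)
    also have "\<dots> \<le> 0" using init by (simp add: mult_nonneg_nonpos)
    finally show ?case using c[of x] by (simp add: mult_le_0_iff)
  qed
qed simp

section \<open>Invertibility and continuity of the matrix inverse\<close>

lemma invertible_if_injective:
  fixes A :: "complex^'n^'n"
  assumes "\<And>N :: complex^'n^'n. A ** N = 0 \<Longrightarrow> N = 0"
  shows "invertible A"
proof -
  have "x = 0" if "A *v x = 0" for x
  proof -
    \<comment> \<open>Every column of \<open>N\<close> is \<open>x\<close>; injectivity is tested on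
      square matrices because the energy argument multiplies by them.\<close>
    define N where "N = (\<chi> i k. x $ i :: complex^'n^'n)"
    have "A ** N = 0"
      using that by (simp add: N_def vec_eq_iff matrix_matrix_mult_def matrix_vector_mult_def)
    then have "N = 0" by (rule assms)
    then show "x = 0" by (simp add: N_def vec_eq_iff)
  qed
  then have "\<exists>B. B ** A = mat 1" using matrix_left_invertible_ker[of A] by blast
  then show ?thesis by (simp add: invertible_left_inverse)
qed

lemma matrix_inv_right: "A ** matrix_inv A = mat 1" and matrix_inv_left: "matrix_inv A ** A = mat 1"
  if "invertible A" for A :: "complex^'n^'n"
  using someI_ex[OF that[unfolded invertible_def]] by (simp_all add: matrix_inv_def)

text \<open>With \<open>B\<close> the inverse of \<open>A0\<close>, the inverse of
  \<open>A x\<close> minus \<open>B\<close> equals the inverse of \<open>A x\<close> times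
  \<open>(A0 - A x) ** B\<close>. Once the error factor is below 1/2, this first bounds the inverse
  of \<open>A x\<close> by \<open>2 * norm B\<close>; inserting that bound into the same identity
  gives convergence.\<close>

lemma tendsto_matrix_inv:
  fixes A :: "'a \<Rightarrow> complex^'n^'n"
  assumes A: "(A \<longlongrightarrow> A0) F" and inv: "\<forall>\<^sub>F x in F. invertible (A x)" and inv0: "invertible A0"
  shows "((\<lambda>x. matrix_inv (A x)) \<longlongrightarrow> matrix_inv A0) F"
proof -
  define B where "B = matrix_inv A0"
  have B: "A0 ** B = mat 1" "B ** A0 = mat 1"
    unfolding B_def using inv0 by (simp_all add: matrix_inv_right matrix_inv_left)
  obtain K where K: "0 \<le> K" "\<And>(A :: complex^'n^'n) (N :: complex^'n^'n). norm (A ** N) \<le> norm A * norm N * K"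
    using mm.nonneg_bounded by blast
  have lim: "((\<lambda>x. norm (A0 - A x)) \<longlongrightarrow> 0) F"
    using tendsto_norm[OF tendsto_diff[OF tendsto_const A], of A0] by simp
  have diff: "norm (matrix_inv (A x) - B) \<le> norm (matrix_inv (A x)) * norm (A0 - A x) * (K * norm B * K)"
    if "invertible (A x)" for x
  proof -
    have "matrix_inv (A x) ** ((A0 - A x) ** B) = matrix_inv (A x) ** (A0 ** B) - (matrix_inv (A x) ** A x) ** B"
      by (simp only: mm.diff_left mm.diff_right matrix_mul_assoc)
    also have "\<dots> = matrix_inv (A x) - B" using B that by (simp add: matrix_inv_left)
    finally have "norm (matrix_inv (A x) - B) = norm (matrix_inv (A x) ** ((A0 - A x) ** B))" by simp
    also have "\<dots> \<le> norm (matrix_inv (A x)) * norm ((A0 - A x) ** B) * K" by (rule K)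
    also have "\<dots> \<le> norm (matrix_inv (A x)) * (norm (A0 - A x) * norm B * K) * K"
      by (intro mult_right_mono mult_left_mono K) auto
    finally show ?thesis by (simp add: mult_ac)
  qed
  have "((\<lambda>x. norm (A0 - A x) * (K * norm B * K)) \<longlongrightarrow> 0 * (K * norm B * K)) F"
    by (intro tendsto_intros lim)
  then have small: "\<forall>\<^sub>F x in F. norm (A0 - A x) * (K * norm B * K) < 1 / 2"
    by (intro order_tendstoD(2)) auto
  have "((\<lambda>x. matrix_inv (A x) - B) \<longlongrightarrow> 0) F"
  proof (rule Lim_null_comparison)
    show "((\<lambda>x. 2 * norm B * (norm (A0 - A x) * (K * norm B * K))) \<longlongrightarrow> 0) F"
      using tendsto_mult_right_zero[OF tendsto_mult_left_zero[OF lim]] .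
    show "\<forall>\<^sub>F x in F. norm (matrix_inv (A x) - B) \<le> 2 * norm B * (norm (A0 - A x) * (K * norm B * K))"
      using small inv
    proof eventually_elim
      case (elim x)
      let ?e = "norm (A0 - A x) * (K * norm B * K)"
      have d: "norm (matrix_inv (A x) - B) \<le> norm (matrix_inv (A x)) * ?e"
        using diff[OF elim(2)] by (simp add: mult.assoc)
      have "norm (matrix_inv (A x)) \<le> norm (matrix_inv (A x) - B) + norm B"
        by (metis diff_add_cancel norm_triangle_ineq)
      also have "norm (matrix_inv (A x)) * ?e \<le> norm (matrix_inv (A x)) * (1 / 2)"
        using elim(1) by (intro mult_left_mono) auto
      then have "norm (matrix_inv (A x) - B) \<le> norm (matrix_inv (A x)) * (1 / 2)" using d by linarith
      finally have "norm (matrix_inv (A x)) \<le> 2 * norm B" by simp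
      then have "norm (matrix_inv (A x)) * ?e \<le> 2 * norm B * ?e"
        using K by (intro mult_right_mono) auto
      with d show ?case by linarith
    qed
  qed
  then show ?thesis by (simp add: Lim_null[symmetric] B_def)
qed

section \<open>The reflection coefficient and the Weyl function\<close>

text \<open>Exactly the properties provided by \<open>upper_weyl_family\<close>; the integral
  equation defining \<open>f\<close> is not referred to again.\<close>

locale weyl_family =
  fixes v :: "real \<Rightarrow> complex^'m2::finite^'m1::finite"
    and f :: "real \<Rightarrow> complex \<Rightarrow> complex^'m1^('m1 + 'm2)" and \<beta> :: real
  assumes V: "potential v absolutely_integrable_on {0..}"
    and f_continuous: "continuous_on ({0..} \<times> {z. 0 \<le> Im z}) (\<lambda>(x,z). f x z)"
    and f_bounded: "\<And>x z. \<lbrakk>0 \<le> x; 0 \<le> Im z\<rbrakk> \<Longrightarrow> norm (f x z) \<le> \<beta>"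
    and f_solution: "\<And>z. 0 \<le> Im z \<Longrightarrow> dirac_solution v z (\<lambda>x. mat (exp (\<i> * of_real x * z)) ** f x z)"
    and f_limit: "\<And>z. 0 \<le> Im z \<Longrightarrow> ((\<lambda>x. f x z) \<longlongrightarrow> first_columns) at_top"
begin

text \<open>If \<open>N\<close> is annihilated by the upper block, the solution times
  \<open>N\<close> starts with nonpositive energy. The limiting energy is the squared norm of
  \<open>N\<close>, which must therefore be 0.\<close>

lemma invertible_upper:
  assumes z: "0 \<le> Im z"
  shows "invertible (upper (f 0 z))"
proof (rule invertible_if_injective)
  fix N :: "complex^'m1^'m1" assume N: "upper (f 0 z) ** N = 0"
  have "1 * energy (first_columns ** N :: complex^'m1^('m1 + 'm2)) \<le> 0"
  proof (rule energy_limit[where h = "\<lambda>x. f x z ** N" and c = "\<lambda>x. exp (\<i> * of_real x * z)"])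
    show "dirac_solution v z (\<lambda>x. mat (exp (\<i> * of_real x * z)) ** (f x z ** N))"
      using dirac_solution_mult_right[OF f_solution[OF z], of N] by (simp add: matrix_mul_assoc)
    show "((\<lambda>x. f x z ** N) \<longlongrightarrow> first_columns ** N) at_top"
      by (intro mm.tendsto f_limit z tendsto_const)
    show "1 * energy (f 0 z ** N) \<le> 0"
      by (simp add: energy_def upper_mult N)
  qed (use z in auto)
  then show "N = 0" by (simp add: energy_def upper_mult lower_mult mm.zero_left)
qed

definition R :: "complex \<Rightarrow> complex^'m1^'m2" where
  "R z = lower (f 0 z) ** matrix_inv (upper (f 0 z))"

lemma f_mult_inv: "0 \<le> Im z \<Longrightarrow> f 0 z ** matrix_inv (upper (f 0 z)) = vstack (mat 1) (R z)"
  by (subst vec_eq_iff_sum) (simp add: upper_mult lower_mult R_def matrix_inv_right[OF invertible_upper])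

lemma f_continuous_z:
  assumes "0 \<le> x"
  shows "continuous_on {z. 0 \<le> Im z} (f x)"
proof -
  have "continuous_on {z. 0 \<le> Im z} (\<lambda>z. case (x, z) of (x, z) \<Rightarrow> f x z)"
    by (rule continuous_on_compose2[OF f_continuous]) (use assms in \<open>auto intro!: continuous_intros\<close>)
  then show ?thesis by simp
qed

lemma continuous_on_inv: "continuous_on {z. 0 \<le> Im z} (\<lambda>z. matrix_inv (upper (f 0 z)))"
  unfolding continuous_on_def
proof (intro ballI)
  fix z assume z: "z \<in> {z. 0 \<le> Im z}"
  show "((\<lambda>z. matrix_inv (upper (f 0 z))) \<longlongrightarrow> matrix_inv (upper (f 0 z))) (at z within {z. 0 \<le> Im z})"
  proof (rule tendsto_matrix_inv)
    show "((\<lambda>z. upper (f 0 z)) \<longlongrightarrow> upper (f 0 z)) (at z within {z. 0 \<le> Im z})"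
      using f_continuous_z[of 0] z
      by (intro bounded_linear.tendsto[OF bounded_linear_upper]) (auto simp: continuous_on_def)
    show "\<forall>\<^sub>F x in at z within {z. 0 \<le> Im z}. invertible (upper (f 0 x))"
      unfolding eventually_at_filter by (intro always_eventually) (auto intro: invertible_upper)
    show "invertible (upper (f 0 z))" using z by (simp add: invertible_upper)
  qed
qed

lemma R_continuous_on: "continuous_on {z. 0 \<le> Im z} R"
  unfolding R_def[abs_def]
  by (intro mm.continuous_on continuous_on_inv bounded_linear.continuous_on[OF bounded_linear_lower] f_continuous_z) simp

text \<open>On the real line the solution exp(ixz) f has the amplitude \<open>B\<close>, and the
  boundedness of the scaled exponential carries the limit \<open>first_columns\<close> over from
  \<open>f\<close> to \<open>B\<close>. Solutions with equal limiting amplitudes coincide.\<close>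

lemma jost_first_columns:
  assumes F: "is_jost_solution v t F"
  shows "F 0 ** first_columns = f 0 (of_real t)"
proof -
  let ?z = "of_real t :: complex"
  define B where "B x = exp_ixzj (-x) ?z ** (mat (exp (\<i> * of_real x * ?z)) ** f x ?z)" for x
  obtain \<kappa> where \<kappa>: "\<And>s z. \<lbrakk>0 \<le> s; (1 - 1) * Im z \<le> 0; 0 \<le> (1 + 1) * Im z\<rbrakk>
      \<Longrightarrow> norm (scaled_exp 1 (-s) z :: complex^('m1 + 'm2)^('m1 + 'm2)) \<le> \<kappa>"
    using scaled_exp_bounded[of 1] by blast
  have B: "B x = scaled_exp 1 (-x) ?z ** f x ?z" for x
    by (simp add: B_def scaled_exp_mult mult_mat_left_comm[of "exp_ixzj (-x) ?z"])
  have BC: "B x - first_columns = scaled_exp 1 (-x) ?z ** (f x ?z - first_columns)" for x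
    unfolding B by (simp add: mm.diff_right scaled_exp_first_columns)
  obtain K where K: "0 \<le> K" "\<And>(A :: complex^('m1 + 'm2)^('m1 + 'm2)) (N :: complex^'m1^('m1 + 'm2)). norm (A ** N) \<le> norm A * norm N * K"
    using mm.nonneg_bounded by blast
  have "((\<lambda>x. B x - first_columns) \<longlongrightarrow> 0) at_top"
  proof (rule Lim_null_comparison)
    have "((\<lambda>x. f x ?z - first_columns) \<longlongrightarrow> 0) at_top"
      using f_limit[of ?z] by (simp add: Lim_null[symmetric])
    from tendsto_mult_left_zero[OF tendsto_mult_right_zero[OF tendsto_norm_zero[OF this]]]
    show "((\<lambda>x. \<kappa> * norm (f x ?z - first_columns) * K) \<longlongrightarrow> 0) at_top" .
    show "\<forall>\<^sub>F x in at_top. norm (B x - first_columns) \<le> \<kappa> * norm (f x ?z - first_columns) * K"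
      using eventually_ge_at_top[of 0]
    proof eventually_elim
      case (elim x)
      then show ?case
        unfolding BC using \<kappa>[of x ?z] by (intro order_trans[OF K(2)] mult_right_mono K) auto
    qed
  qed
  then have "(B \<longlongrightarrow> first_columns) at_top" by (simp add: Lim_null[symmetric])
  moreover have "mat (exp (\<i> * of_real x * ?z)) ** f x ?z = exp_ixzj x ?z ** B x" for x
    by (simp add: B_def exp_ixzj_add)
  ultimately have "mat (exp (\<i> * of_real 0 * ?z)) ** f 0 ?z = F 0 ** first_columns"
    using f_solution[of ?z] by (intro jost_solution_mult_unique[OF F, where B = B]) auto
  then show ?thesis by simp
qed

lemma jost_Y_0: "jost_Y v 0 t = f 0 (of_real t)"
  unfolding jost_Y_def jost_solution_def
  by (rule jost_first_columns) (rule someI_ex[OF jost_solution_exists[OF V]])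

lemma reflection_coefficient_eq: "reflection_coefficient v t = R (of_real t)"
  by (simp add: reflection_coefficient_def jost_Y_0 R_def)

lemma reflection_coefficient_exists: "reflection_coefficient_exists v t"
  unfolding reflection_coefficient_exists_def jost_Y_0
  using jost_solution_exists[OF V] jost_solution_unique[where v = v] invertible_upper[of "of_real t"] by auto

section \<open>The square integrable Weyl solution\<close>

definition W :: "real \<Rightarrow> complex \<Rightarrow> complex^'m1^('m1 + 'm2)" where
  "W x z = mat (exp (\<i> * of_real x * z)) ** f x z ** matrix_inv (upper (f 0 z))"

lemma W_solution: "0 \<le> Im z \<Longrightarrow> dirac_solution v z (\<lambda>x. W x z)"
  unfolding W_def by (intro dirac_solution_mult_right f_solution)

lemma W_0: "0 \<le> Im z \<Longrightarrow> W 0 z = vstack (mat 1) (R z)"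
  by (simp add: W_def f_mult_inv)

lemma norm_exp_i: "cmod (exp (\<i> * of_real x * z)) = exp (- x * Im z)"
  by (simp add: norm_exp_eq_Re)

lemma W_bound:
  assumes z: "0 \<le> Im z"
  obtains c where "0 \<le> c" "\<And>x. 0 \<le> x \<Longrightarrow> norm (W x z) \<le> c * exp (- x * Im z)"
proof -
  obtain K where K: "0 \<le> K" "\<And>(A :: complex^'m1^('m1 + 'm2)) (N :: complex^'m1^'m1). norm (A ** N) \<le> norm A * norm N * K"
    using mm.nonneg_bounded by blast
  let ?N = "matrix_inv (upper (f 0 z))"
  show thesis
  proof (rule that[of "\<bar>\<beta>\<bar> * norm ?N * K"])
    show "0 \<le> \<bar>\<beta>\<bar> * norm ?N * K" using K by simp
    fix x :: real assume x: "0 \<le> x"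
    have "norm (W x z) \<le> norm (mat (exp (\<i> * of_real x * z)) ** f x z) * norm ?N * K"
      unfolding W_def by (rule K)
    also have "\<dots> \<le> (exp (- x * Im z) * \<bar>\<beta>\<bar>) * norm ?N * K"
      using f_bounded[OF x z] K by (intro mult_right_mono) (auto simp: norm_exp_i intro!: mult_left_mono)
    finally show "norm (W x z) \<le> \<bar>\<beta>\<bar> * norm ?N * K * exp (- x * Im z)" by (simp add: mult_ac)
  qed
qed

lemma W_square_integrable:
  assumes z: "0 < Im z"
  shows "(\<lambda>x. adj (W x z) ** W x z) absolutely_integrable_on {0..}"
proof -
  obtain K where K: "0 \<le> K" "\<And>(A :: complex^('m1 + 'm2)^'m1) (N :: complex^'m1^('m1 + 'm2)). norm (A ** N) \<le> norm A * norm N * K"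
    using mm.nonneg_bounded by blast
  obtain c where c: "0 \<le> c" "\<And>x. 0 \<le> x \<Longrightarrow> norm (W x z) \<le> c * exp (- x * Im z)"
    using W_bound[of z] z by auto
  have cont: "continuous_on {0..} (\<lambda>x. W x z)"
    by (rule dirac_solution_continuous_on[OF W_solution]) (use z in simp)
  show ?thesis
  proof (rule measurable_bounded_by_integrable_imp_absolutely_integrable)
    show "(\<lambda>x. adj (W x z) ** W x z) \<in> borel_measurable (lebesgue_on {0..})"
      by (intro continuous_imp_measurable_on_sets_lebesgue mm.continuous_on
          bounded_linear.continuous_on[OF bounded_linear_adj] cont) simp
    show "(\<lambda>x. c * c * K * exp (- (2 * Im z) * x)) integrable_on {0..}"
      by (intro integrable_on_mult_right integrable_on_exp_minus_to_infinity) (use z in simp)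
    fix x :: real assume "x \<in> {0..}"
    then have x: "0 \<le> x" by simp
    have "norm (adj (W x z) ** W x z) \<le> norm (W x z) * norm (W x z) * K"
      using K(2)[of "adj (W x z)" "W x z"] by simp
    also have "\<dots> \<le> (c * exp (- x * Im z)) * (c * exp (- x * Im z)) * K"
      using c K x by (intro mult_right_mono mult_mono) auto
    also have "\<dots> = c * c * K * exp (- (2 * Im z) * x)"
      by (simp add: mult_ac exp_add[symmetric])
    finally show "norm (adj (W x z) ** W x z) \<le> c * c * K * exp (- (2 * Im z) * x)" .
  qed simp
qed

text \<open>
  Pairing the solution at $z$ with a decaying solution at $\overline{z_0}$ leaves only a boundary
  term at $0$, which is a constant invertible matrix times $R(z) - R(z_0)$.
\<close>

theorem R_increment:
  assumes z0: "0 < Im z0"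
  obtains Q where "continuous_on {z. 0 \<le> Im z} Q"
    "\<And>z. 0 \<le> Im z \<Longrightarrow> R z - R z0 = mat (\<i> * (z - z0)) ** Q z"
proof -
  \<comment> \<open>With this choice the factor \<open>z - cnj w\<close> of the Wronskian identity
    becomes \<open>z - z0\<close>.\<close>
  define w where "w = cnj z0"
  have w: "Im w < 0" using z0 by (simp add: w_def)
  obtain g :: "real \<Rightarrow> complex^'m2^('m1 + 'm2)" and \<gamma> where g:
    "\<And>x. 0 \<le> x \<Longrightarrow> norm (g x) \<le> \<gamma>"
    "dirac_solution v w (\<lambda>x. mat (exp (- \<i> * of_real x * w)) ** g x)"
    "(g \<longlongrightarrow> last_columns) at_top"
    using lower_weyl_family[OF V less_imp_le[OF w]] by blast
  define X where "X x = mat (exp (- \<i> * of_real x * w)) ** g x" for x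
  have X: "dirac_solution v w X" using g(2) by (simp add: X_def[abs_def])
  have X0: "X 0 = g 0" by (simp add: X_def)
  have nX: "norm (X x) \<le> \<bar>\<gamma>\<bar> * exp (- Im z0 * x)" if "0 \<le> x" for x
  proof -
    have "norm (X x) = exp (- Im z0 * x) * norm (g x)"
      by (simp add: X_def norm_exp_eq_Re w_def mult.commute)
    then show ?thesis using g(1)[OF that] by (simp add: mult.commute mult_left_mono)
  qed
  \<comment> \<open>The energy argument of \<open>invertible_upper\<close> with reversed signs: in
    the lower half-plane the energy increases, and the limiting energy is minus the squared norm of
    \<open>N\<close>.\<close>
  have "invertible (lower (g 0))"
  proof (rule invertible_if_injective)
    fix N :: "complex^'m2^'m2" assume N: "lower (g 0) ** N = 0"
    have "(-1) * energy (last_columns ** N :: complex^'m2^('m1 + 'm2)) \<le> 0"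
    proof (rule energy_limit[where h = "\<lambda>x. g x ** N" and c = "\<lambda>x. exp (- \<i> * of_real x * w)"])
      show "dirac_solution v w (\<lambda>x. mat (exp (- \<i> * of_real x * w)) ** (g x ** N))"
        using dirac_solution_mult_right[OF g(2), of N] by (simp add: matrix_mul_assoc)
      show "((\<lambda>x. g x ** N) \<longlongrightarrow> last_columns ** N) at_top"
        by (intro mm.tendsto g tendsto_const)
      show "(-1) * energy (g 0 ** N) \<le> 0"
        by (simp add: energy_def lower_mult N)
    qed (use w in auto)
    then show "N = 0" by (simp add: energy_def upper_mult lower_mult mm.zero_left)
  qed
  then have "invertible (adj (lower (g 0)))" by (rule invertible_adj)
  then obtain M where M: "M ** adj (lower (g 0)) = mat 1" by (auto simp: invertible_def)
  define h where "h z t = adj (X t) ** (mat (exp (\<i> * of_real t * z)) ** f t z)" for z t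
  obtain K where K: "0 \<le> K" "\<And>(A :: complex^('m1 + 'm2)^'m2) (N :: complex^'m1^('m1 + 'm2)). norm (A ** N) \<le> norm A * norm N * K"
    using mm.nonneg_bounded by blast
  have hle: "norm (adj (X t) ** (A ** (mat (exp (\<i> * of_real t * z)) ** f t z))) \<le> norm (X t) * norm (A ** (mat (exp (\<i> * of_real t * z)) ** f t z)) * K"
    for t z and A :: "complex^('m1 + 'm2)^('m1 + 'm2)"
    using K(2)[of "adj (X t)"] by simp
  have fle: "norm (mat (exp (\<i> * of_real t * z)) ** f t z) \<le> \<bar>\<beta>\<bar>" if "0 \<le> Im z" "0 \<le> t" for t z
  proof -
    have "norm (mat (exp (\<i> * of_real t * z)) ** f t z) \<le> 1 * norm (f t z)"
      unfolding norm_mat_mult norm_exp_i using that by (intro mult_right_mono) auto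
    then show ?thesis using f_bounded[OF that(2,1)] by simp
  qed
  \<comment> \<open>The decay comes from \<open>X\<close> alone and does not depend on
    \<open>z\<close>, so the bound is uniform up to the real line.\<close>
  have hb: "norm (h z t) \<le> \<bar>\<gamma>\<bar> * \<bar>\<beta>\<bar> * K * exp (- Im z0 * t)" if "0 \<le> Im z" "0 \<le> t" for z t
  proof -
    have "norm (h z t) \<le> norm (X t) * norm (mat (exp (\<i> * of_real t * z)) ** f t z) * K"
      using hle[of t "mat 1" z] by (simp add: h_def)
    also have "\<dots> \<le> (\<bar>\<gamma>\<bar> * exp (- Im z0 * t)) * \<bar>\<beta>\<bar> * K"
      using nX fle that K by (intro mult_right_mono mult_mono) auto
    finally show ?thesis by (simp add: mult_ac)
  qed
  have wint: "(\<lambda>t. \<bar>\<gamma>\<bar> * \<bar>\<beta>\<bar> * K * exp (- Im z0 * t)) integrable_on {0..}"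
    by (intro integrable_on_mult_right integrable_on_exp_minus_to_infinity z0)
  have hai: "h z absolutely_integrable_on {0..}" if z: "0 \<le> Im z" for z
  proof (rule measurable_bounded_by_integrable_imp_absolutely_integrable[OF _ _ wint])
    show "h z \<in> borel_measurable (lebesgue_on {0..})"
      unfolding h_def[abs_def]
      by (intro continuous_imp_measurable_on_sets_lebesgue mm.continuous_on
          bounded_linear.continuous_on[OF bounded_linear_adj] dirac_solution_continuous_on[OF X]
          dirac_solution_continuous_on[OF f_solution[OF z]]) simp
    show "norm (h z t) \<le> \<bar>\<gamma>\<bar> * \<bar>\<beta>\<bar> * K * exp (- Im z0 * t)" if "t \<in> {0..}" for t
      using hb[OF z] that by simp
  qed simp
  define G where "G z = integral {0..} (h z)" for z
  have "continuous_on ({0..} \<times> {z. 0 \<le> Im z}) (\<lambda>(x,z). integral {x..} (h z))"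
  proof (rule continuous_on_tail_integral[OF _ wint])
    show "continuous_on {z. 0 \<le> Im z} (\<lambda>z. h z t)" if "0 \<le> t" for t
      unfolding h_def
      by (intro mm.continuous_on continuous_on_const f_continuous_z that
          bounded_linear.continuous_on[OF bounded_linear_mat] continuous_intros)
  qed (use hai hb in auto)
  then have "continuous_on {z. 0 \<le> Im z} (\<lambda>z. case (0, z) of (x,z) \<Rightarrow> integral {x..} (h z))"
    by (rule continuous_on_compose2) (auto intro!: continuous_intros)
  then have G: "continuous_on {z. 0 \<le> Im z} G" by (simp add: G_def[abs_def])
  have main: "mat (\<i> * (z - z0)) ** G z = - (adj (g 0) ** (dirac_j ** f 0 z))" if z: "0 \<le> Im z" for z
  proof -
    let ?Y = "\<lambda>x. mat (exp (\<i> * of_real x * z)) ** f x z"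
    have hc: "(\<lambda>x. mat (\<i> * (z - z0)) ** h z x) absolutely_integrable_on {0..}"
      by (rule absolutely_integrable_const_mult[OF hai[OF z]])
    have lim1: "((\<lambda>b. integral {0..b} (\<lambda>x. mat (\<i> * (z - z0)) ** h z x)) \<longlongrightarrow> integral {0..} (\<lambda>x. mat (\<i> * (z - z0)) ** h z x)) at_top"
      by (rule tendsto_integral_halfline[OF hc])
    have eq1: "integral {0..} (\<lambda>x. mat (\<i> * (z - z0)) ** h z x) = mat (\<i> * (z - z0)) ** G z"
      using integral_linear[OF set_lebesgue_integral_eq_integral(1)[OF hai[OF z]] mm.bounded_linear_right[of "mat (\<i> * (z - z0))"]]
      by (simp add: o_def G_def)
    have ev: "\<forall>\<^sub>F b in at_top. integral {0..b} (\<lambda>x. mat (\<i> * (z - z0)) ** h z x) = adj (X b) ** (dirac_j ** ?Y b) - adj (g 0) ** (dirac_j ** f 0 z)"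
      using eventually_ge_at_top[of 0]
    proof eventually_elim
      case (elim b)
      show ?case
        using wronskian[OF X f_solution[OF z] order_refl elim] by (simp add: integral_unique w_def h_def X0)
    qed
    obtain K' where K': "0 \<le> K'" "\<And>(A :: complex^('m1 + 'm2)^('m1 + 'm2)) (N :: complex^'m1^('m1 + 'm2)). norm (A ** N) \<le> norm A * norm N * K'"
      using mm.nonneg_bounded by blast
    \<comment> \<open>The boundary term at infinity is a decaying factor times a bounded
      one.\<close>
    have lim2: "((\<lambda>b. adj (X b) ** (dirac_j ** ?Y b)) \<longlongrightarrow> 0) at_top"
    proof (rule Lim_null_comparison)
      let ?c = "\<bar>\<gamma>\<bar> * (norm (dirac_j :: complex^('m1 + 'm2)^('m1 + 'm2)) * \<bar>\<beta>\<bar> * K') * K"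
      have "((\<lambda>b. exp (- Im z0 * b)) \<longlongrightarrow> 0) at_top" using z0 by real_asymp
      then show "((\<lambda>b. ?c * exp (- Im z0 * b)) \<longlongrightarrow> 0) at_top" by (rule tendsto_mult_right_zero)
      show "\<forall>\<^sub>F b in at_top. norm (adj (X b) ** (dirac_j ** ?Y b)) \<le> ?c * exp (- Im z0 * b)"
        using eventually_ge_at_top[of 0]
      proof eventually_elim
        case (elim b)
        have "norm (dirac_j ** ?Y b) \<le> norm (dirac_j :: complex^('m1 + 'm2)^('m1 + 'm2)) * norm (?Y b) * K'" by (rule K')
        also have "\<dots> \<le> norm (dirac_j :: complex^('m1 + 'm2)^('m1 + 'm2)) * \<bar>\<beta>\<bar> * K'"
          using fle[OF z elim] K' by (intro mult_right_mono mult_left_mono) auto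
        finally have jY: "norm (dirac_j ** ?Y b) \<le> norm (dirac_j :: complex^('m1 + 'm2)^('m1 + 'm2)) * \<bar>\<beta>\<bar> * K'" .
        have "norm (adj (X b) ** (dirac_j ** ?Y b)) \<le> norm (X b) * norm (dirac_j ** ?Y b) * K"
          by (rule hle)
        also have "\<dots> \<le> (\<bar>\<gamma>\<bar> * exp (- Im z0 * b)) * (norm (dirac_j :: complex^('m1 + 'm2)^('m1 + 'm2)) * \<bar>\<beta>\<bar> * K') * K"
          using nX[OF elim] jY K by (intro mult_right_mono mult_mono) auto
        finally show ?case by (simp add: mult_ac)
      qed
    qed
    have "((\<lambda>b. adj (X b) ** (dirac_j ** ?Y b) - adj (g 0) ** (dirac_j ** f 0 z)) \<longlongrightarrow> 0 - adj (g 0) ** (dirac_j ** f 0 z)) at_top"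
      by (intro tendsto_diff lim2 tendsto_const)
    moreover have "((\<lambda>b. adj (X b) ** (dirac_j ** ?Y b) - adj (g 0) ** (dirac_j ** f 0 z)) \<longlongrightarrow> mat (\<i> * (z - z0)) ** G z) at_top"
      by (rule Lim_transform_eventually[OF lim1[unfolded eq1] ev])
    ultimately have "0 - adj (g 0) ** (dirac_j ** f 0 z) = mat (\<i> * (z - z0)) ** G z"
      using tendsto_unique trivial_limit_at_top_linorder by blast
    then show ?thesis by simp
  qed
  define P where "P z = G z ** matrix_inv (upper (f 0 z))" for z
  have P: "mat (\<i> * (z - z0)) ** P z = adj (lower (g 0)) ** R z - adj (upper (g 0))" if z: "0 \<le> Im z" for z
  proof -
    have "mat (\<i> * (z - z0)) ** P z = - (adj (g 0) ** (dirac_j ** (f 0 z ** matrix_inv (upper (f 0 z)))))"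
      unfolding P_def matrix_mul_assoc main[OF z, unfolded matrix_mul_assoc] by (simp add: mm.minus_left)
    then show ?thesis
      unfolding f_mult_inv[OF z] adj_mult_split by (simp add: mm.minus_right)
  qed
  \<comment> \<open>At \<open>z = z0\<close> the left side of \<open>P\<close> vanishes. This
    expresses the unknown upper block of \<open>g 0\<close> through \<open>R z0\<close> and produces
    the difference \<open>R z - R z0\<close>.\<close>
  have "adj (upper (g 0)) = adj (lower (g 0)) ** R z0" using P[of z0] z0 by simp
  then have inc: "mat (\<i> * (z - z0)) ** P z = adj (lower (g 0)) ** (R z - R z0)" if "0 \<le> Im z" for z
    using P[OF that] by (simp add: mm.diff_right)
  show thesis
  proof (rule that[of "\<lambda>z. M ** P z"])
    show "continuous_on {z. 0 \<le> Im z} (\<lambda>z. M ** P z)"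
      unfolding P_def by (intro mm.continuous_on continuous_on_const G continuous_on_inv)
    show "R z - R z0 = mat (\<i> * (z - z0)) ** (M ** P z)" if "0 \<le> Im z" for z
    proof -
      have "mat (\<i> * (z - z0)) ** (M ** P z) = M ** (mat (\<i> * (z - z0)) ** P z)"
        by (simp add: mult_mat_left_comm[of M])
      also have "\<dots> = (M ** adj (lower (g 0))) ** (R z - R z0)"
        by (simp add: inc[OF that] matrix_mul_assoc)
      finally show ?thesis by (simp add: M)
    qed
  qed
qed

lemma R_holomorphic: "(\<lambda>z. R z $ i $ k) holomorphic_on {z. 0 < Im z}"
  unfolding holomorphic_on_def
proof (intro ballI)
  fix z0 :: complex assume "z0 \<in> {z. 0 < Im z}"
  then have z0: "0 < Im z0" by simp
  obtain Q where Q: "continuous_on {z. 0 \<le> Im z} Q" "\<And>z. 0 \<le> Im z \<Longrightarrow> R z - R z0 = mat (\<i> * (z - z0)) ** Q z"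
    using R_increment[OF z0] by blast
  have "(Q \<longlongrightarrow> Q z0) (at z0 within {z. 0 \<le> Im z})"
    using Q(1) z0 by (simp add: continuous_on_def)
  then have "(Q \<longlongrightarrow> Q z0) (at z0 within {z. 0 < Im z})"
    by (rule tendsto_within_subset) auto
  then have lim: "((\<lambda>z. \<i> * Q z $ i $ k) \<longlongrightarrow> \<i> * Q z0 $ i $ k) (at z0 within {z. 0 < Im z})"
    by (intro tendsto_intros)
  have "((\<lambda>z. R z $ i $ k) has_field_derivative \<i> * Q z0 $ i $ k) (at z0 within {z. 0 < Im z})"
    unfolding has_field_derivative_iff
  proof (rule Lim_transform_eventually[OF lim])
    show "\<forall>\<^sub>F z in at z0 within {z. 0 < Im z}. \<i> * Q z $ i $ k = (R z $ i $ k - R z0 $ i $ k) / (z - z0)"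
      unfolding eventually_at_filter
    proof (intro always_eventually allI impI)
      fix z assume z: "z \<noteq> z0" "z \<in> {z. 0 < Im z}"
      have "(R z - R z0) $ i $ k = \<i> * (z - z0) * Q z $ i $ k"
        using z by (subst Q(2)) (auto simp: mat_mult_nth)
      then show "\<i> * Q z $ i $ k = (R z $ i $ k - R z0 $ i $ k) / (z - z0)" using z by simp
    qed
  qed
  then show "(\<lambda>z. R z $ i $ k) field_differentiable at z0 within {z. 0 < Im z}"
    by (auto simp: field_differentiable_def)
qed

section \<open>The extension property and the identification with the Weyl function\<close>

lemma R_extension: "is_continuous_analytic_extension (reflection_coefficient v) R"
  unfolding is_continuous_analytic_extension_def
  using R_continuous_on R_holomorphic reflection_coefficient_eq by auto

lemma adj_vstack_one: "hstack (mat 1) (adj A) = adj (vstack (mat 1) A)"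
  unfolding vec_eq_iff
proof (intro allI)
  fix i k show "hstack (mat 1) (adj A) $ i $ k = adj (vstack (mat 1) A) $ i $ k"
    by (cases k) (simp_all add: mat_def)
qed

lemma weyl_integrand: "hstack (mat 1) (adj A) ** adj U ** U ** vstack (mat 1) A = adj (U ** vstack (mat 1) A) ** (U ** vstack (mat 1) A)"
  by (simp add: adj_vstack_one adj_mult matrix_mul_assoc)

lemma R_is_weyl:
  assumes "\<And>z. 0 < Im z \<Longrightarrow> \<phi> z = R z"
  shows "is_weyl_function v \<phi>"
  unfolding is_weyl_function_def
proof (intro allI impI)
  fix z assume z: "0 < Im z"
  obtain u where u: "fundamental_solution v z u" "u 0 = mat 1"
    using fundamental_solution_exists[OF V] by blast
  \<comment> \<open>Both sides solve the system with initial value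
    \<open>vstack (mat 1) (R z)\<close>, so square integrability of \<open>W\<close> transfers to
    the Weyl integrand.\<close>
  have eq: "W x z = u x ** vstack (mat 1) (R z)" if "0 \<le> x" for x
  proof (rule dirac_solution_unique[OF V _ _ _ that])
    show "dirac_solution v z (\<lambda>x. u x ** vstack (mat 1) (R z))"
      using u by (intro dirac_solution_mult_right) (simp add: fundamental_solution_def)
  qed (use z W_solution W_0 u in auto)
  have "(\<lambda>x. hstack (mat 1) (adj (\<phi> z)) ** adj (u x) ** u x ** vstack (mat 1) (\<phi> z)) absolutely_integrable_on {0..}
    \<longleftrightarrow> (\<lambda>x. adj (W x z) ** W x z) absolutely_integrable_on {0..}"
    unfolding weyl_integrand assms[OF z] by (rule set_integrable_cong) (auto simp: eq)
  then show "\<exists>u. fundamental_solution v z u \<and> u 0 = mat 1 \<and>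
    (\<lambda>x. hstack (mat 1) (adj (\<phi> z)) ** adj (u x) ** u x ** vstack (mat 1) (\<phi> z)) absolutely_integrable_on {0..}"
    using u W_square_integrable[OF z] by blast
qed

lemma norm_sq_integrable:
  fixes y :: "real \<Rightarrow> complex^'m1^('m1 + 'm2)"
  assumes "(\<lambda>x. adj (y x) ** y x) absolutely_integrable_on {0..}"
  shows "(\<lambda>x. (norm (y x))\<^sup>2) absolutely_integrable_on {0..}"
  using absolutely_integrable_linear[OF assms bounded_linear_re_trace] by (simp add: o_def re_trace_adj_mult)

text \<open>
  The difference of two square integrable solutions would start with negative energy, which
  can only decrease; its norm would be bounded away from $0$.
\<close>

lemma weyl_is_R:
  assumes \<phi>: "is_weyl_function v \<phi>" and z: "0 < Im z"
  shows "\<phi> z = R z"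
proof -
  obtain u where u: "fundamental_solution v z u" "u 0 = mat 1"
    "(\<lambda>x. adj (u x ** vstack (mat 1) (\<phi> z)) ** (u x ** vstack (mat 1) (\<phi> z))) absolutely_integrable_on {0..}"
    using \<phi> z unfolding is_weyl_function_def weyl_integrand by blast
  define y where "y x = u x ** vstack (mat 1) (\<phi> z)" for x
  define d where "d x = y x - W x z" for x
  have d: "dirac_solution v z d"
    unfolding d_def[abs_def] y_def using u(1) z
    by (intro dirac_solution_diff dirac_solution_mult_right W_solution) (auto simp: fundamental_solution_def)
  define \<delta> where "\<delta> = (norm (\<phi> z - R z))\<^sup>2"
  \<comment> \<open>Both solutions start with the identity as upper block; in the difference only
    the lower block survives, hence the negative sign.\<close>
  have e0: "energy (d 0) = - \<delta>"
    using z by (simp add: d_def y_def u(2) W_0 energy_def \<delta>_def)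
  have dlow: "\<delta> \<le> (norm (d x))\<^sup>2" if "0 \<le> x" for x
  proof -
    have "energy (d x) \<le> - \<delta>"
      using energy_mono[OF d order_refl that, of 1] z e0 by simp
    moreover have "- (norm (d x))\<^sup>2 \<le> energy (d x)"
      unfolding energy_def norm_sq_split by simp
    ultimately show ?thesis by linarith
  qed
  \<comment> \<open>An integrable majorant for the squared norm of the difference, by the inequality
    (a + b)^2 <= 2 a^2 + 2 b^2.\<close>
  define s where "s x = 2 * (norm (y x))\<^sup>2 + 2 * (norm (W x z))\<^sup>2" for x
  have s: "s absolutely_integrable_on {0..}"
    unfolding s_def[abs_def] using u(3) W_square_integrable[OF z]
    by (intro set_integral_add set_integrable_mult_right norm_sq_integrable) (simp_all add: y_def)
  have ds: "\<delta> \<le> s x" if "0 \<le> x" for x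
  proof -
    have "(norm (d x))\<^sup>2 \<le> (norm (y x) + norm (W x z))\<^sup>2"
      unfolding d_def by (intro power_mono norm_triangle_ineq4) simp
    also have "\<dots> \<le> s x"
      using sum_squares_bound[of "norm (y x)" "norm (W x z)"] by (simp add: s_def power2_sum)
    finally show ?thesis using dlow[OF that] by simp
  qed
  have si: "s integrable_on {0..}" "s integrable_on {0..b}" for b
    using s absolutely_integrable_tail(2)[OF s order_refl] set_lebesgue_integral_eq_integral(1) by blast+
  \<comment> \<open>A positive constant lower bound would make the integral of \<open>s\<close> over
    the half-line infinite.\<close>
  have "\<delta> * real n \<le> integral {0..} s" for n
  proof -
    have "\<delta> * real n = integral {0..real n} (\<lambda>x. \<delta>)" by simp
    also have "\<dots> \<le> integral {0..real n} s"
      by (rule integral_le) (use si ds in auto)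
    also have "\<dots> \<le> integral {0..} s"
      by (rule integral_subset_le) (use si in \<open>auto simp: s_def\<close>)
    finally show ?thesis .
  qed
  then have "\<not> 0 < \<delta>" using reals_Archimedean3[of \<delta>] by (metis mult.commute not_le)
  then have "\<delta> = 0" by (simp add: \<delta>_def)
  then show ?thesis by (simp add: \<delta>_def)
qed

end

section \<open>Uniqueness of the continuous analytic extension\<close>

lemma holomorphic_zero_boundary:
  assumes hol: "f holomorphic_on {z. 0 < Im z}" and cont: "continuous_on {z. 0 \<le> Im z} f"
    and real: "\<And>t::real. f (of_real t) = 0" and z: "0 \<le> Im z"
  shows "f z = 0"
proof -
  \<comment> \<open>Reflection requires real boundary values, and 0 is real. The result is entire,
    and its zeros on the real line accumulate at 0.\<close>
  define F where "F z = (if 0 \<le> Im z then f z else cnj (f (cnj z)))" for z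
  have hol: "F holomorphic_on UNIV"
    unfolding F_def[abs_def]
    by (rule Schwarz_reflection) (use hol cont real in \<open>auto simp: Reals_def\<close>)
  have lim: "(0::complex) islimpt range complex_of_real"
    unfolding islimpt_approachable
  proof (intro allI impI)
    fix e :: real assume "e > 0"
    show "\<exists>x'\<in>range complex_of_real. x' \<noteq> 0 \<and> dist x' 0 < e"
    proof (intro bexI conjI)
      show "complex_of_real (e/2) \<noteq> 0" "dist (complex_of_real (e/2)) 0 < e"
        using \<open>e > 0\<close> by (auto simp: norm_divide)
    qed (rule rangeI)
  qed
  have "F z = 0"
    by (rule analytic_continuation[OF hol open_UNIV connected_UNIV subset_UNIV UNIV_I lim]) (use real in \<open>auto simp: F_def\<close>)
  then show ?thesis using z by (simp add: F_def)
qed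

lemma continuous_analytic_extension_unique:
  assumes R: "is_continuous_analytic_extension r R" and R': "is_continuous_analytic_extension r R'"
    and z: "0 \<le> Im z"
  shows "R' z = R z"
proof -
  have "R' z $ i $ k - R z $ i $ k = 0" for i k
  proof (rule holomorphic_zero_boundary[OF _ _ _ z])
    show "(\<lambda>z. R' z $ i $ k - R z $ i $ k) holomorphic_on {z. 0 < Im z}"
      using R R' by (intro holomorphic_on_diff) (auto simp: is_continuous_analytic_extension_def)
    show "continuous_on {z. 0 \<le> Im z} (\<lambda>z. R' z $ i $ k - R z $ i $ k)"
      using R R' by (intro continuous_intros) (auto simp: is_continuous_analytic_extension_def)
    show "R' (of_real t) $ i $ k - R (of_real t) $ i $ k = 0" for t :: real
      using R R' by (simp add: is_continuous_analytic_extension_def)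
  qed
  then show ?thesis by (simp add: vec_eq_iff)
qed

text \<open>Only the values on the open half-plane matter for a Weyl function. The final equivalence
  thus contains existence, uniqueness there and equality with \<open>R\<close> all at once.\<close>

theorem theorem3p4:
  fixes v :: "real \<Rightarrow> complex^('m2::finite)^('m1::finite)"
  assumes V_L1: "\<And>i k. (\<lambda>x. potential v x $ i $ k) absolutely_integrable_on {0..}"
  shows "(\<forall>z::real. reflection_coefficient_exists v z) \<and>
    (\<exists>R. is_continuous_analytic_extension (reflection_coefficient v) R \<and>
         (\<forall>R'. is_continuous_analytic_extension (reflection_coefficient v) R' \<longrightarrow>
            (\<forall>z. 0 \<le> Im z \<longrightarrow> R' z = R z)) \<and>
         (\<forall>\<phi>. is_weyl_function v \<phi> \<longleftrightarrow> (\<forall>z. 0 < Im z \<longrightarrow> \<phi> z = R z)))"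
proof -
  have V: "potential v absolutely_integrable_on {0..}"
    by (rule absolutely_integrable_entrywise[OF V_L1])
  show ?thesis
  proof (rule upper_weyl_family[OF V])
    fix f :: "real \<Rightarrow> complex \<Rightarrow> complex^'m1^('m1 + 'm2)" and \<beta>
    assume "continuous_on ({0..} \<times> {z. 0 \<le> Im z}) (\<lambda>(x,z). f x z)"
      "\<And>x z. \<lbrakk>0 \<le> x; 0 \<le> Im z\<rbrakk> \<Longrightarrow> norm (f x z) \<le> \<beta>"
      "\<And>z. 0 \<le> Im z \<Longrightarrow> dirac_solution v z (\<lambda>x. mat (exp (\<i> * of_real x * z)) ** f x z)"
      "\<And>z. 0 \<le> Im z \<Longrightarrow> ((\<lambda>x. f x z) \<longlongrightarrow> first_columns) at_top"
    then interpret weyl_family v f \<beta> by unfold_locales (use V in auto)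
    show ?thesis
      using reflection_coefficient_exists R_extension continuous_analytic_extension_unique[OF R_extension]
        R_is_weyl weyl_is_R by blast
  qed
qed

end
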